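(* Let $\mu$ be a measurable cardinal, $U$ a normal ultrafilter over $\mu$, and $\mathcal{P}_U$ the Prikry forcing. Each of the following statements, if it holds in $V$, is forced by $\mathcal{P}_U$ to hold: (1) $\begin{pmatrix}\mu^{++}\\ \mu^{+}\end{pmatrix}\to\begin{pmatrix} n\\ \mu^{+}\end{pmatrix}^{1,1}_{\mu}$, for each $n<\omega$; (2) $\begin{pmatrix}\mu^{++}\\ \mu^{+}\end{pmatrix}\to\begin{pmatrix} \nu\\ \mu^{+}\end{pmatrix}^{1,1}_{\mu}$, for each regular $\nu<\mu$; (3) $\begin{pmatrix}\mu^{++}\\ \mu^{+}\end{pmatrix}\not\to\begin{pmatrix} n\\ \mu^{+}\end{pmatrix}^{1,1}_{\mu}$, for each $n<\omega$; (4) $\begin{pmatrix}\mu^{++}\\ \mu^{+}\end{pmatrix}\not\to\begin{pmatrix} \nu\\ \mu^{+}\end{pmatrix}^{1,1}_{\mu}$, for each regular $\nu<\mu$; (5) $\begin{pmatrix}\mu^{++}\\ \mu^{+}\end{pmatrix}\not\to\begin{pmatrix} \mu^{+}\\ \mu^{+}\end{pmatrix}^{1,1}_{\mu}$.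
   Context: The polarized partition relation $\begin{pmatrix}\kappa_0\\ \kappa_1\end{pmatrix}\to\begin{pmatrix}\lambda_0\\ \lambda_1\end{pmatrix}^{1,1}_{\theta}$ means: for every $f:\kappa_0\times\kappa_1\to\theta$ there are $H_0\in[\kappa_0]^{\lambda_0}$ and $H_1\in[\kappa_1]^{\lambda_1}$ with $|f``(H_0\times H_1)|\le1$; $\not\to$ denotes its negation. Prikry forcing $\mathcal{P}_U$: conditions $\langle a,X\rangle$ with $a\in[\mu]^{<\omega}$, $X\in U$; $\langle a,X\rangle\le\langle b,Y\rangle$ iff $a\cap(\max b+1)=b$ and $(a\setminus b)\cup X\subseteq Y$. *)

theory Defs
  imports Main "HOL-Library.Countable_Set"
begin

section \<open>The set-theoretic universe\<close>

text \<open>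
  A type of class \<open>zfc\<close> plays the role of the ground universe V: its elements are the sets, and
  \<open>elts x\<close> is the HOL set of all members of \<open>x\<close>. As usual for set theory inside HOL, the two
  axiom schemes are stated for arbitrary HOL predicates and functions.
\<close>

class zfc =
  fixes elts :: "'a \<Rightarrow> 'a set"
  assumes zfc_extensionality: "elts x = elts y \<Longrightarrow> x = y"
    and zfc_foundation: "elts x \<noteq> {} \<Longrightarrow> \<exists>y\<in>elts x. elts y \<inter> elts x = {}"
    and zfc_pairing: "\<exists>z. elts z = {x, y}"
    and zfc_union: "\<exists>z. elts z = \<Union> (elts ` elts x)"
    and zfc_power: "\<exists>z. elts z = {y. elts y \<subseteq> elts x}"
    and zfc_infinity:
      "\<exists>w. (\<exists>e\<in>elts w. elts e = {}) \<and> (\<forall>y\<in>elts w. \<exists>s\<in>elts w. elts s = insert y (elts y))"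
    and zfc_separation: "\<exists>z. elts z = {y \<in> elts x. P y}"
    and zfc_replacement: "\<exists>z. elts z = F ` elts x"
    and zfc_choice:
      "\<lbrakk>\<forall>y\<in>elts x. elts y \<noteq> {};
        \<forall>y\<in>elts x. \<forall>z\<in>elts x. y \<noteq> z \<longrightarrow> elts y \<inter> elts z = {}\<rbrakk>
       \<Longrightarrow> \<exists>c. \<forall>y\<in>elts x. \<exists>!z. z \<in> elts c \<inter> elts y"

text \<open>Meaningful only if some set has exactly the members \<open>A\<close>.\<close>

definition set_of :: "'v::zfc set \<Rightarrow> 'v" where
  "set_of A = (THE x. elts x = A)"

definition vpair :: "'v::zfc \<Rightarrow> 'v \<Rightarrow> 'v" where
  "vpair x y = set_of {set_of {x}, set_of {x, y}}"

fun vnat :: "nat \<Rightarrow> 'v::zfc" where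
  "vnat 0 = set_of {}"
| "vnat (Suc n) = set_of (insert (vnat n) (elts (vnat n)))"

lemma elts_set_of: "elts z = A \<Longrightarrow> elts (set_of A) = A"
  for z :: "'v::zfc"
  unfolding set_of_def by (rule theI[of "\<lambda>x. elts x = A" z]) (auto intro: zfc_extensionality)

lemma elts_empty [simp]: "elts (set_of {} :: 'v::zfc) = {}"
proof -
  obtain z :: 'v where "elts z = {y \<in> elts undefined. False}"
    using zfc_separation[of undefined "\<lambda>_. False"] by blast
  then show ?thesis by (intro elts_set_of[of z]) simp
qed

lemma elts_upair [simp]: "elts (set_of {x, y}) = {x, y}"
  for x y :: "'v::zfc"
  using zfc_pairing[of x y] elts_set_of by blast

lemma elts_singleton [simp]: "elts (set_of {x}) = {x}"
  for x :: "'v::zfc"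
  using elts_upair[of x x] by simp

lemma elts_image [simp]: "elts (set_of (F ` elts x)) = F ` elts x"
  for x :: "'v::zfc" and F :: "'v \<Rightarrow> 'v"
  using zfc_replacement[of F x] elts_set_of by blast

lemma elts_Union [simp]: "elts (set_of (\<Union> (elts ` elts x))) = \<Union> (elts ` elts x)"
  for x :: "'v::zfc"
  using zfc_union[of x] elts_set_of by blast

lemma elts_insert [simp]: "elts (set_of (insert y (elts x))) = insert y (elts x)"
  for x y :: "'v::zfc"
proof -
  have "\<Union> (elts ` elts (set_of {x, set_of {y}})) = insert y (elts x)" by auto
  then show ?thesis using elts_Union[of "set_of {x, set_of {y}}"] by metis
qed

lemma vpair_inject [simp]: "vpair a b = vpair c d \<longleftrightarrow> a = c \<and> b = d"
  for a b c d :: "'v::zfc"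
proof
  assume "vpair a b = vpair c d"
  then have "elts (vpair a b) = elts (vpair c d)" by simp
  then have "{set_of {a}, set_of {a, b}} = {set_of {c}, set_of {c, d}}"
    by (simp add: vpair_def)
  then have "elts ` {set_of {a}, set_of {a, b}} = elts ` {set_of {c}, set_of {c, d}}" by (rule arg_cong)
  then have "{{a}, {a, b}} = {{c}, {c, d}}" by simp
  then show "a = c \<and> b = d" by (auto simp: doubleton_eq_iff)
qed simp

lemma elts_not_refl: "x \<notin> elts x"
  for x :: "'v::zfc"
  using zfc_foundation[of "set_of {x}"] by auto

lemma elts_vnat: "elts (vnat n :: 'v::zfc) = vnat ` {..<n}"
proof (induction n)
  case (Suc n)
  have "elts (vnat (Suc n) :: 'v) = insert (vnat n) (elts (vnat n))"
    by (simp only: vnat.simps elts_insert)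
  then show ?case using Suc by (simp add: lessThan_Suc)
qed simp

lemma inj_vnat: "inj (vnat :: nat \<Rightarrow> 'v::zfc)"
proof (rule linorder_injI)
  fix m n :: nat assume "m < n"
  then have "(vnat m :: 'v) \<in> elts (vnat n)" by (auto simp: elts_vnat)
  then show "(vnat m :: 'v) \<noteq> vnat n" using elts_not_refl by metis
qed

lemma range_small: "\<exists>z. elts z = range f"
  for f :: "nat \<Rightarrow> 'v::zfc"
proof -
  obtain w :: 'v where e: "\<exists>e\<in>elts w. elts e = {}"
    and s: "\<forall>y\<in>elts w. \<exists>s\<in>elts w. elts s = insert y (elts y)"
    using zfc_infinity by blast
  have w: "vnat n \<in> elts w" for n
  proof (induction n)
    case 0
    then show ?case using e zfc_extensionality elts_empty by (metis vnat.simps(1))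
  next
    case (Suc n)
    then show ?case using s zfc_extensionality elts_insert by (metis vnat.simps(2))
  qed
  define g where "g y = f (inv vnat y)" for y :: 'v
  obtain u :: 'v where u: "elts u = {y \<in> elts w. y \<in> range vnat}"
    using zfc_separation[of w "\<lambda>y. y \<in> range vnat"] by blast
  have "elts u = range vnat" using u w by auto
  then have "g ` elts u = range f" by (simp add: g_def inj_vnat image_image)
  then show ?thesis using zfc_replacement[of g u] by metis
qed

lemma wf_elts: "wf {(x, y :: 'v::zfc). x \<in> elts y}"
proof (rule wfI_min)
  fix x :: 'v and Q assume "x \<in> Q"
  define t where "t n = ((\<lambda>y. set_of (\<Union> (elts ` elts y))) ^^ n) (set_of {x})" for n
  obtain r where r: "elts r = range t" using range_small by blast
  define T where "T = set_of (\<Union> (elts ` elts r))"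
  have T: "elts T = (\<Union>n. elts (t n))" using elts_Union[of r] unfolding T_def r by simp
  have "elts (t (Suc n)) = \<Union> (elts ` elts (t n))" for n by (simp add: t_def)
  then have step: "z \<in> elts T" if "y \<in> elts T" "z \<in> elts y" for y z
    using that unfolding T by blast
  have x: "x \<in> elts T" unfolding T by (rule UN_I[of 0]) (auto simp: t_def)
  obtain m where m: "elts m = {y \<in> elts T. y \<in> Q}"
    using zfc_separation[of T "\<lambda>y. y \<in> Q"] by blast
  then have "elts m \<noteq> {}" using x \<open>x \<in> Q\<close> by auto
  then obtain y where y: "y \<in> elts m" "elts y \<inter> elts m = {}" using zfc_foundation[of m] by blast
  have "y \<in> Q" using y m by auto
  moreover have "z \<notin> Q" if "z \<in> elts y" for z using y m step[of y z] that by auto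
  ultimately show "\<exists>y\<in>Q. \<forall>z. (z, y) \<in> {(x, y). x \<in> elts y} \<longrightarrow> z \<notin> Q"
    by auto
qed


section \<open>Formulas of set theory\<close>

text \<open>
  Quantifiers bind HOL variables and parameters occur directly in the formula. All formulas
  below are given by uniform definitions that do not inspect their parameters, so each of them
  is an ordinary first-order formula of the language of set theory. It can be read in V, with
  sets as parameters, or in the forcing language, with names as parameters.
\<close>

datatype 'v fm =
    Mem 'v 'v
  | Eql 'v 'v
  | Neg "'v fm"
  | Conj "'v fm" "'v fm"
  | Forall "'v \<Rightarrow> 'v fm"

definition Disj :: "'v fm \<Rightarrow> 'v fm \<Rightarrow> 'v fm" where
  "Disj \<phi> \<psi> = Neg (Conj (Neg \<phi>) (Neg \<psi>))"

definition Imp :: "'v fm \<Rightarrow> 'v fm \<Rightarrow> 'v fm" where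
  "Imp \<phi> \<psi> = Neg (Conj \<phi> (Neg \<psi>))"

definition Iff :: "'v fm \<Rightarrow> 'v fm \<Rightarrow> 'v fm" where
  "Iff \<phi> \<psi> = Conj (Imp \<phi> \<psi>) (Imp \<psi> \<phi>)"

definition Exists :: "('v \<Rightarrow> 'v fm) \<Rightarrow> 'v fm" where
  "Exists F = Neg (Forall (\<lambda>x. Neg (F x)))"

definition All_in :: "'v \<Rightarrow> ('v \<Rightarrow> 'v fm) \<Rightarrow> 'v fm" where
  "All_in a F = Forall (\<lambda>x. Imp (Mem x a) (F x))"

definition Ex_in :: "'v \<Rightarrow> ('v \<Rightarrow> 'v fm) \<Rightarrow> 'v fm" where
  "Ex_in a F = Exists (\<lambda>x. Conj (Mem x a) (F x))"

primrec holds :: "'v::zfc fm \<Rightarrow> bool" where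
  "holds (Mem x y) \<longleftrightarrow> x \<in> elts y"
| "holds (Eql x y) \<longleftrightarrow> x = y"
| "holds (Neg \<phi>) \<longleftrightarrow> \<not> holds \<phi>"
| "holds (Conj \<phi> \<psi>) \<longleftrightarrow> holds \<phi> \<and> holds \<psi>"
| "holds (Forall F) \<longleftrightarrow> (\<forall>x. holds (F x))"

definition subset_fm :: "'v \<Rightarrow> 'v \<Rightarrow> 'v fm" where
  "subset_fm x y = All_in x (\<lambda>z. Mem z y)"

definition upair_fm :: "'v \<Rightarrow> 'v \<Rightarrow> 'v \<Rightarrow> 'v fm"  \<comment> \<open>\<open>z = {x, y}\<close>\<close> where
  "upair_fm z x y = Forall (\<lambda>u. Iff (Mem u z) (Disj (Eql u x) (Eql u y)))"

definition pair_fm :: "'v \<Rightarrow> 'v \<Rightarrow> 'v \<Rightarrow> 'v fm"  \<comment> \<open>\<open>z = \<langle>x, y\<rangle>\<close>\<close> where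
  "pair_fm z x y = Forall (\<lambda>u. Iff (Mem u z) (Disj (upair_fm u x x) (upair_fm u x y)))"

definition pair_in_fm :: "'v \<Rightarrow> 'v \<Rightarrow> 'v \<Rightarrow> 'v fm"  \<comment> \<open>\<open>\<langle>x, y\<rangle> \<in> f\<close>\<close> where
  "pair_in_fm x y f = Ex_in f (\<lambda>z. pair_fm z x y)"

definition prod_fm :: "'v \<Rightarrow> 'v \<Rightarrow> 'v \<Rightarrow> 'v fm"  \<comment> \<open>\<open>d = a \<times> b\<close>\<close> where
  "prod_fm d a b =
     Forall (\<lambda>z. Iff (Mem z d) (Ex_in a (\<lambda>x. Ex_in b (\<lambda>y. pair_fm z x y))))"

definition function_fm :: "'v \<Rightarrow> 'v \<Rightarrow> 'v \<Rightarrow> 'v fm"  \<comment> \<open>\<open>f : a \<rightarrow> b\<close>\<close> where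
  "function_fm f a b =
     Conj (All_in f (\<lambda>z. Ex_in a (\<lambda>x. Ex_in b (\<lambda>y. pair_fm z x y))))
          (All_in a (\<lambda>x. Ex_in b (\<lambda>y.
             Conj (pair_in_fm x y f) (All_in b (\<lambda>y'. Imp (pair_in_fm x y' f) (Eql y' y))))))"

definition bijection_fm :: "'v \<Rightarrow> 'v \<Rightarrow> 'v \<Rightarrow> 'v fm" where
  "bijection_fm f a b =
     Conj (function_fm f a b)
          (All_in b (\<lambda>y. Ex_in a (\<lambda>x.
             Conj (pair_in_fm x y f) (All_in a (\<lambda>x'. Imp (pair_in_fm x' y f) (Eql x' x))))))"

definition equinumerous_fm :: "'v \<Rightarrow> 'v \<Rightarrow> 'v fm" where
  "equinumerous_fm a b = Exists (\<lambda>f. bijection_fm f a b)"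

definition transitive_fm :: "'v \<Rightarrow> 'v fm" where
  "transitive_fm x = All_in x (\<lambda>y. subset_fm y x)"

definition ordinal_fm :: "'v \<Rightarrow> 'v fm" where
  "ordinal_fm x = Conj (transitive_fm x) (All_in x transitive_fm)"

definition cardinal_fm :: "'v \<Rightarrow> 'v fm" where
  "cardinal_fm k = Conj (ordinal_fm k) (All_in k (\<lambda>a. Neg (equinumerous_fm a k)))"

definition succ_cardinal_fm :: "'v \<Rightarrow> 'v \<Rightarrow> 'v fm"  \<comment> \<open>\<open>l\<close> is the least cardinal above \<open>k\<close>\<close> where
  "succ_cardinal_fm l k =
     Conj (Conj (cardinal_fm l) (Mem k l))
          (All_in l (\<lambda>d. Neg (Conj (cardinal_fm d) (Mem k d))))"

definition subset_of_size_fm :: "'v \<Rightarrow> 'v \<Rightarrow> 'v \<Rightarrow> 'v fm"  \<comment> \<open>\<open>h \<in> [k]\<^sup>l\<close>\<close> where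
  "subset_of_size_fm h k l = Conj (subset_fm h k) (equinumerous_fm h l)"

definition image_at_most_one_fm :: "'v \<Rightarrow> 'v \<Rightarrow> 'v \<Rightarrow> 'v fm"
    \<comment> \<open>the image of \<open>h\<^sub>0 \<times> h\<^sub>1\<close> under \<open>f\<close> has at most one element\<close> where
  "image_at_most_one_fm f h\<^sub>0 h\<^sub>1 =
     All_in h\<^sub>0 (\<lambda>x. All_in h\<^sub>1 (\<lambda>y. All_in h\<^sub>0 (\<lambda>x'. All_in h\<^sub>1 (\<lambda>y'.
       Forall (\<lambda>p. Forall (\<lambda>p'. Forall (\<lambda>c. Forall (\<lambda>c'.
         Imp (Conj (Conj (pair_fm p x y) (pair_in_fm p c f))
                   (Conj (pair_fm p' x' y') (pair_in_fm p' c' f)))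
             (Eql c c')))))))))"

definition polarized_fm :: "'v \<Rightarrow> 'v \<Rightarrow> 'v \<Rightarrow> 'v \<Rightarrow> 'v \<Rightarrow> 'v fm" where
  "polarized_fm k\<^sub>0 k\<^sub>1 l\<^sub>0 l\<^sub>1 t =
     Forall (\<lambda>d. Forall (\<lambda>f.
       Imp (Conj (prod_fm d k\<^sub>0 k\<^sub>1) (function_fm f d t))
           (Exists (\<lambda>h\<^sub>0. Exists (\<lambda>h\<^sub>1.
              Conj (Conj (subset_of_size_fm h\<^sub>0 k\<^sub>0 l\<^sub>0) (subset_of_size_fm h\<^sub>1 k\<^sub>1 l\<^sub>1))
                   (image_at_most_one_fm f h\<^sub>0 h\<^sub>1))))))"

text \<open>
  The cardinals \<open>m\<^sup>+\<close> and \<open>m\<^sup>+\<^sup>+\<close> are part of the formula, hence are evaluated in the model in which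
  the formula is read (in the extension, for a forced formula).
\<close>

definition with_successors :: "'v \<Rightarrow> ('v \<Rightarrow> 'v \<Rightarrow> 'v fm) \<Rightarrow> 'v fm" where
  "with_successors m \<Phi> =
     Exists (\<lambda>m\<^sub>1. Exists (\<lambda>m\<^sub>2.
       Conj (Conj (succ_cardinal_fm m\<^sub>1 m) (succ_cardinal_fm m\<^sub>2 m\<^sub>1)) (\<Phi> m\<^sub>1 m\<^sub>2)))"

definition arrow_fm :: "'v \<Rightarrow> 'v \<Rightarrow> 'v fm" where
  "arrow_fm m l = with_successors m (\<lambda>m\<^sub>1 m\<^sub>2. polarized_fm m\<^sub>2 m\<^sub>1 l m\<^sub>1 m)"

definition not_arrow_fm :: "'v \<Rightarrow> 'v \<Rightarrow> 'v fm" where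
  "not_arrow_fm m l = with_successors m (\<lambda>m\<^sub>1 m\<^sub>2. Neg (polarized_fm m\<^sub>2 m\<^sub>1 l m\<^sub>1 m))"

definition not_arrow_succ_fm :: "'v \<Rightarrow> 'v fm" where
  "not_arrow_succ_fm m = with_successors m (\<lambda>m\<^sub>1 m\<^sub>2. Neg (polarized_fm m\<^sub>2 m\<^sub>1 m\<^sub>1 m\<^sub>1 m))"


section \<open>Forcing\<close>

text \<open>
  A forcing notion is given by its set \<open>C\<close> of conditions and its ordering \<open>le\<close>; \<open>le q p\<close> means
  that \<open>q\<close> is stronger than \<open>p\<close>.
\<close>

inductive is_name :: "'v::zfc set \<Rightarrow> 'v \<Rightarrow> bool" for C where
  "(\<And>z. z \<in> elts \<tau> \<Longrightarrow> \<exists>\<sigma> p. z = vpair \<sigma> p \<and> is_name C \<sigma> \<and> p \<in> C) \<Longrightarrow> is_name C \<tau>"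

function check :: "'v::zfc \<Rightarrow> 'v \<Rightarrow> 'v" where
  "check one x = set_of ((\<lambda>y. vpair (check one y) one) ` elts x)"
  by auto
termination
  by (relation "inv_image {(x, y). x \<in> elts y} snd") (auto intro: wf_elts)

declare check.simps [simp del]

text \<open>
  The usual recursion for forcing an equality of names. The recursion descends in rank and all
  recursive occurrences are positive, so it can be written as an inductive definition.
\<close>

inductive forces_eq :: "'v::zfc set \<Rightarrow> ('v \<Rightarrow> 'v \<Rightarrow> bool) \<Rightarrow> 'v \<Rightarrow> 'v \<Rightarrow> 'v \<Rightarrow> bool" for C le where
  "\<lbrakk>\<forall>\<pi> s. vpair \<pi> s \<in> elts \<sigma> \<longrightarrow>
       (\<forall>q\<in>C. le q p \<longrightarrow> (\<exists>r\<in>C. le r q \<and>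
          (le r s \<longrightarrow> (\<exists>\<rho> t. vpair \<rho> t \<in> elts \<tau> \<and> le r t \<and> forces_eq C le r \<pi> \<rho>))));
    \<forall>\<rho> t. vpair \<rho> t \<in> elts \<tau> \<longrightarrow>
       (\<forall>q\<in>C. le q p \<longrightarrow> (\<exists>r\<in>C. le r q \<and>
          (le r t \<longrightarrow> (\<exists>\<pi> s. vpair \<pi> s \<in> elts \<sigma> \<and> le r s \<and> forces_eq C le r \<pi> \<rho>))))\<rbrakk>
   \<Longrightarrow> forces_eq C le p \<sigma> \<tau>"

definition forces_mem :: "'v::zfc set \<Rightarrow> ('v \<Rightarrow> 'v \<Rightarrow> bool) \<Rightarrow> 'v \<Rightarrow> 'v \<Rightarrow> 'v \<Rightarrow> bool" where
  "forces_mem C le p \<sigma> \<tau> \<longleftrightarrow>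
     (\<forall>q\<in>C. le q p \<longrightarrow> (\<exists>r\<in>C. le r q \<and>
        (\<exists>\<pi> s. vpair \<pi> s \<in> elts \<tau> \<and> le r s \<and> forces_eq C le r \<sigma> \<pi>)))"

primrec forces :: "'v::zfc set \<Rightarrow> ('v \<Rightarrow> 'v \<Rightarrow> bool) \<Rightarrow> 'v fm \<Rightarrow> 'v \<Rightarrow> bool" where
  "forces C le (Mem \<sigma> \<tau>) = (\<lambda>p. forces_mem C le p \<sigma> \<tau>)"
| "forces C le (Eql \<sigma> \<tau>) = (\<lambda>p. forces_eq C le p \<sigma> \<tau>)"
| "forces C le (Neg \<phi>) = (\<lambda>p. \<forall>q\<in>C. le q p \<longrightarrow> \<not> forces C le \<phi> q)"
| "forces C le (Conj \<phi> \<psi>) = (\<lambda>p. forces C le \<phi> p \<and> forces C le \<psi> p)"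
| "forces C le (Forall F) = (\<lambda>p. \<forall>\<tau>. is_name C \<tau> \<longrightarrow> forces C le (F \<tau>) p)"


section \<open>Measurable cardinals and Prikry forcing\<close>

definition regular_cardinal :: "'v::zfc \<Rightarrow> bool" where
  "regular_cardinal k \<longleftrightarrow> holds (cardinal_fm k) \<and> infinite (elts k) \<and>
     (\<forall>a\<in>elts k. \<forall>F. F ` elts a \<subseteq> elts k \<longrightarrow> (\<exists>b\<in>elts k. \<forall>x\<in>elts a. F x \<in> elts b))"

definition ultrafilter_over :: "'v::zfc \<Rightarrow> 'v \<Rightarrow> bool" where
  "ultrafilter_over m U \<longleftrightarrow>
     (\<forall>X\<in>elts U. elts X \<subseteq> elts m) \<and> m \<in> elts U \<and>
     (\<forall>X\<in>elts U. \<forall>Y. elts X \<subseteq> elts Y \<and> elts Y \<subseteq> elts m \<longrightarrow> Y \<in> elts U) \<and>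
     (\<forall>X\<in>elts U. \<forall>Y\<in>elts U. \<forall>Z. elts Z = elts X \<inter> elts Y \<longrightarrow> Z \<in> elts U) \<and>
     (\<forall>X Y. elts X \<subseteq> elts m \<and> elts Y = elts m - elts X \<longrightarrow> (X \<in> elts U \<longleftrightarrow> Y \<notin> elts U))"

definition nonprincipal :: "'v::zfc \<Rightarrow> 'v \<Rightarrow> bool" where
  "nonprincipal m U \<longleftrightarrow> (\<forall>x\<in>elts m. set_of {x} \<notin> elts U)"

text \<open>As \<open>m\<close> is a cardinal, families of fewer than \<open>m\<close> sets are those indexed by some \<open>g \<in> m\<close>.\<close>

definition complete_filter :: "'v::zfc \<Rightarrow> 'v \<Rightarrow> bool" where
  "complete_filter m U \<longleftrightarrow>
     (\<forall>g\<in>elts m. \<forall>A. (\<forall>x\<in>elts g. A x \<in> elts U) \<longrightarrow>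
        set_of {y \<in> elts m. \<forall>x\<in>elts g. y \<in> elts (A x)} \<in> elts U)"

definition diagonally_closed :: "'v::zfc \<Rightarrow> 'v \<Rightarrow> bool" where
  "diagonally_closed m U \<longleftrightarrow>
     (\<forall>A. (\<forall>x\<in>elts m. A x \<in> elts U) \<longrightarrow>
        set_of {y \<in> elts m. \<forall>x\<in>elts y. y \<in> elts (A x)} \<in> elts U)"

definition measurable_cardinal :: "'v::zfc \<Rightarrow> bool" where
  "measurable_cardinal m \<longleftrightarrow> holds (cardinal_fm m) \<and> uncountable (elts m) \<and>
     (\<exists>U. ultrafilter_over m U \<and> nonprincipal m U \<and> complete_filter m U)"

definition normal_ultrafilter :: "'v::zfc \<Rightarrow> 'v \<Rightarrow> bool" where
  "normal_ultrafilter m U \<longleftrightarrow>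
     ultrafilter_over m U \<and> nonprincipal m U \<and> complete_filter m U \<and> diagonally_closed m U"

definition prikry_conditions :: "'v::zfc \<Rightarrow> 'v \<Rightarrow> 'v set" where
  "prikry_conditions m U =
     {vpair a X | a X. elts a \<subseteq> elts m \<and> finite (elts a) \<and> X \<in> elts U}"

text \<open>
  The set \<open>{x. \<exists>y\<in>elts b. x = y \<or> x \<in> elts y}\<close> is the ordinal \<open>max b + 1\<close>, which is read as \<open>0\<close>
  for empty \<open>b\<close>.
\<close>

definition prikry_le :: "'v::zfc \<Rightarrow> 'v \<Rightarrow> bool" where
  "prikry_le p q \<longleftrightarrow> (\<exists>a X b Y. p = vpair a X \<and> q = vpair b Y \<and>
     elts a \<inter> {x. \<exists>y\<in>elts b. x = y \<or> x \<in> elts y} = elts b \<and>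
     (elts a - elts b) \<union> elts X \<subseteq> elts Y)"

definition prikry_check :: "'v::zfc \<Rightarrow> 'v \<Rightarrow> 'v" where
  "prikry_check m x = check (vpair (set_of {}) m) x"

definition prikry_forces :: "'v::zfc \<Rightarrow> 'v \<Rightarrow> 'v fm \<Rightarrow> bool" where
  "prikry_forces m U \<phi> \<longleftrightarrow>
     (\<forall>p\<in>prikry_conditions m U. forces (prikry_conditions m U) prikry_le \<phi> p)"

end

theory Submission
  imports Defs
begin

unbundle cardinal_syntax

text \<open>
  Conditions of \<open>\<P>\<^sub>U\<close> with the same stem are compatible, fewer than \<open>\<mu>\<close> of them even have a common
  extension with that stem, and there are only \<open>\<mu>\<close> stems. Hence \<open>\<mu>\<^sup>+\<close> and \<open>\<mu>\<^sup>+\<^sup>+\<close> keep their meaning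
  in the extension.

  Positive relations: for a name \<open>f\<close> of a colouring choose conditions \<open>p\<^sub>\<alpha>\<^sub>\<beta>\<close> deciding \<open>f(\<alpha>, \<beta>)\<close> and
  colour \<open>(\<alpha>, \<beta>)\<close> in the ground model by the stem of \<open>p\<^sub>\<alpha>\<^sub>\<beta>\<close> and the decided value. On a homogeneous
  \<open>H\<^sub>0 \<times> H\<^sub>1\<close> the \<open>p\<^sub>\<alpha>\<^sub>\<beta>\<close> with \<open>\<alpha> \<in> H\<^sub>0\<close> have a common extension \<open>p\<^sub>\<beta>\<close>, and some condition forces
  \<open>p\<^sub>\<beta>\<close> to be generic for \<open>\<mu>\<^sup>+\<close> many \<open>\<beta>\<close>.

  Negative relations: a ground model colouring stays a counterexample. Suppose that a condition forces
  the contrary. For \<open>j < \<mu>\<^sup>+\<close> choose a descending sequence of conditions whose first entry decides the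
  \<open>j\<close>-th element of the large side and which together decide \<open>\<nu>\<close> many elements of the small side. For
  \<open>\<mu>\<^sup>+\<close> many \<open>j\<close> the sequences have the same stems, and these yield a homogeneous rectangle in the
  ground model. For countable \<open>\<nu>\<close> such sequences exist trivially, and \<open>\<mu>\<^sup>\<omega> = \<mu>\<close> allows to unify their
  stems. For uncountable regular \<open>\<nu>\<close> normality gives, for each \<open>i < \<nu>\<close>, a number \<open>n\<^sub>i\<close> such that almost
  all extensions of the stem by \<open>n\<^sub>i\<close> points decide the \<open>i\<close>-th element; as \<open>n\<^sub>i\<close> is constant on a set of
  size \<open>\<nu>\<close>, a single condition decides \<open>\<nu>\<close> many elements.
\<close>

section \<open>The ground model\<close>

subsection \<open>Small sets\<close>

text \<open>The case distinction on \<nu> answers a real obstacle. The generic sequence is cofinal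
  in \<mu> with order type \<omega>, and a condition decides only finitely many of its terms. So for
  countable \<nu> a single condition may decide too little of the small side, and the decisions have
  to be spread over a descending sequence of conditions. Such a sequence need not have a lower
  bound. This is harmless for the negative relations: a rectangle is homogeneous as soon as any two
  of its points get the same colour, and two points are settled by finitely many conditions, which
  only have to be compatible. The positive relations are more demanding, since there the rectangle
  must be forced as a whole. This is where the small side has to be smaller than \<mu>: only then do
  the conditions attached to one column have a common extension.\<close>

definition small :: "'v::zfc set \<Rightarrow> bool" where
  "small A \<longleftrightarrow> (\<exists>z. elts z = A)"

lemma elts_set_of_small [simp]: "small A \<Longrightarrow> elts (set_of A) = A"
  unfolding small_def using elts_set_of by blast

lemma small_elts [simp]: "small (elts x)"
  unfolding small_def by blast

lemma set_of_elts [simp]: "set_of (elts x) = x"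
  by (rule zfc_extensionality) simp

lemma small_subset:
  assumes "small A" "B \<subseteq> A" shows "small B"
proof -
  obtain x where x: "elts x = A" using assms(1) unfolding small_def by blast
  obtain z where "elts z = {y \<in> elts x. y \<in> B}" using zfc_separation[of x "\<lambda>y. y \<in> B"] by blast
  then have "elts z = B" using x assms(2) by auto
  then show ?thesis unfolding small_def by blast
qed

lemma small_image: "small A \<Longrightarrow> small (F ` A)" for F :: "'v::zfc \<Rightarrow> 'v"
  unfolding small_def using zfc_replacement[of F] by metis

lemma small_UN:
  fixes A :: "'v::zfc set" and B :: "'v \<Rightarrow> 'v set"
  assumes "small A" "\<And>x. x \<in> A \<Longrightarrow> small (B x)"
  shows "small (\<Union>x\<in>A. B x)"
proof -
  obtain w where w: "elts w = (\<lambda>x. set_of (B x)) ` A"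
    using small_image[OF assms(1), of "\<lambda>x. set_of (B x)"] unfolding small_def by blast
  obtain z where z: "elts z = \<Union> (elts ` elts w)" using zfc_union by blast
  have "elts ` elts w = B ` A" unfolding w using assms(2) by (auto simp: image_image intro!: image_eqI)
  then have "elts z = (\<Union>x\<in>A. B x)" using z by simp
  then show ?thesis unfolding small_def by blast
qed

lemma small_vpairs:
  fixes A B :: "'v::zfc set"
  assumes "small A" "small B"
  shows "small {vpair x y | x y. x \<in> A \<and> y \<in> B}"
proof -
  have "{vpair x y | x y. x \<in> A \<and> y \<in> B} = (\<Union>x\<in>A. (\<lambda>y. vpair x y) ` B)" by auto
  then show ?thesis using assms by (simp add: small_UN small_image)
qed

lemma small_Pow: "\<exists>z. elts z = {y. elts y \<subseteq> elts x}" for x :: "'v::zfc"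
  by (rule zfc_power)

lemma elts_vpair: "elts (vpair x y) = {set_of {x}, set_of {x, y}}"
  by (simp add: vpair_def)

subsection \<open>Truth in the ground model\<close>

lemma holds_Disj [simp]: "holds (Disj \<phi> \<psi>) \<longleftrightarrow> holds \<phi> \<or> holds \<psi>"
  by (simp add: Disj_def)

lemma holds_Imp [simp]: "holds (Imp \<phi> \<psi>) \<longleftrightarrow> (holds \<phi> \<longrightarrow> holds \<psi>)"
  by (simp add: Imp_def)

lemma holds_Iff [simp]: "holds (Iff \<phi> \<psi>) \<longleftrightarrow> (holds \<phi> \<longleftrightarrow> holds \<psi>)"
  by (auto simp: Iff_def)

lemma holds_Exists [simp]: "holds (Exists F) \<longleftrightarrow> (\<exists>x. holds (F x))"
  by (simp add: Exists_def)

lemma holds_All_in [simp]: "holds (All_in a F) \<longleftrightarrow> (\<forall>x\<in>elts a. holds (F x))"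
  by (auto simp: All_in_def)

lemma holds_Ex_in [simp]: "holds (Ex_in a F) \<longleftrightarrow> (\<exists>x\<in>elts a. holds (F x))"
  by (auto simp: Ex_in_def)

lemma holds_subset [simp]: "holds (subset_fm x y) \<longleftrightarrow> elts x \<subseteq> elts y"
  by (auto simp: subset_fm_def)

lemma holds_upair [simp]: "holds (upair_fm z x y) \<longleftrightarrow> z = set_of {x, y}"
proof -
  have "holds (upair_fm z x y) \<longleftrightarrow> elts z = {x, y}" by (auto simp: upair_fm_def)
  then show ?thesis by (metis elts_upair zfc_extensionality)
qed

lemma holds_pair [simp]: "holds (pair_fm z x y) \<longleftrightarrow> z = vpair x y"
proof -
  have "holds (pair_fm z x y) \<longleftrightarrow> elts z = elts (vpair x y)"
    by (auto simp: pair_fm_def elts_vpair)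
  then show ?thesis using zfc_extensionality by blast
qed

lemma holds_pair_in [simp]: "holds (pair_in_fm x y f) \<longleftrightarrow> vpair x y \<in> elts f"
  by (auto simp: pair_in_fm_def)

lemma holds_prod: "holds (prod_fm d a b) \<longleftrightarrow> elts d = {vpair x y | x y. x \<in> elts a \<and> y \<in> elts b}"
  by (auto simp: prod_fm_def)

definition graph_on :: "'v::zfc set \<Rightarrow> ('v \<Rightarrow> 'v) \<Rightarrow> 'v set" where
  "graph_on A g = (\<lambda>x. vpair x (g x)) ` A"

lemma small_graph_on: "small A \<Longrightarrow> small (graph_on A g)"
  unfolding graph_on_def by (rule small_image)

lemma vpair_in_graph_on [simp]: "vpair x y \<in> graph_on A g \<longleftrightarrow> x \<in> A \<and> y = g x"
  by (auto simp: graph_on_def)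

lemma holds_function:
  "holds (function_fm f a b) \<longleftrightarrow> (\<exists>g. (\<forall>x\<in>elts a. g x \<in> elts b) \<and> elts f = graph_on (elts a) g)"
  (is "?l \<longleftrightarrow> ?r")
proof
  assume l: ?l
  then have 1: "\<And>z. z \<in> elts f \<Longrightarrow> \<exists>x\<in>elts a. \<exists>y\<in>elts b. z = vpair x y"
    and 2: "\<forall>x\<in>elts a. \<exists>y. y \<in> elts b \<and> vpair x y \<in> elts f \<and> (\<forall>y'\<in>elts b. vpair x y' \<in> elts f \<longrightarrow> y' = y)"
    by (auto simp: function_fm_def)
  from bchoice[OF 2] obtain g where g: "\<forall>x\<in>elts a. g x \<in> elts b \<and> vpair x (g x) \<in> elts f \<and>
       (\<forall>y'\<in>elts b. vpair x y' \<in> elts f \<longrightarrow> y' = g x)" by blast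
  have "elts f = graph_on (elts a) g"
  proof
    show "elts f \<subseteq> graph_on (elts a) g"
    proof
      fix z assume z: "z \<in> elts f"
      then obtain x y where "x \<in> elts a" "y \<in> elts b" "z = vpair x y" using 1 by blast
      then show "z \<in> graph_on (elts a) g" using g z by auto
    qed
    show "graph_on (elts a) g \<subseteq> elts f" using g by (auto simp: graph_on_def)
  qed
  then show ?r using g by blast
next
  assume ?r
  then obtain g where g: "\<forall>x\<in>elts a. g x \<in> elts b" "elts f = graph_on (elts a) g" by blast
  then show ?l by (auto simp: function_fm_def graph_on_def)
qed

lemma holds_bijection:
  "holds (bijection_fm f a b) \<longleftrightarrow> (\<exists>g. bij_betw g (elts a) (elts b) \<and> elts f = graph_on (elts a) g)"
  (is "?l \<longleftrightarrow> ?r")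
proof
  assume l: ?l
  then obtain g where g: "\<forall>x\<in>elts a. g x \<in> elts b" "elts f = graph_on (elts a) g"
    by (auto simp: bijection_fm_def holds_function)
  have "\<forall>y\<in>elts b. \<exists>x\<in>elts a. y = g x \<and> (\<forall>x'\<in>elts a. y = g x' \<longrightarrow> x' = x)"
    using l unfolding bijection_fm_def by (simp add: g)
  then have "bij_betw g (elts a) (elts b)"
    using g(1) unfolding bij_betw_def inj_on_def by (safe; metis imageI)
  then show ?r using g by blast
next
  assume ?r
  then obtain g where g: "bij_betw g (elts a) (elts b)" "elts f = graph_on (elts a) g" by blast
  have "holds (function_fm f a b)"
    unfolding holds_function using g by (auto simp: bij_betw_def)
  moreover have "\<forall>y\<in>elts b. \<exists>x\<in>elts a. y = g x \<and> (\<forall>x'\<in>elts a. y = g x' \<longrightarrow> x' = x)"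
    using g(1) unfolding bij_betw_def inj_on_def by (safe; metis imageE)
  ultimately show ?l unfolding bijection_fm_def by (simp add: g)
qed

lemma holds_equinumerous:
  "holds (equinumerous_fm a b) \<longleftrightarrow> (\<exists>g. bij_betw g (elts a) (elts b))"
proof -
  have "elts (set_of (graph_on (elts a) g)) = graph_on (elts a) g" for g
    by (intro elts_set_of_small small_graph_on small_elts)
  then show ?thesis unfolding equinumerous_fm_def holds_Exists holds_bijection by blast
qed

lemma card_of_ordIso_V:
  "holds (equinumerous_fm a b) \<longleftrightarrow> |elts a| =o |elts b|"
  by (simp add: holds_equinumerous card_of_ordIso)

text \<open>Separation and replacement hold for arbitrary HOL predicates and functions, so every HOL
  subset of a set and every HOL function on a set is represented by a set. Hence colourings become
  binary HOL functions, and sizes are compared by the HOL cardinal order.\<close>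

lemma holds_polarized:
  "holds (polarized_fm k\<^sub>0 k\<^sub>1 l\<^sub>0 l\<^sub>1 t) \<longleftrightarrow>
     (\<forall>f. (\<forall>x\<in>elts k\<^sub>0. \<forall>y\<in>elts k\<^sub>1. f x y \<in> elts t) \<longrightarrow>
        (\<exists>H\<^sub>0 H\<^sub>1. H\<^sub>0 \<subseteq> elts k\<^sub>0 \<and> |H\<^sub>0| =o |elts l\<^sub>0| \<and> H\<^sub>1 \<subseteq> elts k\<^sub>1 \<and> |H\<^sub>1| =o |elts l\<^sub>1| \<and>
          (\<forall>x\<in>H\<^sub>0. \<forall>y\<in>H\<^sub>1. \<forall>x'\<in>H\<^sub>0. \<forall>y'\<in>H\<^sub>1. f x y = f x' y')))" (is "?l \<longleftrightarrow> ?r")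
proof
  assume l: ?l
  show ?r
  proof (intro allI impI)
    fix f assume f: "\<forall>x\<in>elts k\<^sub>0. \<forall>y\<in>elts k\<^sub>1. f x y \<in> elts t"
    let ?D = "{vpair x y | x y. x \<in> elts k\<^sub>0 \<and> y \<in> elts k\<^sub>1}"
    define d where "d = set_of ?D"
    have d: "elts d = ?D" unfolding d_def by (intro elts_set_of_small small_vpairs small_elts)
    \<comment> \<open>The colouring is curried on the HOL side; \<open>g\<close> recovers its two
      arguments from the coded pair.\<close>
    define g where "g z = (THE c. \<exists>x y. z = vpair x y \<and> c = f x y)" for z
    have g: "g (vpair x y) = f x y" for x y unfolding g_def by auto
    define F where "F = set_of (graph_on (elts d) g)"
    have F: "elts F = graph_on (elts d) g" unfolding F_def by (intro elts_set_of_small small_graph_on small_elts)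
    have "holds (prod_fm d k\<^sub>0 k\<^sub>1)" by (simp add: holds_prod d)
    moreover have "holds (function_fm F d t)" unfolding holds_function
      using F d g f by (intro exI[of _ g]) auto
    ultimately obtain h0 h1 where
      h: "holds (subset_of_size_fm h0 k\<^sub>0 l\<^sub>0)" "holds (subset_of_size_fm h1 k\<^sub>1 l\<^sub>1)"
         "holds (image_at_most_one_fm F h0 h1)"
      using l unfolding polarized_fm_def holds.simps holds_Imp holds_Exists by blast
    from h have s: "elts h0 \<subseteq> elts k\<^sub>0" "elts h1 \<subseteq> elts k\<^sub>1" "|elts h0| =o |elts l\<^sub>0|" "|elts h1| =o |elts l\<^sub>1|"
      by (simp_all add: subset_of_size_fm_def card_of_ordIso_V)
    have "f x y = f x' y'" if xy: "x \<in> elts h0" "y \<in> elts h1" "x' \<in> elts h0" "y' \<in> elts h1" for x y x' y'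
    proof -
      have "x \<in> elts k\<^sub>0" "y \<in> elts k\<^sub>1" "x' \<in> elts k\<^sub>0" "y' \<in> elts k\<^sub>1" using s xy by blast+
      moreover have "\<forall>p p' c c'. (p = vpair x y \<and> vpair p c \<in> elts F) \<and> p' = vpair x' y' \<and> vpair p' c' \<in> elts F \<longrightarrow> c = c'"
        using h(3) xy unfolding image_at_most_one_fm_def by simp
      ultimately show ?thesis by (simp add: F d g)
    qed
    then show "\<exists>H\<^sub>0 H\<^sub>1. H\<^sub>0 \<subseteq> elts k\<^sub>0 \<and> |H\<^sub>0| =o |elts l\<^sub>0| \<and> H\<^sub>1 \<subseteq> elts k\<^sub>1 \<and> |H\<^sub>1| =o |elts l\<^sub>1| \<and>
          (\<forall>x\<in>H\<^sub>0. \<forall>y\<in>H\<^sub>1. \<forall>x'\<in>H\<^sub>0. \<forall>y'\<in>H\<^sub>1. f x y = f x' y')"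
      using s by (intro exI[of _ "elts h0"] exI[of _ "elts h1"] conjI ballI) assumption+
  qed
next
  assume r: ?r
  show ?l unfolding polarized_fm_def holds.simps holds_Imp holds_Exists
  proof (intro allI impI)
    fix d F assume "holds (prod_fm d k\<^sub>0 k\<^sub>1) \<and> holds (function_fm F d t)"
    then have d: "holds (prod_fm d k\<^sub>0 k\<^sub>1)" and F: "holds (function_fm F d t)" by blast+
    from F obtain g where g: "\<forall>z\<in>elts d. g z \<in> elts t" "elts F = graph_on (elts d) g"
      by (auto simp: holds_function)
    have "\<forall>x\<in>elts k\<^sub>0. \<forall>y\<in>elts k\<^sub>1. g (vpair x y) \<in> elts t" using g d by (auto simp: holds_prod)
    from r[rule_format, of "\<lambda>x y. g (vpair x y)"] this obtain H0 H1 where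
      H: "H0 \<subseteq> elts k\<^sub>0" "|H0| =o |elts l\<^sub>0|" "H1 \<subseteq> elts k\<^sub>1" "|H1| =o |elts l\<^sub>1|"
      "\<forall>x\<in>H0. \<forall>y\<in>H1. \<forall>x'\<in>H0. \<forall>y'\<in>H1. g (vpair x y) = g (vpair x' y')" by blast
    have e: "elts (set_of H0) = H0" "elts (set_of H1) = H1"
      using H small_subset small_elts by (metis elts_set_of_small)+
    have "holds (image_at_most_one_fm F (set_of H0) (set_of H1))"
      unfolding image_at_most_one_fm_def holds_All_in holds.simps holds_Imp holds_pair holds_pair_in e
    proof (intro ballI allI impI)
      fix x y x' y' p p' c c'
      assume "x \<in> H0" "y \<in> H1" "x' \<in> H0" "y' \<in> H1"
        and "(p = vpair x y \<and> vpair p c \<in> elts F) \<and> p' = vpair x' y' \<and> vpair p' c' \<in> elts F"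
      then have "c = g (vpair x y)" "c' = g (vpair x' y')" by (simp_all add: g)
      then show "c = c'" using H(5) \<open>x \<in> H0\<close> \<open>y \<in> H1\<close> \<open>x' \<in> H0\<close> \<open>y' \<in> H1\<close> by metis
    qed
    moreover have "holds (subset_of_size_fm (set_of H0) k\<^sub>0 l\<^sub>0)" "holds (subset_of_size_fm (set_of H1) k\<^sub>1 l\<^sub>1)"
      using H by (simp_all add: subset_of_size_fm_def card_of_ordIso_V e)
    ultimately show "\<exists>h0 h1. (holds (subset_of_size_fm h0 k\<^sub>0 l\<^sub>0) \<and> holds (subset_of_size_fm h1 k\<^sub>1 l\<^sub>1)) \<and>
       holds (image_at_most_one_fm F h0 h1)"
      by blast
  qed
qed

subsection \<open>Ordinals and cardinals\<close>

abbreviation ordinal :: "'v::zfc \<Rightarrow> bool" where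
  "ordinal x \<equiv> holds (ordinal_fm x)"

lemma ordinal_iff:
  "ordinal x \<longleftrightarrow> (\<forall>y\<in>elts x. elts y \<subseteq> elts x) \<and> (\<forall>y\<in>elts x. \<forall>z\<in>elts y. elts z \<subseteq> elts y)"
  by (auto simp: ordinal_fm_def transitive_fm_def)

lemma ordinal_elt: "ordinal x \<Longrightarrow> y \<in> elts x \<Longrightarrow> ordinal y"
  unfolding ordinal_iff by blast

lemma ordinal_trans: "ordinal x \<Longrightarrow> y \<in> elts x \<Longrightarrow> z \<in> elts y \<Longrightarrow> z \<in> elts x"
  unfolding ordinal_iff by blast

lemma elts_irrefl [simp]: "x \<notin> elts x" for x :: "'v::zfc"
  by (rule elts_not_refl)

lemma elts_induct [case_names step]:
  assumes "\<And>x. (\<And>y. y \<in> elts x \<Longrightarrow> P y) \<Longrightarrow> P (x :: 'v::zfc)"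
  shows "P x"
  by (rule wf_induct_rule[OF wf_elts]) (use assms in auto)

lemma elts_minimal:
  fixes t :: "'v::zfc"
  assumes "t \<in> A" shows "\<exists>m\<in>A. \<forall>x\<in>elts m. x \<notin> A"
  using wf_elts assms unfolding wf_eq_minimal by (metis (mono_tags, lifting) case_prodI mem_Collect_eq)

text \<open>Double induction. If x and y were incomparable, the outer hypothesis would put every
  element of x into y and the inner one every element of y into x, so that x = y by
  extensionality.\<close>

lemma ordinal_linear:
  assumes "ordinal x" "ordinal y"
  shows "x \<in> elts y \<or> x = y \<or> y \<in> elts x"
  using assms
proof (induction x arbitrary: y rule: elts_induct)
  case (step x)
  note IH1 = step.IH and ox = step.prems(1)
  from step.prems(2) show ?case
  proof (induction y rule: elts_induct)
    case (step y)
    show ?case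
    proof (rule ccontr)
      assume n: "\<not> (x \<in> elts y \<or> x = y \<or> y \<in> elts x)"
      have "elts x \<subseteq> elts y"
      proof
        fix z assume z: "z \<in> elts x"
        then have "z \<in> elts y \<or> z = y \<or> y \<in> elts z" using IH1 ox step.prems ordinal_elt by blast
        then show "z \<in> elts y" using n z ordinal_trans[OF ox] by blast
      qed
      moreover have "elts y \<subseteq> elts x"
      proof
        fix z assume z: "z \<in> elts y"
        then have "x \<in> elts z \<or> x = z \<or> z \<in> elts x" using step ordinal_elt by blast
        then show "z \<in> elts x" using n z ordinal_trans[OF step.prems] by blast
      qed
      ultimately show False using n zfc_extensionality by blast
    qed
  qed
qed

lemma ordinal_elts_linear:
  assumes "ordinal k" "x \<in> elts k" "y \<in> elts k"
  shows "x \<in> elts y \<or> x = y \<or> y \<in> elts x"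
  using assms ordinal_elt ordinal_linear by blast

lemma holds_cardinal:
  "holds (cardinal_fm k) \<longleftrightarrow> ordinal k \<and> (\<forall>a\<in>elts k. \<not> |elts a| =o |elts k| )"
  by (simp add: cardinal_fm_def card_of_ordIso_V)

lemma elts_mono_ordinal: "ordinal k \<Longrightarrow> a \<in> elts k \<Longrightarrow> |elts a| \<le>o |elts k|"
  using ordinal_trans by (intro card_of_mono1) blast

lemma cardinal_elt_less:
  assumes "holds (cardinal_fm k)" "a \<in> elts k"
  shows "|elts a| <o |elts k|"
  using assms elts_mono_ordinal unfolding holds_cardinal
  by (metis ordLeq_iff_ordLess_or_ordIso)

text \<open>The bridge from HOL cardinals to internal ordinals: membership well-orders k, and a
  smaller set is isomorphic to a proper initial segment, which consists of elements of some a in k.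
  Through it regularity and completeness, stated for index sets in k, apply to arbitrary families of
  fewer than k members.\<close>

lemma ordLess_ordinal_elt:
  fixes k :: "'v::zfc" and A :: "'b set"
  assumes o: "ordinal k" and A: "|A| <o |elts k|"
  shows "\<exists>a\<in>elts k. |A| \<le>o |elts a|"
proof -
  define r where "r = {(x, y). x \<in> elts k \<and> y \<in> elts k \<and> (x = y \<or> x \<in> elts y)}"
  have F: "Field r = elts k" unfolding r_def Field_def by auto
  have "Well_order r"
    unfolding well_order_on_def linear_order_on_def partial_order_on_def preorder_on_def F
  proof (intro conjI)
    show "r \<subseteq> elts k \<times> elts k" "refl_on (elts k) r" unfolding r_def refl_on_def by auto
    show "trans r" unfolding r_def trans_def using o ordinal_elt ordinal_trans by (auto; blast)
    show "antisym r"
    proof (rule antisymI, rule ccontr)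
      fix x y assume "(x, y) \<in> r" "(y, x) \<in> r" "x \<noteq> y"
      then have "x \<in> elts k" "x \<in> elts y" "y \<in> elts x" unfolding r_def by auto
      then show False using ordinal_trans[OF ordinal_elt[OF o]] elts_irrefl by blast
    qed
    show "total_on (elts k) r" unfolding r_def total_on_def using ordinal_elts_linear[OF o] by blast
    have "r - Id \<subseteq> {(x, y). x \<in> elts y}" unfolding r_def by auto
    then show "wf (r - Id)" using wf_elts wf_subset by blast
  qed
  then have "|elts k| \<le>o r" using F card_of_least by (metis card_of_well_order_on)
  then have "|A| <o r" using A ordLess_ordLeq_trans by blast
  then obtain a where a: "a \<in> Field r" "|A| =o Restr r (underS r a)"
    using internalize_ordLess by (metis \<open>Well_order r\<close> card_of_Well_order ordLess_iff_ordIso_Restr)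
  have "Field (Restr r (underS r a)) \<subseteq> elts a"
    unfolding Field_def underS_def r_def by auto
  moreover have "|A| \<le>o |elts a|"
  proof -
    have "|Field ( |A| )| =o |Field (Restr r (underS r a))|"
      using a(2) by (meson card_of_cong)
    then show ?thesis using calculation
      by (metis Field_card_of card_of_mono1 ordIso_ordLeq_trans)
  qed
  ultimately show ?thesis using a F by blast
qed

lemma holds_succ_cardinal:
  "holds (succ_cardinal_fm l k) \<longleftrightarrow> holds (cardinal_fm l) \<and> k \<in> elts l \<and>
     (\<forall>d\<in>elts l. \<not> (holds (cardinal_fm d) \<and> k \<in> elts d))"
  by (simp add: succ_cardinal_fm_def)

lemma succ_cardinal_less: "holds (succ_cardinal_fm l k) \<Longrightarrow> |elts k| <o |elts l|"
  unfolding holds_succ_cardinal using cardinal_elt_less by blast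

text \<open>An ordinal strictly between k and l is not a cardinal, so it is equinumerous with one of
  its elements, to which the induction hypothesis applies.\<close>

lemma succ_cardinal_elt:
  assumes s: "holds (succ_cardinal_fm l k)" and "y \<in> elts l"
  shows "|elts y| \<le>o |elts k|"
  using assms(2)
proof (induction y rule: elts_induct)
  case (step y)
  have ol: "ordinal l" "k \<in> elts l" using s by (auto simp: holds_succ_cardinal holds_cardinal)
  then have ok: "ordinal k" "ordinal y" using step.prems ordinal_elt by blast+
  consider "y \<in> elts k" | "y = k" | "k \<in> elts y" using ordinal_linear[OF ok(2,1)] by blast
  then show ?case
  proof cases
    case 1 then show ?thesis using elts_mono_ordinal ok by blast
  next
    case 2 then show ?thesis by (simp add: card_of_mono1)
  next
    case 3
    then have "\<not> holds (cardinal_fm y)" using s step.prems unfolding holds_succ_cardinal by blast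
    then obtain a where a: "a \<in> elts y" "|elts a| =o |elts y|" using ok by (auto simp: holds_cardinal)
    then have "|elts a| \<le>o |elts k|" using step ordinal_trans[OF ol(1)] by blast
    then show ?thesis using a(2) ordIso_symmetric ordIso_ordLeq_trans by blast
  qed
qed

text \<open>Regularity of the successor cardinal. A bounded J would lie in an initial segment of l
  and thus have size at most k. So J is cofinal, and l is a union of |J| sets of size at most k,
  where k is at most |J|.\<close>

lemma succ_cardinal_big_subset:
  assumes s: "holds (succ_cardinal_fm l k)" and k: "infinite (elts k)"
    and J: "J \<subseteq> elts l" "\<not> |J| \<le>o |elts k|"
  shows "|J| =o |elts l|"
proof -
  have ol: "ordinal l" "k \<in> elts l" using s by (auto simp: holds_succ_cardinal holds_cardinal)
  have kJ: "|elts k| \<le>o |J|" using J(2) by (metis card_of_Well_order ordLeq_total)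
  have cof: "\<exists>j\<in>J. x \<in> elts j" if x: "x \<in> elts l" for x
  proof (rule ccontr)
    assume "\<not> (\<exists>j\<in>J. x \<in> elts j)"
    then have "J \<subseteq> insert x (elts x)" using J(1) ordinal_elts_linear[OF ol(1) x] by blast
    then have "|J| \<le>o |insert x (elts x)|" by (rule card_of_mono1)
    moreover have "|insert x (elts x)| \<le>o |elts k|"
    proof -
      have "|{x} \<union> elts x| \<le>o |elts k|"
      proof (rule card_of_Un_ordLeq_infinite_Field)
        show "|{x}| \<le>o |elts k|"
          using k by (meson card_of_Well_order card_of_ordLeq_finite finite.emptyI finite_insert ordLeq_total)
      qed (use k succ_cardinal_elt[OF s x] in \<open>simp_all add: Field_card_of card_of_card_order_on\<close>)
      then show ?thesis by simp
    qed
    ultimately show False using J(2) ordLeq_transitive by blast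
  qed
  have "elts l \<subseteq> (\<Union>j\<in>J. elts j)" using cof by auto
  then have "|elts l| \<le>o |\<Union>j\<in>J. elts j|" by (rule card_of_mono1)
  moreover have "|\<Union>j\<in>J. elts j| \<le>o |J|"
  proof (rule card_of_UNION_ordLeq_infinite)
    show "infinite J" using kJ k by (metis card_of_ordLeq_infinite)
    show "|J| \<le>o |J|" by (simp add: card_of_mono1)
    show "\<forall>i\<in>J. |elts i| \<le>o |J|" using succ_cardinal_elt[OF s] J(1) kJ ordLeq_transitive by blast
  qed
  ultimately have "|elts l| \<le>o |J|" using ordLeq_transitive by blast
  then show ?thesis using J(1) by (simp add: card_of_mono1 ordIso_iff_ordLeq)
qed

lemma card_of_not_ordLeq: "\<not> |A| \<le>o |B| \<longleftrightarrow> |B| <o |A|"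
  by (rule not_ordLeq_iff_ordLess[OF card_of_Well_order card_of_Well_order])

lemma pigeonhole_big:
  assumes M: "infinite M" and J: "\<not> |J| \<le>o |M|" and S: "t ` J \<subseteq> S" "|S| \<le>o |M|"
  shows "\<exists>s\<in>S. \<not> |{j \<in> J. t j = s}| \<le>o |M|"
proof (rule ccontr)
  assume "\<not> ?thesis"
  then have "|\<Union>s\<in>S. {j \<in> J. t j = s}| \<le>o |M|"
    by (intro card_of_UNION_ordLeq_infinite[OF M S(2)]) auto
  moreover have "(\<Union>s\<in>S. {j \<in> J. t j = s}) = J" using S(1) by auto
  ultimately show False using J by simp
qed

text \<open>The transfinite recursion runs along a well-order of the index set all of whose proper initial
  segments are smaller than the sets to choose from.\<close>

lemma injective_choice:
  assumes I: "|I| \<le>o |K|" and K: "infinite K" and J: "\<And>i. i \<in> I \<Longrightarrow> |K| \<le>o |J i|"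
  shows "\<exists>\<phi>. inj_on \<phi> I \<and> (\<forall>i\<in>I. \<phi> i \<in> J i)"
proof -
  define R where "R = |I| - Id"
  have wfR: "wf R" unfolding R_def using card_of_Well_order[of I] well_order_on_def by blast
  define \<phi> where "\<phi> = wfrec R (\<lambda>f i. SOME y. y \<in> J i \<and> y \<notin> f ` {j. (j, i) \<in> R})"
  have rec: "\<phi> i = (SOME y. y \<in> J i \<and> y \<notin> \<phi> ` {j. (j, i) \<in> R})" for i
  proof -
    have "cut \<phi> R i ` {j. (j, i) \<in> R} = \<phi> ` {j. (j, i) \<in> R}" by (auto simp: cut_def image_def)
    then show ?thesis unfolding \<phi>_def by (subst wfrec[OF wfR]) (simp add: \<phi>_def)
  qed
  have ex: "\<exists>y. y \<in> J i \<and> y \<notin> \<phi> ` {j. (j, i) \<in> R}" if i: "i \<in> I" for i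
  proof (rule ccontr)
    assume "\<not> ?thesis"
    then have "J i \<subseteq> \<phi> ` {j. (j, i) \<in> R}" by blast
    then have "|J i| \<le>o |{j. (j, i) \<in> R}|" by (meson card_of_mono1 card_of_image ordLeq_transitive)
    moreover have "{j. (j, i) \<in> R} = underS |I| i" unfolding R_def underS_def by auto
    moreover have "|underS |I| i| <o |I|"
      using card_of_underS[OF card_of_Card_order] i by (metis Field_card_of)
    ultimately show False
      using J[OF i] I by (metis not_ordLeq_ordLess ordLeq_transitive)
  qed
  have \<phi>: "\<phi> i \<in> J i" "\<phi> i \<notin> \<phi> ` {j. (j, i) \<in> R}" if "i \<in> I" for i
    using someI_ex[OF ex[OF that]] rec[of i] by auto
  have "inj_on \<phi> I"
  proof (rule inj_onI, rule ccontr)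
    fix i j assume ij: "i \<in> I" "j \<in> I" "\<phi> i = \<phi> j" "i \<noteq> j"
    have "total_on I |I|" using card_of_well_order_on[of I] unfolding well_order_on_def linear_order_on_def by blast
    then have "(i, j) \<in> R \<or> (j, i) \<in> R" using ij unfolding R_def total_on_def by auto
    then show False using \<phi>(2) ij by (metis imageI mem_Collect_eq)
  qed
  then show ?thesis using \<phi>(1) by blast
qed

section \<open>The forcing relation\<close>

locale forcing_poset =
  fixes C :: "'v::zfc set" and le :: "'v \<Rightarrow> 'v \<Rightarrow> bool" and one :: 'v
  assumes le_refl: "p \<in> C \<Longrightarrow> le p p"
    and le_trans: "le p q \<Longrightarrow> le q r \<Longrightarrow> le p r"
    and one_in [simp]: "one \<in> C"
    and le_one [simp]: "p \<in> C \<Longrightarrow> le p one"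
    and small_C: "small C"
begin

abbreviation frc :: "'v \<Rightarrow> 'v fm \<Rightarrow> bool" (infix "\<tturnstile>" 50) where
  "p \<tturnstile> \<phi> \<equiv> forces C le \<phi> p"

abbreviation name :: "'v \<Rightarrow> bool" where "name \<equiv> is_name C"

abbreviation feq :: "'v \<Rightarrow> 'v \<Rightarrow> 'v \<Rightarrow> bool" where "feq \<equiv> forces_eq C le"
abbreviation fmem :: "'v \<Rightarrow> 'v \<Rightarrow> 'v \<Rightarrow> bool" where "fmem \<equiv> forces_mem C le"

definition dense_below :: "'v \<Rightarrow> ('v \<Rightarrow> bool) \<Rightarrow> bool" where
  "dense_below p P \<longleftrightarrow> (\<forall>q\<in>C. le q p \<longrightarrow> (\<exists>r\<in>C. le r q \<and> P r))"

lemma dense_belowI: "(\<And>q. q \<in> C \<Longrightarrow> le q p \<Longrightarrow> \<exists>r\<in>C. le r q \<and> P r) \<Longrightarrow> dense_below p P"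
  unfolding dense_below_def by blast

lemma dense_belowE:
  assumes "dense_below p P" "q \<in> C" "le q p"
  obtains r where "r \<in> C" "le r q" "le r p" "P r"
  using assms le_trans unfolding dense_below_def by blast

lemma dense_below_mono: "dense_below p P \<Longrightarrow> le q p \<Longrightarrow> dense_below q P"
  unfolding dense_below_def using le_trans by blast

lemma dense_below_weaken:
  "dense_below p P \<Longrightarrow> (\<And>r. r \<in> C \<Longrightarrow> le r p \<Longrightarrow> P r \<Longrightarrow> Q r) \<Longrightarrow> dense_below p Q"
  unfolding dense_below_def using le_trans by blast

lemma dense_below_const [simp]: "p \<in> C \<Longrightarrow> dense_below p (\<lambda>_. P) \<longleftrightarrow> P"
  unfolding dense_below_def using le_refl by blast

lemma dense_below_all: "(\<And>r. r \<in> C \<Longrightarrow> le r p \<Longrightarrow> P r) \<Longrightarrow> dense_below p P"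
  unfolding dense_below_def using le_refl by blast

lemma dense_below_cong:
  "(\<And>r. r \<in> C \<Longrightarrow> P r \<longleftrightarrow> Q r) \<Longrightarrow> dense_below p P \<longleftrightarrow> dense_below p Q"
  unfolding dense_below_def by blast

lemma dense_below_dense:
  "dense_below p (\<lambda>q. dense_below q P) \<Longrightarrow> dense_below p P"
  unfolding dense_below_def using le_refl le_trans by meson

lemma feq_iff:
  "feq p \<sigma> \<tau> \<longleftrightarrow>
    (\<forall>\<pi> s. vpair \<pi> s \<in> elts \<sigma> \<longrightarrow> dense_below p (\<lambda>r. le r s \<longrightarrow>
        (\<exists>\<rho> t. vpair \<rho> t \<in> elts \<tau> \<and> le r t \<and> feq r \<pi> \<rho>))) \<and>
    (\<forall>\<rho> t. vpair \<rho> t \<in> elts \<tau> \<longrightarrow> dense_below p (\<lambda>r. le r t \<longrightarrow>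
        (\<exists>\<pi> s. vpair \<pi> s \<in> elts \<sigma> \<and> le r s \<and> feq r \<pi> \<rho>)))"
  by (subst forces_eq.simps) (auto simp: dense_below_def)

lemma fmem_iff:
  "fmem p \<sigma> \<tau> \<longleftrightarrow> dense_below p (\<lambda>r. \<exists>\<pi> s. vpair \<pi> s \<in> elts \<tau> \<and> le r s \<and> feq r \<sigma> \<pi>)"
  unfolding forces_mem_def dense_below_def by blast

lemma feqD1:
  "feq p \<sigma> \<tau> \<Longrightarrow> vpair \<pi> s \<in> elts \<sigma> \<Longrightarrow>
    dense_below p (\<lambda>r. le r s \<longrightarrow> (\<exists>\<rho> t. vpair \<rho> t \<in> elts \<tau> \<and> le r t \<and> feq r \<pi> \<rho>))"
  by (subst (asm) feq_iff) blast

lemma feqD2: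
  "feq p \<sigma> \<tau> \<Longrightarrow> vpair \<rho> t \<in> elts \<tau> \<Longrightarrow>
    dense_below p (\<lambda>r. le r t \<longrightarrow> (\<exists>\<pi> s. vpair \<pi> s \<in> elts \<sigma> \<and> le r s \<and> feq r \<pi> \<rho>))"
  by (subst (asm) feq_iff) blast

lemma fmemE:
  assumes "fmem p \<sigma> \<tau>" "q \<in> C" "le q p"
  obtains r \<pi> s where "r \<in> C" "le r q" "le r p" "vpair \<pi> s \<in> elts \<tau>" "le r s" "feq r \<sigma> \<pi>"
  using dense_belowE[OF assms(1)[unfolded fmem_iff] assms(2,3)] by metis

lemma feq_mono: "feq p \<sigma> \<tau> \<Longrightarrow> le q p \<Longrightarrow> feq q \<sigma> \<tau>"
  by (subst (asm) feq_iff, subst feq_iff) (meson dense_below_mono)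

lemma feq_dense: "dense_below p (\<lambda>q. feq q \<sigma> \<tau>) \<Longrightarrow> feq p \<sigma> \<tau>"
proof (subst feq_iff, intro conjI allI impI)
  assume d: "dense_below p (\<lambda>q. feq q \<sigma> \<tau>)"
  show "dense_below p (\<lambda>r. le r s \<longrightarrow> (\<exists>\<rho> t. vpair \<rho> t \<in> elts \<tau> \<and> le r t \<and> feq r \<pi> \<rho>))"
    if "vpair \<pi> s \<in> elts \<sigma>" for \<pi> s
    by (rule dense_below_dense, rule dense_below_weaken[OF d], rule feqD1[OF _ that])
  show "dense_below p (\<lambda>r. le r t \<longrightarrow> (\<exists>\<pi> s. vpair \<pi> s \<in> elts \<sigma> \<and> le r s \<and> feq r \<pi> \<rho>))"
    if "vpair \<rho> t \<in> elts \<tau>" for \<rho> t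
    by (rule dense_below_dense, rule dense_below_weaken[OF d], rule feqD2[OF _ that])
qed

lemma fmem_mono: "fmem p \<sigma> \<tau> \<Longrightarrow> le q p \<Longrightarrow> fmem q \<sigma> \<tau>"
  unfolding fmem_iff by (rule dense_below_mono)

lemma fmem_dense: "dense_below p (\<lambda>q. fmem q \<sigma> \<tau>) \<Longrightarrow> fmem p \<sigma> \<tau>"
  unfolding fmem_iff by (rule dense_below_dense)

lemma frc_mono: "p \<tturnstile> \<phi> \<Longrightarrow> q \<in> C \<Longrightarrow> le q p \<Longrightarrow> q \<tturnstile> \<phi>"
proof (induction \<phi> arbitrary: p q)
  case (Neg \<phi>) then show ?case using le_trans[OF _ Neg.prems(3)] by auto
qed (auto intro: feq_mono fmem_mono)

text \<open>Justifies all later passages to stronger conditions. In the case of a negation, a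
  condition below p forcing \<phi> would have an extension forcing both \<phi> and its
  negation.\<close>

lemma frc_dense: "p \<in> C \<Longrightarrow> dense_below p (\<lambda>q. q \<tturnstile> \<phi>) \<Longrightarrow> p \<tturnstile> \<phi>"
proof (induction \<phi> arbitrary: p)
  case (Neg \<phi>)
  show ?case
  proof (simp, intro ballI impI notI)
    fix q assume q: "q \<in> C" "le q p" "q \<tturnstile> \<phi>"
    then obtain r where "r \<in> C" "le r q" "r \<tturnstile> Neg \<phi>" using Neg.prems by (meson dense_belowE)
    then show False using frc_mono[OF q(3)] le_refl by auto
  qed
next
  case (Forall F)
  show ?case
  proof (simp, intro allI impI)
    fix \<tau> assume t: "name \<tau>"
    have "dense_below p (\<lambda>q. q \<tturnstile> F \<tau>)"
      by (rule dense_below_weaken[OF Forall.prems(2)]) (simp add: t)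
    then show "p \<tturnstile> F \<tau>" using Forall.IH Forall.prems(1) by blast
  qed
next
  case (Conj \<phi> \<psi>)
  have "dense_below p (\<lambda>q. q \<tturnstile> \<phi>)" "dense_below p (\<lambda>q. q \<tturnstile> \<psi>)"
    by (rule dense_below_weaken[OF Conj.prems(2)], simp)+
  then show ?case using Conj.IH Conj.prems(1) by simp
qed (auto intro: feq_dense fmem_dense)

lemma frc_Neg: "p \<tturnstile> Neg \<phi> \<longleftrightarrow> (\<forall>q\<in>C. le q p \<longrightarrow> \<not> q \<tturnstile> \<phi>)"
  by simp

lemma frc_Imp:
  assumes "p \<in> C" shows "p \<tturnstile> Imp \<phi> \<psi> \<longleftrightarrow> (\<forall>q\<in>C. le q p \<longrightarrow> q \<tturnstile> \<phi> \<longrightarrow> q \<tturnstile> \<psi>)"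
proof
  assume l: "p \<tturnstile> Imp \<phi> \<psi>"
  show "\<forall>q\<in>C. le q p \<longrightarrow> q \<tturnstile> \<phi> \<longrightarrow> q \<tturnstile> \<psi>"
  proof (intro ballI impI, rule frc_dense)
    fix q assume q: "q \<in> C" "le q p" "q \<tturnstile> \<phi>"
    show "dense_below q (\<lambda>q. q \<tturnstile> \<psi>)"
    proof (rule dense_belowI)
      fix r assume r: "r \<in> C" "le r q"
      then have "r \<tturnstile> \<phi>" "le r p" using q frc_mono le_trans by meson+
      then show "\<exists>s\<in>C. le s r \<and> s \<tturnstile> \<psi>" using l r unfolding Imp_def by auto
    qed
  qed
next
  assume r: "\<forall>q\<in>C. le q p \<longrightarrow> q \<tturnstile> \<phi> \<longrightarrow> q \<tturnstile> \<psi>"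
  then show "p \<tturnstile> Imp \<phi> \<psi>" unfolding Imp_def using le_refl by auto
qed

lemma frc_Disj: "p \<tturnstile> Disj \<phi> \<psi> \<longleftrightarrow> dense_below p (\<lambda>r. r \<tturnstile> \<phi> \<or> r \<tturnstile> \<psi>)"
proof
  assume l: "p \<tturnstile> Disj \<phi> \<psi>"
  show "dense_below p (\<lambda>r. r \<tturnstile> \<phi> \<or> r \<tturnstile> \<psi>)"
  proof (rule dense_belowI, rule ccontr)
    fix q assume q: "q \<in> C" "le q p" "\<not> (\<exists>r\<in>C. le r q \<and> (r \<tturnstile> \<phi> \<or> r \<tturnstile> \<psi>))"
    then have "q \<tturnstile> Conj (Neg \<phi>) (Neg \<psi>)" by auto
    then show False using l q unfolding Disj_def by auto
  qed
next
  assume d: "dense_below p (\<lambda>r. r \<tturnstile> \<phi> \<or> r \<tturnstile> \<psi>)"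
  show "p \<tturnstile> Disj \<phi> \<psi>" unfolding Disj_def
    using d unfolding dense_below_def by auto
qed

lemma frc_Iff:
  assumes "p \<in> C" shows "p \<tturnstile> Iff \<phi> \<psi> \<longleftrightarrow> (\<forall>q\<in>C. le q p \<longrightarrow> q \<tturnstile> \<phi> \<longleftrightarrow> q \<tturnstile> \<psi>)"
  unfolding Iff_def using frc_Imp[OF assms] by auto

lemma frc_Exists:
  "p \<tturnstile> Exists F \<longleftrightarrow> dense_below p (\<lambda>r. \<exists>\<tau>. name \<tau> \<and> r \<tturnstile> F \<tau>)"
proof
  assume l: "p \<tturnstile> Exists F"
  show "dense_below p (\<lambda>r. \<exists>\<tau>. name \<tau> \<and> r \<tturnstile> F \<tau>)"
  proof (rule dense_belowI)
    fix q assume q: "q \<in> C" "le q p"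
    then have "\<not> q \<tturnstile> Forall (\<lambda>x. Neg (F x))" using l unfolding Exists_def by auto
    then obtain \<tau> r where "name \<tau>" "r \<in> C" "le r q" "r \<tturnstile> F \<tau>" by auto
    then show "\<exists>r\<in>C. le r q \<and> (\<exists>\<tau>. name \<tau> \<and> r \<tturnstile> F \<tau>)" by blast
  qed
next
  assume "dense_below p (\<lambda>r. \<exists>\<tau>. name \<tau> \<and> r \<tturnstile> F \<tau>)"
  then show "p \<tturnstile> Exists F" unfolding Exists_def dense_below_def by (auto; blast)
qed

lemma frc_All_in:
  assumes "p \<in> C"
  shows "p \<tturnstile> All_in a F \<longleftrightarrow> (\<forall>\<tau> q. name \<tau> \<longrightarrow> q \<in> C \<longrightarrow> le q p \<longrightarrow> fmem q \<tau> a \<longrightarrow> q \<tturnstile> F \<tau>)"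
  unfolding All_in_def using frc_Imp[OF assms] by auto

lemma frc_Ex_in:
  "p \<tturnstile> Ex_in a F \<longleftrightarrow> dense_below p (\<lambda>r. \<exists>\<tau>. name \<tau> \<and> fmem r \<tau> a \<and> r \<tturnstile> F \<tau>)"
  unfolding Ex_in_def using frc_Exists by auto

subsection \<open>Equality and membership of names\<close>

lemma name_iff: "name \<tau> \<longleftrightarrow> (\<forall>z\<in>elts \<tau>. \<exists>\<sigma> p. z = vpair \<sigma> p \<and> name \<sigma> \<and> p \<in> C)"
  by (subst is_name.simps) auto

lemma name_elt: "name \<tau> \<Longrightarrow> vpair \<sigma> p \<in> elts \<tau> \<Longrightarrow> name \<sigma> \<and> p \<in> C"
proof -
  assume "name \<tau>" "vpair \<sigma> p \<in> elts \<tau>"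
  then have "\<exists>\<sigma>' p'. vpair \<sigma> p = vpair \<sigma>' p' \<and> name \<sigma>' \<and> p' \<in> C" using name_iff[of \<tau>] by blast
  then show ?thesis by auto
qed

lemma feq_refl: "name \<sigma> \<Longrightarrow> feq p \<sigma> \<sigma>"
proof (induction \<sigma> arbitrary: p rule: is_name.induct)
  case (1 \<tau>)
  have *: "feq r \<pi> \<pi>" if "vpair \<pi> s \<in> elts \<tau>" for r \<pi> s using 1[OF that] by auto
  then show ?case
    by (subst feq_iff, intro conjI allI impI; intro dense_below_all impI) (use * in blast)+
qed

lemma feq_sym: "feq p \<sigma> \<tau> \<Longrightarrow> feq p \<tau> \<sigma>"
proof (induction rule: forces_eq.induct)
  case (1 \<sigma> p \<tau>)
  show ?case
    by (rule forces_eq.intros) (use 1 in \<open>fast+\<close>)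
qed

lemma feq_ext_elt:
  assumes n: "name \<sigma>" "name \<tau>"
    and 1: "\<And>\<pi> s q. vpair \<pi> s \<in> elts \<sigma> \<Longrightarrow> q \<in> C \<Longrightarrow> le q p \<Longrightarrow> le q s \<Longrightarrow> fmem q \<pi> \<tau>"
    and 2: "\<And>\<pi> s q. vpair \<pi> s \<in> elts \<tau> \<Longrightarrow> q \<in> C \<Longrightarrow> le q p \<Longrightarrow> le q s \<Longrightarrow> fmem q \<pi> \<sigma>"
  shows "feq p \<sigma> \<tau>"
proof -
  have *: "dense_below p (\<lambda>r. le r s \<longrightarrow> (\<exists>\<rho> t. vpair \<rho> t \<in> elts \<tau> \<and> le r t \<and> feq r \<pi> \<rho>))"
    if m: "\<And>q. q \<in> C \<Longrightarrow> le q p \<Longrightarrow> le q s \<Longrightarrow> fmem q \<pi> \<tau>" for \<pi> s \<tau>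
  proof (rule dense_belowI)
    fix q assume q: "q \<in> C" "le q p"
    show "\<exists>r\<in>C. le r q \<and> (le r s \<longrightarrow> (\<exists>\<rho> t. vpair \<rho> t \<in> elts \<tau> \<and> le r t \<and> feq r \<pi> \<rho>))"
    proof (cases "\<exists>r\<in>C. le r q \<and> le r s")
      \<comment> \<open>No condition below q lies below s, so the implication holds vacuously at q
        itself.\<close>
      case False then show ?thesis using q le_refl by blast
    next
      case True
      then obtain r where r: "r \<in> C" "le r q" "le r s" by blast
      then have "fmem r \<pi> \<tau>" using m q le_trans by blast
      then show ?thesis using fmemE[of r \<pi> \<tau> r] r le_refl le_trans by metis
    qed
  qed
  show ?thesis
  proof (subst feq_iff, intro conjI allI impI)
    fix \<pi> s assume "vpair \<pi> s \<in> elts \<sigma>"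
    then show "dense_below p (\<lambda>r. le r s \<longrightarrow> (\<exists>\<rho> t. vpair \<rho> t \<in> elts \<tau> \<and> le r t \<and> feq r \<pi> \<rho>))"
      by (intro * 1)
  next
    fix \<pi> s assume "vpair \<pi> s \<in> elts \<tau>"
    then have "dense_below p (\<lambda>r. le r s \<longrightarrow> (\<exists>\<rho> t. vpair \<rho> t \<in> elts \<sigma> \<and> le r t \<and> feq r \<pi> \<rho>))"
      by (intro * 2)
    then show "dense_below p (\<lambda>r. le r s \<longrightarrow> (\<exists>\<rho> t. vpair \<rho> t \<in> elts \<sigma> \<and> le r t \<and> feq r \<rho> \<pi>))"
      by (rule dense_below_weaken) (use feq_sym in blast)
  qed
qed

lemma feq_fmem:
  assumes "feq p \<sigma> \<tau>" "vpair \<pi> s \<in> elts \<sigma>" "le q p" "le q s" shows "fmem q \<pi> \<tau>"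
  unfolding fmem_iff
  by (rule dense_below_weaken[OF dense_below_mono[OF feqD1[OF assms(1,2)] assms(3)]]) (use assms(4) le_trans in blast)

text \<open>Induction on the first name with the other two arbitrary. An element of
  \<open>\<upsilon>\<close> is traced back through \<open>\<tau>\<close> to \<open>\<sigma>\<close>;
  symmetry then turns the two equalities round, so that the hypothesis for an element of
  \<open>\<sigma>\<close> applies in this direction as well.\<close>

lemma feq_trans:
  assumes "name \<sigma>" "name \<tau>" "name \<upsilon>" "feq p \<sigma> \<tau>" "feq p \<tau> \<upsilon>" shows "feq p \<sigma> \<upsilon>"
  using assms
proof (induction \<sigma> arbitrary: p \<tau> \<upsilon> rule: is_name.induct)
  case (1 \<sigma>)
  have IH: "feq r \<pi> \<kappa>" if "vpair \<pi> s \<in> elts \<sigma>" "vpair \<rho> t \<in> elts \<tau>" "vpair \<kappa> u \<in> elts \<upsilon>" "feq r \<pi> \<rho>" "feq r \<rho> \<kappa>"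
    for r \<pi> s \<rho> t \<kappa> u
    using 1(1)[OF that(1)] that 1(2,3) name_elt by (metis vpair_inject)
  have "name \<sigma>" using 1(1) name_iff by blast
  then show ?case
  proof (rule feq_ext_elt[OF _ 1(3)])
    fix \<pi> s q assume \<pi>: "vpair \<pi> s \<in> elts \<sigma>" "q \<in> C" "le q p" "le q s"
    show "fmem q \<pi> \<upsilon>"
    proof (rule fmem_dense, rule dense_below_weaken[OF feq_fmem[OF 1(4) \<pi>(1,3,4), unfolded fmem_iff]])
      fix r assume r: "r \<in> C" "le r q" "\<exists>\<rho> t. vpair \<rho> t \<in> elts \<tau> \<and> le r t \<and> feq r \<pi> \<rho>"
      then obtain \<rho> t where \<rho>: "vpair \<rho> t \<in> elts \<tau>" "le r t" "feq r \<pi> \<rho>" by blast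
      show "fmem r \<pi> \<upsilon>" unfolding fmem_iff
        by (rule dense_below_weaken[OF feq_fmem[OF 1(5) \<rho>(1) le_trans[OF r(2) \<pi>(3)] \<rho>(2), unfolded fmem_iff]])
          (use IH[OF \<pi>(1) \<rho>(1)] feq_mono[OF \<rho>(3)] in blast)
    qed
  next
    fix \<kappa> u q assume \<kappa>: "vpair \<kappa> u \<in> elts \<upsilon>" "q \<in> C" "le q p" "le q u"
    show "fmem q \<kappa> \<sigma>"
    proof (rule fmem_dense, rule dense_below_weaken[OF feq_fmem[OF feq_sym[OF 1(5)] \<kappa>(1,3,4), unfolded fmem_iff]])
      fix r assume r: "r \<in> C" "le r q" "\<exists>\<rho> t. vpair \<rho> t \<in> elts \<tau> \<and> le r t \<and> feq r \<kappa> \<rho>"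
      then obtain \<rho> t where \<rho>: "vpair \<rho> t \<in> elts \<tau>" "le r t" "feq r \<kappa> \<rho>" by blast
      show "fmem r \<kappa> \<sigma>" unfolding fmem_iff
        by (rule dense_below_weaken[OF feq_fmem[OF feq_sym[OF 1(4)] \<rho>(1) le_trans[OF r(2) \<kappa>(3)] \<rho>(2), unfolded fmem_iff]])
          (use IH[OF _ \<rho>(1) \<kappa>(1)] feq_mono[OF feq_sym[OF \<rho>(3)]] feq_sym in blast)
    qed
  qed
qed

lemma fmem_elt: "name \<tau> \<Longrightarrow> vpair \<pi> s \<in> elts \<tau> \<Longrightarrow> le p s \<Longrightarrow> fmem p \<pi> \<tau>"
  unfolding fmem_iff by (rule dense_below_all) (use name_elt feq_refl le_trans in blast)

lemma fmem_cong_left: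
  assumes "name \<sigma>" "name \<sigma>'" "name \<tau>" "feq p \<sigma> \<sigma>'" "fmem p \<sigma> \<tau>" shows "fmem p \<sigma>' \<tau>"
  using assms(5) unfolding fmem_iff
  by (rule dense_below_weaken) (meson assms feq_mono feq_sym feq_trans name_elt)

lemma fmem_cong_right:
  assumes "name \<sigma>" "name \<tau>" "name \<tau>'" "feq p \<tau> \<tau>'" "fmem p \<sigma> \<tau>" shows "fmem p \<sigma> \<tau>'"
proof (rule fmem_dense, rule dense_belowI)
  fix q assume q: "q \<in> C" "le q p"
  then obtain r \<pi> s where r: "r \<in> C" "le r q" "le r p" "vpair \<pi> s \<in> elts \<tau>" "le r s" "feq r \<sigma> \<pi>"
    using fmemE[OF assms(5)] by metis
  then obtain r' \<rho> t where r': "r' \<in> C" "le r' r" "vpair \<rho> t \<in> elts \<tau>'" "le r' t" "feq r' \<pi> \<rho>"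
    using dense_belowE[OF feqD1[OF assms(4) r(4)] r(1,3)] le_trans[OF _ r(5)] by metis
  have "feq r' \<sigma> \<rho>"
    using feq_trans[of \<sigma> \<pi> \<rho> r'] assms r r' name_elt feq_mono by blast
  then have "fmem r' \<sigma> \<tau>'" unfolding fmem_iff
    using r' le_trans feq_mono by (intro dense_below_all) blast
  then show "\<exists>r\<in>C. le r q \<and> fmem r \<sigma> \<tau>'" using r r' le_trans by blast
qed

lemma feq_ext:
  assumes n: "name \<sigma>" "name \<tau>"
    and "\<And>\<pi> q. name \<pi> \<Longrightarrow> q \<in> C \<Longrightarrow> le q p \<Longrightarrow> fmem q \<pi> \<sigma> \<longleftrightarrow> fmem q \<pi> \<tau>"
  shows "feq p \<sigma> \<tau>"
  by (rule feq_ext_elt[OF n]) (use assms fmem_elt name_elt in meson)+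

abbreviation same :: "'v \<Rightarrow> 'v \<Rightarrow> 'v \<Rightarrow> bool" where
  "same p x y \<equiv> name x \<and> name y \<and> feq p x y"

text \<open>Two formulas are related if they differ only in parameters that \<open>p\<close> forces to be equal. The
  higher-order syntax admits formulas that inspect their parameters, so the substitution of equals has
  to be justified formula by formula.\<close>

inductive fm_eq :: "'v \<Rightarrow> 'v fm \<Rightarrow> 'v fm \<Rightarrow> bool" for p where
  fm_eq_Mem: "same p a c \<Longrightarrow> same p b d \<Longrightarrow> fm_eq p (Mem a b) (Mem c d)"
| fm_eq_Eql: "same p a c \<Longrightarrow> same p b d \<Longrightarrow> fm_eq p (Eql a b) (Eql c d)"
| fm_eq_Neg: "fm_eq p \<phi> \<psi> \<Longrightarrow> fm_eq p (Neg \<phi>) (Neg \<psi>)"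
| fm_eq_Conj: "fm_eq p \<phi> \<psi> \<Longrightarrow> fm_eq p \<phi>' \<psi>' \<Longrightarrow> fm_eq p (Conj \<phi> \<phi>') (Conj \<psi> \<psi>')"
| fm_eq_Forall: "(\<And>x. name x \<Longrightarrow> fm_eq p (F x) (G x)) \<Longrightarrow> fm_eq p (Forall F) (Forall G)"

lemma fm_eq_frc: "fm_eq p \<phi> \<psi> \<Longrightarrow> q \<in> C \<Longrightarrow> le q p \<Longrightarrow> q \<tturnstile> \<phi> \<longleftrightarrow> q \<tturnstile> \<psi>"
proof (induction arbitrary: q rule: fm_eq.induct)
  case (fm_eq_Mem a c b d)
  then have n: "name a" "name b" "name c" "name d" and "feq q a c" "feq q b d" using feq_mono by auto
  then have "feq q a c" "feq q b d" "feq q c a" "feq q d b" using feq_sym by auto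
  then have "fmem q a b \<Longrightarrow> fmem q c d" "fmem q c d \<Longrightarrow> fmem q a b"
    using n fmem_cong_left[of a c b q] fmem_cong_right[of c b d q]
      fmem_cong_left[of c a d q] fmem_cong_right[of a d b q] by blast+
  then show ?case by auto
next
  case (fm_eq_Eql a c b d)
  then have n: "name a" "name b" "name c" "name d" and "feq q a c" "feq q b d" using feq_mono by auto
  then have "feq q a c" "feq q b d" "feq q c a" "feq q d b" using feq_sym by auto
  then have "feq q a b \<Longrightarrow> feq q c d" "feq q c d \<Longrightarrow> feq q a b"
    using n feq_trans[of c a b q] feq_trans[of c b d q] feq_trans[of a c d q] feq_trans[of a d b q] by blast+
  then show ?case by auto
next
  case (fm_eq_Neg \<phi> \<psi>)
  then show ?case using le_trans[OF _ fm_eq_Neg.prems(2)] by auto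
qed auto

lemma fm_eq_Imp: "fm_eq p \<phi> \<psi> \<Longrightarrow> fm_eq p \<phi>' \<psi>' \<Longrightarrow> fm_eq p (Imp \<phi> \<phi>') (Imp \<psi> \<psi>')"
  unfolding Imp_def by (intro fm_eq.intros)

lemma fm_eq_Disj: "fm_eq p \<phi> \<psi> \<Longrightarrow> fm_eq p \<phi>' \<psi>' \<Longrightarrow> fm_eq p (Disj \<phi> \<phi>') (Disj \<psi> \<psi>')"
  unfolding Disj_def by (intro fm_eq.intros)

lemma fm_eq_Iff: "fm_eq p \<phi> \<psi> \<Longrightarrow> fm_eq p \<phi>' \<psi>' \<Longrightarrow> fm_eq p (Iff \<phi> \<phi>') (Iff \<psi> \<psi>')"
  unfolding Iff_def by (intro fm_eq.intros fm_eq_Imp)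

lemma fm_eq_Exists: "(\<And>x. name x \<Longrightarrow> fm_eq p (F x) (G x)) \<Longrightarrow> fm_eq p (Exists F) (Exists G)"
  unfolding Exists_def by (intro fm_eq.intros)

lemma fm_eq_All_in:
  assumes "same p a b" "\<And>x. name x \<Longrightarrow> fm_eq p (F x) (G x)"
  shows "fm_eq p (All_in a F) (All_in b G)"
  unfolding All_in_def by (intro fm_eq.intros fm_eq_Imp assms) (auto intro: feq_refl)

lemma fm_eq_Ex_in:
  assumes "same p a b" "\<And>x. name x \<Longrightarrow> fm_eq p (F x) (G x)"
  shows "fm_eq p (Ex_in a F) (Ex_in b G)"
  unfolding Ex_in_def by (intro fm_eq.intros fm_eq_Exists assms) (auto intro: feq_refl)

lemmas fm_eq_rules = fm_eq_Mem fm_eq_Eql fm_eq_Neg fm_eq_Conj fm_eq_Forall fm_eq_Imp fm_eq_Disj fm_eq_Iff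
  fm_eq_Exists fm_eq_All_in fm_eq_Ex_in

text \<open>The condition under which a quantifier bounded by a name may be reduced to the elements
  of that name.\<close>

definition congruent_fm :: "('v \<Rightarrow> 'v fm) \<Rightarrow> bool" where
  "congruent_fm F \<longleftrightarrow> (\<forall>p \<sigma> \<tau>. same p \<sigma> \<tau> \<longrightarrow> fm_eq p (F \<sigma>) (F \<tau>))"

lemma congruent_fmI:
  "(\<And>p \<sigma> \<tau>. same p \<sigma> \<tau> \<Longrightarrow> fm_eq p (F \<sigma>) (F \<tau>)) \<Longrightarrow> congruent_fm F"
  unfolding congruent_fm_def by blast

lemma congruent_fmD:
  "congruent_fm F \<Longrightarrow> name \<sigma> \<Longrightarrow> name \<tau> \<Longrightarrow> feq p \<sigma> \<tau> \<Longrightarrow> p \<in> C \<Longrightarrow> p \<tturnstile> F \<sigma> \<longleftrightarrow> p \<tturnstile> F \<tau>"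
  unfolding congruent_fm_def using fm_eq_frc le_refl by blast

text \<open>A name forced into \<open>\<tau>\<close> is densely equal to one of the elements listed
  in \<open>\<tau>\<close>, and congruence carries F over from that element.\<close>

lemma frc_All_in_name:
  assumes "p \<in> C" "congruent_fm F" "name \<tau>"
  shows "p \<tturnstile> All_in \<tau> F \<longleftrightarrow> (\<forall>\<pi> s q. vpair \<pi> s \<in> elts \<tau> \<longrightarrow> q \<in> C \<longrightarrow> le q p \<longrightarrow> le q s \<longrightarrow> q \<tturnstile> F \<pi>)"
  (is "?l \<longleftrightarrow> ?r")
proof
  assume ?l then show ?r unfolding frc_All_in[OF assms(1)] using fmem_elt name_elt assms(3) by meson
next
  assume r: ?r
  show ?l unfolding frc_All_in[OF assms(1)]
  proof (intro allI impI)
    fix \<sigma> q assume q: "name \<sigma>" "q \<in> C" "le q p" "fmem q \<sigma> \<tau>"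
    show "q \<tturnstile> F \<sigma>"
      by (rule frc_dense[OF q(2)], rule dense_below_weaken[OF q(4)[unfolded fmem_iff]])
        (meson assms(2,3) congruent_fmD le_trans name_elt q(1) q(3) r)
  qed
qed

lemma frc_Ex_in_name:
  assumes "congruent_fm F" "name \<tau>"
  shows "p \<tturnstile> Ex_in \<tau> F \<longleftrightarrow> dense_below p (\<lambda>r. \<exists>\<pi> s. vpair \<pi> s \<in> elts \<tau> \<and> le r s \<and> r \<tturnstile> F \<pi>)"
  (is "?l \<longleftrightarrow> ?r")
proof
  assume ?r then show ?l unfolding frc_Ex_in
    by (rule dense_below_weaken) (use assms fmem_elt name_elt in meson)
next
  assume l: ?l
  show ?r
  proof (rule dense_below_dense, rule dense_below_weaken[OF l[unfolded frc_Ex_in]])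
    fix r assume r: "r \<in> C" "le r p" "\<exists>\<sigma>. name \<sigma> \<and> fmem r \<sigma> \<tau> \<and> r \<tturnstile> F \<sigma>"
    then obtain \<sigma> where s: "name \<sigma>" "fmem r \<sigma> \<tau>" "r \<tturnstile> F \<sigma>" by blast
    show "dense_below r (\<lambda>r. \<exists>\<pi> s. vpair \<pi> s \<in> elts \<tau> \<and> le r s \<and> r \<tturnstile> F \<pi>)"
      by (rule dense_below_weaken[OF s(2)[unfolded fmem_iff]])
        (meson assms congruent_fmD frc_mono name_elt s)
  qed
qed

subsection \<open>Names for pairs\<close>

text \<open>Both members carry the weakest condition, so they belong to the pair outright. Applied
  twice this gives the Kuratowski pair \<open>pairn\<close> of names.\<close>

definition upn :: "'v \<Rightarrow> 'v \<Rightarrow> 'v" where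
  "upn a b = set_of {vpair a one, vpair b one}"

definition pairn :: "'v \<Rightarrow> 'v \<Rightarrow> 'v" where
  "pairn a b = upn (upn a a) (upn a b)"

lemma elts_upn: "elts (upn a b) = {vpair a one, vpair b one}"
  by (simp add: upn_def)

lemma name_upn [simp, intro]: "name a \<Longrightarrow> name b \<Longrightarrow> name (upn a b)"
  by (subst name_iff) (auto simp: elts_upn)

lemma name_pairn [simp, intro]: "name a \<Longrightarrow> name b \<Longrightarrow> name (pairn a b)"
  by (simp add: pairn_def)

lemma fmem_upn: "fmem p x (upn a b) \<longleftrightarrow> dense_below p (\<lambda>r. feq r x a \<or> feq r x b)"
  unfolding fmem_iff elts_upn by (rule dense_below_cong) (simp, metis le_one)

lemma fmem_upnI [simp]: "name a \<Longrightarrow> fmem p a (upn a b)" "name b \<Longrightarrow> fmem p b (upn a b)"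
  unfolding fmem_upn by (simp_all add: dense_below_all feq_refl)

lemma frc_upair:
  assumes "p \<in> C" "name z" "name a" "name b"
  shows "p \<tturnstile> upair_fm z a b \<longleftrightarrow> feq p z (upn a b)"
proof -
  have "p \<tturnstile> upair_fm z a b \<longleftrightarrow>
    (\<forall>x. name x \<longrightarrow> (\<forall>q\<in>C. le q p \<longrightarrow> fmem q x z \<longleftrightarrow> fmem q x (upn a b)))"
    by (simp add: upair_fm_def frc_Iff[OF assms(1)] frc_Disj fmem_upn)
  also have "\<dots> \<longleftrightarrow> feq p z (upn a b)"
    using assms feq_ext[of z "upn a b" p] fmem_cong_right[of _ z "upn a b"] fmem_cong_right[of _ "upn a b" z]
      feq_mono[of p z "upn a b"] feq_sym[of _ z "upn a b"] by (meson name_upn)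
  finally show ?thesis .
qed

lemma frc_pair:
  assumes "p \<in> C" "name z" "name a" "name b"
  shows "p \<tturnstile> pair_fm z a b \<longleftrightarrow> feq p z (pairn a b)"
proof -
  have "p \<tturnstile> pair_fm z a b \<longleftrightarrow>
    (\<forall>x. name x \<longrightarrow> (\<forall>q\<in>C. le q p \<longrightarrow> fmem q x z \<longleftrightarrow> fmem q x (pairn a b)))"
  proof -
    have *: "dense_below q (\<lambda>r. r \<tturnstile> upair_fm x a a \<or> r \<tturnstile> upair_fm x a b) \<longleftrightarrow> fmem q x (pairn a b)"
      if "name x" "q \<in> C" for x q
      unfolding pairn_def fmem_upn using that assms
      by (auto simp: frc_upair elim!: dense_below_weaken)
    show ?thesis
      by (auto simp: pair_fm_def frc_Iff[OF assms(1)] frc_Disj *)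
  qed
  also have "\<dots> \<longleftrightarrow> feq p z (pairn a b)"
    using assms feq_ext[of z "pairn a b" p] fmem_cong_right[of _ z "pairn a b"] fmem_cong_right[of _ "pairn a b" z]
      feq_mono[of p z "pairn a b"] feq_sym[of _ z "pairn a b"] by (meson name_pairn)
  finally show ?thesis .
qed

lemma frc_pair_in:
  assumes "p \<in> C" "name f" "name a" "name b"
  shows "p \<tturnstile> pair_in_fm a b f \<longleftrightarrow> fmem p (pairn a b) f"
proof
  assume "p \<tturnstile> pair_in_fm a b f"
  then show "fmem p (pairn a b) f" unfolding pair_in_fm_def frc_Ex_in
    by (intro fmem_dense, elim dense_below_weaken) (metis assms frc_pair fmem_cong_left name_pairn)
next
  assume "fmem p (pairn a b) f"
  then show "p \<tturnstile> pair_in_fm a b f" unfolding pair_in_fm_def frc_Ex_in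
    by (intro dense_below_all exI[of _ "pairn a b"])
       (simp add: assms frc_pair fmem_mono feq_refl)
qed

lemma feq_upn: "name a \<Longrightarrow> name b \<Longrightarrow> name c \<Longrightarrow> name d \<Longrightarrow> feq p a c \<Longrightarrow> feq p b d \<Longrightarrow> feq p (upn a b) (upn c d)"
proof (rule feq_ext_elt)
  assume n: "name a" "name b" "name c" "name d" and e: "feq p a c" "feq p b d"
  fix \<pi> s q assume q: "q \<in> C" "le q p"
  have m: "feq q c a" "feq q d b" "feq q a c" "feq q b d" using e q feq_mono feq_sym by blast+
  show "fmem q \<pi> (upn c d)" if "vpair \<pi> s \<in> elts (upn a b)"
    unfolding fmem_upn by (rule dense_below_all) (use that[unfolded elts_upn] m feq_mono in \<open>simp, metis\<close>)
  show "fmem q \<pi> (upn a b)" if "vpair \<pi> s \<in> elts (upn c d)"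
    unfolding fmem_upn by (rule dense_below_all) (use that[unfolded elts_upn] m feq_mono in \<open>simp, metis\<close>)
qed auto

lemma feq_pairn: "name a \<Longrightarrow> name b \<Longrightarrow> name c \<Longrightarrow> name d \<Longrightarrow> feq p a c \<Longrightarrow> feq p b d \<Longrightarrow> feq p (pairn a b) (pairn c d)"
  unfolding pairn_def by (intro feq_upn) auto

lemma upn_single_inject:
  assumes "name a" "name c" "name d" "feq p (upn a a) (upn c d)"
  shows "feq p c a" "feq p d a"
proof -
  have "fmem p x (upn a a)" if "x \<in> {c, d}" for x
    by (rule fmem_cong_right[of _ "upn c d"])
      (use assms that feq_sym in auto)
  then show "feq p c a" "feq p d a" by (auto simp: fmem_upn intro!: feq_dense)
qed

text \<open>Below any condition b equals a or d. Where b equals a, the member d of {a, b} equals a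
  or b, hence b in either case.\<close>

lemma upn_inject:
  assumes n: "name a" "name b" "name d" and p: "p \<in> C" "feq p (upn a b) (upn a d)"
  shows "feq p b d"
proof (rule feq_dense, rule dense_belowI)
  fix q assume q: "q \<in> C" "le q p"
  have m: "fmem q b (upn a d)"
    by (rule fmem_cong_right[of _ "upn a b"]) (use n q p feq_mono in auto)
  obtain r where r: "r \<in> C" "le r q" "feq r b a \<or> feq r b d"
    using dense_belowE[OF m[unfolded fmem_upn] q(1) le_refl[OF q(1)]] by metis
  show "\<exists>r\<in>C. le r q \<and> feq r b d"
  proof (cases "feq r b d")
    case False
    then have ba: "feq r b a" using r by blast
    have "feq r (upn a b) (upn a d)" using p q r feq_mono by blast
    from feq_sym[OF this] have md: "fmem r d (upn a b)"
      by (rule fmem_cong_right[rotated 3]) (simp_all add: n)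
    obtain s where s: "s \<in> C" "le s r" "feq s d a \<or> feq s d b"
      using dense_belowE[OF md[unfolded fmem_upn] r(1) le_refl[OF r(1)]] by metis
    then have "feq s b d" using n ba feq_mono feq_sym feq_trans by meson
    then show ?thesis using r s le_trans by blast
  qed (use r in blast)
qed

lemma pairn_inject:
  assumes n: "name a" "name b" "name c" "name d" and p: "p \<in> C" and e: "feq p (pairn a b) (pairn c d)"
  shows "feq p a c" "feq p b d"
proof -
  have "fmem p (upn a a) (pairn c d)"
    by (rule fmem_cong_right[of _ "pairn a b"]) (use n e in \<open>simp_all add: pairn_def\<close>)
  then have "dense_below p (\<lambda>r. feq r (upn a a) (upn c c) \<or> feq r (upn a a) (upn c d))"
    by (simp add: pairn_def fmem_upn)
  then have "dense_below p (\<lambda>r. feq r a c)"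
    by (rule dense_below_weaken) (use upn_single_inject(1)[OF n(1,3,3)] upn_single_inject(1)[OF n(1,3,4)] feq_sym in blast)
  then show ac: "feq p a c" by (rule feq_dense)
  have "feq p (pairn c d) (pairn a d)" by (intro feq_pairn n feq_refl feq_sym[OF ac])
  then have "feq p (upn (upn a a) (upn a b)) (upn (upn a a) (upn a d))"
    using e n feq_trans unfolding pairn_def by (meson name_upn)
  then have "feq p (upn a b) (upn a d)" by (rule upn_inject[rotated 4]) (use n p in auto)
  then show "feq p b d" by (rule upn_inject[OF n(1,2,4) p])
qed

subsection \<open>Canonical names\<close>

abbreviation chk :: "'v \<Rightarrow> 'v" where "chk \<equiv> check one"

lemma elts_chk: "elts (chk x) = (\<lambda>y. vpair (chk y) one) ` elts x"
  by (subst check.simps) simp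

lemma vpair_in_chk [simp]: "vpair \<pi> s \<in> elts (chk x) \<longleftrightarrow> s = one \<and> (\<exists>y\<in>elts x. \<pi> = chk y)"
  by (auto simp: elts_chk)

lemma name_chk [simp, intro]: "name (chk x)"
proof (induction x rule: elts_induct)
  case (step x)
  then show ?case by (subst name_iff) (auto simp: elts_chk)
qed

lemma chk_upair: "chk (set_of {x, y}) = upn (chk x) (chk y)"
  by (rule zfc_extensionality) (simp add: elts_chk elts_upn)

lemma chk_vpair: "chk (vpair x y) = pairn (chk x) (chk y)"
  using chk_upair[of x x] by (simp add: vpair_def chk_upair pairn_def)

lemma fmem_chk: "p \<in> C \<Longrightarrow> fmem p \<sigma> (chk x) \<longleftrightarrow> dense_below p (\<lambda>r. \<exists>y\<in>elts x. feq r \<sigma> (chk y))"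
  unfolding fmem_iff by (rule dense_below_cong) auto

lemma fmem_chkI: "y \<in> elts x \<Longrightarrow> p \<in> C \<Longrightarrow> fmem p (chk y) (chk x)"
  by (rule fmem_elt[of _ _ one]) (auto simp: elts_chk)

text \<open>If p forces the two canonical names equal, then for each element of one side some
  stronger condition equates it with a definite element of the other. The induction hypothesis at
  that stronger condition makes the two elements really equal, so the sets have the same
  elements.\<close>

lemma feq_chk: "p \<in> C \<Longrightarrow> feq p (chk x) (chk y) \<longleftrightarrow> x = y"
proof (induction x arbitrary: y p rule: elts_induct)
  case (step x)
  show ?case
  proof
    assume e: "feq p (chk x) (chk y)"
    have "elts x = elts y"
    proof (intro equalityI subsetI)
      fix z assume z: "z \<in> elts x"
      have "fmem p (chk z) (chk y)"
        by (rule fmem_cong_right[OF _ _ _ e fmem_chkI[OF z step.prems]]) simp_all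
      from dense_belowE[OF this[unfolded fmem_chk[OF step.prems]] step.prems le_refl[OF step.prems]]
      obtain r w where "r \<in> C" "w \<in> elts y" "feq r (chk z) (chk w)" by metis
      then show "z \<in> elts y" using step.IH z by metis
    next
      fix z assume z: "z \<in> elts y"
      have "fmem p (chk z) (chk x)"
        by (rule fmem_cong_right[OF _ _ _ feq_sym[OF e] fmem_chkI[OF z step.prems]]) simp_all
      from dense_belowE[OF this[unfolded fmem_chk[OF step.prems]] step.prems le_refl[OF step.prems]]
      obtain r w where "r \<in> C" "w \<in> elts x" "feq r (chk w) (chk z)" using feq_sym by metis
      then show "z \<in> elts x" using step.IH by metis
    qed
    then show "x = y" by (rule zfc_extensionality)
  qed (auto intro: feq_refl)
qed

lemma fmem_chk_chk: "p \<in> C \<Longrightarrow> fmem p (chk y) (chk x) \<longleftrightarrow> y \<in> elts x"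
proof -
  assume p: "p \<in> C"
  have "dense_below p (\<lambda>r. \<exists>z\<in>elts x. feq r (chk y) (chk z)) \<longleftrightarrow> dense_below p (\<lambda>r. y \<in> elts x)"
    by (auto elim!: dense_below_weaken simp: feq_chk)
  then show ?thesis using fmem_chk[OF p] p by simp
qed

lemma frc_All_in_chk:
  assumes "p \<in> C" "congruent_fm F"
  shows "p \<tturnstile> All_in (chk x) F \<longleftrightarrow> (\<forall>y\<in>elts x. p \<tturnstile> F (chk y))"
  unfolding frc_All_in_name[OF assms name_chk]
  using assms(1) le_refl frc_mono by (simp, metis le_one)

lemma frc_Ex_in_chk:
  assumes "p \<in> C" "congruent_fm F"
  shows "p \<tturnstile> Ex_in (chk x) F \<longleftrightarrow> dense_below p (\<lambda>r. \<exists>y\<in>elts x. r \<tturnstile> F (chk y))"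
  unfolding frc_Ex_in_name[OF assms(2) name_chk]
  by (rule dense_below_cong) auto

lemma frc_All_in_chkI:
  assumes "p \<in> C" "congruent_fm F" "\<And>y. y \<in> elts x \<Longrightarrow> p \<tturnstile> F (chk y)"
  shows "p \<tturnstile> All_in (chk x) F"
  using assms by (simp add: frc_All_in_chk)

lemma frc_All_inI:
  "p \<in> C \<Longrightarrow> (\<And>y q. name y \<Longrightarrow> q \<in> C \<Longrightarrow> le q p \<Longrightarrow> fmem q y a \<Longrightarrow> q \<tturnstile> F y) \<Longrightarrow> p \<tturnstile> All_in a F"
  by (simp add: frc_All_in)

lemma frc_Ex_inI:
  assumes "name y" "fmem p y a" "p \<tturnstile> F y" shows "p \<tturnstile> Ex_in a F"
  unfolding frc_Ex_in using assms by (intro dense_below_all) (meson fmem_mono frc_mono)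

lemma frc_Ex_in_chkI:
  assumes "p \<in> C" "y \<in> elts x" "p \<tturnstile> F (chk y)"
  shows "p \<tturnstile> Ex_in (chk x) F"
  using assms fmem_chkI name_chk frc_Ex_inI by blast

lemma frc_All_inD:
  assumes "p \<tturnstile> All_in a F" "p \<in> C" "q \<in> C" "le q p" "name y" "fmem q y a"
  shows "q \<tturnstile> F y"
  using assms frc_All_in by blast

lemma frc_ExistsI:
  assumes "name y" "p \<tturnstile> F y" shows "p \<tturnstile> Exists F"
  unfolding frc_Exists using assms by (intro dense_below_all) (meson frc_mono)

subsection \<open>Substitution of equals in the formulas at hand\<close>

lemma fm_eq_upair:
  "same p z z' \<Longrightarrow> same p x x' \<Longrightarrow> same p y y' \<Longrightarrow> fm_eq p (upair_fm z x y) (upair_fm z' x' y')"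
  unfolding upair_fm_def by (intro fm_eq_rules) (simp_all add: feq_refl)

lemma fm_eq_pair:
  "same p z z' \<Longrightarrow> same p x x' \<Longrightarrow> same p y y' \<Longrightarrow> fm_eq p (pair_fm z x y) (pair_fm z' x' y')"
  unfolding pair_fm_def by (intro fm_eq_rules fm_eq_upair) (simp_all add: feq_refl)

lemma fm_eq_pair_in:
  "same p x x' \<Longrightarrow> same p y y' \<Longrightarrow> same p f f' \<Longrightarrow> fm_eq p (pair_in_fm x y f) (pair_in_fm x' y' f')"
  unfolding pair_in_fm_def by (intro fm_eq_rules fm_eq_pair) (simp_all add: feq_refl)

lemma fm_eq_function:
  "same p f f' \<Longrightarrow> same p x x' \<Longrightarrow> same p y y' \<Longrightarrow> fm_eq p (function_fm f x y) (function_fm f' x' y')"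
  unfolding function_fm_def by (intro fm_eq_rules fm_eq_pair fm_eq_pair_in) (simp_all add: feq_refl)

lemma fm_eq_bijection:
  "same p f f' \<Longrightarrow> same p x x' \<Longrightarrow> same p y y' \<Longrightarrow> fm_eq p (bijection_fm f x y) (bijection_fm f' x' y')"
  unfolding bijection_fm_def by (intro fm_eq_rules fm_eq_function fm_eq_pair_in) (simp_all add: feq_refl)

lemma fm_eq_equinumerous:
  "same p x x' \<Longrightarrow> same p y y' \<Longrightarrow> fm_eq p (equinumerous_fm x y) (equinumerous_fm x' y')"
  unfolding equinumerous_fm_def by (intro fm_eq_rules fm_eq_bijection) (simp_all add: feq_refl)

lemma fm_eq_subset:
  "same p x x' \<Longrightarrow> same p y y' \<Longrightarrow> fm_eq p (subset_fm x y) (subset_fm x' y')"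
  unfolding subset_fm_def by (intro fm_eq_rules) (simp_all add: feq_refl)

lemma fm_eq_transitive:
  "same p x x' \<Longrightarrow> fm_eq p (transitive_fm x) (transitive_fm x')"
  unfolding transitive_fm_def by (intro fm_eq_rules fm_eq_subset) (simp_all add: feq_refl)

lemma fm_eq_ordinal:
  "same p x x' \<Longrightarrow> fm_eq p (ordinal_fm x) (ordinal_fm x')"
  unfolding ordinal_fm_def by (intro fm_eq_rules fm_eq_transitive) (simp_all add: feq_refl)

lemma fm_eq_cardinal:
  "same p x x' \<Longrightarrow> fm_eq p (cardinal_fm x) (cardinal_fm x')"
  unfolding cardinal_fm_def by (intro fm_eq_rules fm_eq_ordinal fm_eq_equinumerous) (simp_all add: feq_refl)

lemmas fm_eq_all = fm_eq_rules fm_eq_pair fm_eq_pair_in fm_eq_function fm_eq_bijection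
  fm_eq_equinumerous fm_eq_subset fm_eq_transitive fm_eq_ordinal fm_eq_cardinal

subsection \<open>Canonical names of functions and ordinals\<close>

lemma frc_pair_chk [simp]: "p \<in> C \<Longrightarrow> p \<tturnstile> pair_fm (chk z) (chk x) (chk y) \<longleftrightarrow> z = vpair x y"
  by (simp add: frc_pair feq_chk flip: chk_vpair)

lemma frc_pair_in_chk [simp]: "p \<in> C \<Longrightarrow> p \<tturnstile> pair_in_fm (chk x) (chk y) (chk f) \<longleftrightarrow> vpair x y \<in> elts f"
  by (simp add: frc_pair_in fmem_chk_chk flip: chk_vpair)

lemma frc_transitive_chk:
  assumes "p \<in> C" "\<forall>y\<in>elts x. elts y \<subseteq> elts x" shows "p \<tturnstile> transitive_fm (chk x)"
  unfolding transitive_fm_def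
proof (rule frc_All_in_chkI)
  show "congruent_fm (\<lambda>y. subset_fm y (chk x))"
    by (intro congruent_fmI fm_eq_all) (simp_all add: feq_refl)
  fix y assume y: "y \<in> elts x"
  show "p \<tturnstile> subset_fm (chk y) (chk x)" unfolding subset_fm_def
  proof (rule frc_All_in_chkI)
    show "congruent_fm (\<lambda>z. Mem z (chk x))" by (intro congruent_fmI fm_eq_all) (simp_all add: feq_refl)
  qed (use assms y in \<open>auto simp: fmem_chk_chk\<close>)
qed (fact assms(1))

lemma frc_ordinal_chk:
  assumes "p \<in> C" "ordinal x" shows "p \<tturnstile> ordinal_fm (chk x)"
proof -
  have "p \<tturnstile> All_in (chk x) transitive_fm"
  proof (rule frc_All_in_chkI)
    show "congruent_fm transitive_fm" by (intro congruent_fmI fm_eq_all)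
  qed (use assms in \<open>auto intro: frc_transitive_chk simp: ordinal_iff\<close>)
  then show ?thesis
    unfolding ordinal_fm_def using assms by (auto intro: frc_transitive_chk simp: ordinal_iff)
qed

text \<open>The common shape of the totality clause in \<open>function_fm\<close> and, with the
  arguments of R exchanged, of the inverse clause in \<open>bijection_fm\<close>; both are treated
  at once.\<close>

definition ex1_fm :: "'v \<Rightarrow> 'v \<Rightarrow> ('v \<Rightarrow> 'v \<Rightarrow> 'v fm) \<Rightarrow> 'v fm" where
  "ex1_fm a b R = All_in a (\<lambda>x. Ex_in b (\<lambda>y. Conj (R x y) (All_in b (\<lambda>y'. Imp (R x y') (Eql y' y)))))"

lemma frc_ex1I:
  assumes p: "p \<in> C" and n: "name a" "name b"
    and R: "\<And>p x x' y. same p x x' \<Longrightarrow> name y \<Longrightarrow> fm_eq p (R x y) (R x' y)"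
    and ex: "\<And>x s q. vpair x s \<in> elts a \<Longrightarrow> q \<in> C \<Longrightarrow> le q p \<Longrightarrow> le q s \<Longrightarrow>
              \<exists>r\<in>C. le r q \<and> (\<exists>y. name y \<and> fmem r y b \<and> r \<tturnstile> R x y)"
    and unique: "\<And>x y y' q. name x \<Longrightarrow> name y \<Longrightarrow> name y' \<Longrightarrow> q \<in> C \<Longrightarrow> le q p \<Longrightarrow>
              q \<tturnstile> R x y \<Longrightarrow> q \<tturnstile> R x y' \<Longrightarrow> feq q y y'"
  shows "p \<tturnstile> ex1_fm a b R"
proof -
  let ?U = "\<lambda>x y. Conj (R x y) (All_in b (\<lambda>y'. Imp (R x y') (Eql y' y)))"
  have c: "congruent_fm (\<lambda>x. Ex_in b (?U x))"
    by (intro congruent_fmI fm_eq_all R) (simp_all add: feq_refl n)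
  show ?thesis
    unfolding ex1_fm_def frc_All_in_name[OF p c n(1)]
  proof (intro allI impI, rule frc_dense, assumption, rule dense_belowI)
    fix x s q q' assume x: "vpair x s \<in> elts a" "q \<in> C" "le q p" "le q s" and q': "q' \<in> C" "le q' q"
    have nx: "name x" using x n name_elt by blast
    have le': "le q' p" "le q' s" using x q' le_trans by blast+
    from ex[OF x(1) q'(1) this] obtain r y where r: "r \<in> C" "le r q'" and y: "name y" "fmem r y b" "r \<tturnstile> R x y"
      by blast
    have "t \<tturnstile> Imp (R x y') (Eql y' y)" if t: "t \<in> C" "le t r" "name y'" for t y'
    proof (simp add: frc_Imp[OF t(1)], intro ballI impI)
      fix u assume u: "u \<in> C" "le u t" "u \<tturnstile> R x y'"
      have ur: "le u r" using u t le_trans by blast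
      have "le u p" using ur r le' le_trans by blast
      then show "feq u y' y" using unique[OF nx t(3) y(1) u(1) _ u(3) frc_mono[OF y(3) u(1) ur]] by blast
    qed
    then have "r \<tturnstile> ?U x y" using y(3) r(1) by (simp add: frc_All_in)
    from frc_Ex_inI[of y r b "?U x", OF y(1,2) this] show "\<exists>r\<in>C. le r q' \<and> r \<tturnstile> Ex_in b (?U x)" using r by blast
  qed
qed

lemma frc_ex1D:
  assumes p: "p \<in> C" and h: "p \<tturnstile> ex1_fm a b R" and q: "q \<in> C" "le q p" "name x" "fmem q x a"
  shows "dense_below q (\<lambda>r. \<exists>y. name y \<and> fmem r y b \<and> r \<tturnstile> R x y \<and>
    (\<forall>s\<in>C. \<forall>y'. name y' \<longrightarrow> le s r \<longrightarrow> fmem s y' b \<longrightarrow> s \<tturnstile> R x y' \<longrightarrow> feq s y' y))"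
proof -
  have "q \<tturnstile> Ex_in b (\<lambda>y. Conj (R x y) (All_in b (\<lambda>y'. Imp (R x y') (Eql y' y))))"
    by (rule frc_All_inD[OF h[unfolded ex1_fm_def] p q])
  then show ?thesis unfolding frc_Ex_in
  proof (rule dense_below_weaken)
    fix r assume r: "r \<in> C"
      and "\<exists>y. name y \<and> fmem r y b \<and> r \<tturnstile> Conj (R x y) (All_in b (\<lambda>y'. Imp (R x y') (Eql y' y)))"
    then obtain y where y: "name y" "fmem r y b" "r \<tturnstile> R x y"
      and u: "r \<tturnstile> All_in b (\<lambda>y'. Imp (R x y') (Eql y' y))" by auto
    have "feq s y' y" if s: "s \<in> C" "name y'" "le s r" "fmem s y' b" "s \<tturnstile> R x y'" for s y'
    proof -
      have "s \<tturnstile> Imp (R x y') (Eql y' y)" using frc_All_inD[OF u r s(1,3,2,4)] .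
      then show ?thesis using s(1,5) le_refl by (simp add: frc_Imp)
    qed
    then show "\<exists>y. name y \<and> fmem r y b \<and> r \<tturnstile> R x y \<and>
      (\<forall>s\<in>C. \<forall>y'. name y' \<longrightarrow> le s r \<longrightarrow> fmem s y' b \<longrightarrow> s \<tturnstile> R x y' \<longrightarrow> feq s y' y)"
      using y by blast
  qed
qed

lemma frc_functionI:
  assumes p: "p \<in> C" and n: "name f" "name a" "name b"
    and 1: "\<And>z s q. vpair z s \<in> elts f \<Longrightarrow> q \<in> C \<Longrightarrow> le q p \<Longrightarrow> le q s \<Longrightarrow>
              \<exists>x y. name x \<and> name y \<and> fmem q x a \<and> fmem q y b \<and> z = pairn x y"
    and 2: "\<And>x s q. vpair x s \<in> elts a \<Longrightarrow> q \<in> C \<Longrightarrow> le q p \<Longrightarrow> le q s \<Longrightarrow>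
              \<exists>r\<in>C. le r q \<and> (\<exists>y. name y \<and> fmem r y b \<and> fmem r (pairn x y) f)"
    and 3: "\<And>x y y' q. name x \<Longrightarrow> name y \<Longrightarrow> name y' \<Longrightarrow> q \<in> C \<Longrightarrow> le q p \<Longrightarrow>
              fmem q (pairn x y) f \<Longrightarrow> fmem q (pairn x y') f \<Longrightarrow> feq q y y'"
  shows "p \<tturnstile> function_fm f a b"
proof -
  have c1: "congruent_fm (\<lambda>z. Ex_in a (\<lambda>x. Ex_in b (\<lambda>y. pair_fm z x y)))"
    by (intro congruent_fmI fm_eq_all) (simp_all add: feq_refl n)
  have "p \<tturnstile> All_in f (\<lambda>z. Ex_in a (\<lambda>x. Ex_in b (\<lambda>y. pair_fm z x y)))"
    unfolding frc_All_in_name[OF p c1 n(1)]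
  proof (intro allI impI)
    fix z s q assume *: "vpair z s \<in> elts f" "q \<in> C" "le q p" "le q s"
    from 1[OF *] obtain x y where "name x" "name y" "fmem q x a" "fmem q y b" "z = pairn x y" by blast
    then show "q \<tturnstile> Ex_in a (\<lambda>x. Ex_in b (\<lambda>y. pair_fm z x y))"
      using * by (intro frc_Ex_inI[of x] frc_Ex_inI[of y]) (simp_all add: frc_pair feq_refl)
  qed
  moreover have "p \<tturnstile> ex1_fm a b (\<lambda>x y. pair_in_fm x y f)"
  proof (rule frc_ex1I[OF p n(2,3)])
    fix x s q assume x: "vpair x s \<in> elts a" "q \<in> C" "le q p" "le q s"
    then have "name x" using n name_elt by blast
    then show "\<exists>r\<in>C. le r q \<and> (\<exists>y. name y \<and> fmem r y b \<and> r \<tturnstile> pair_in_fm x y f)"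
      using 2[OF x] n by (metis frc_pair_in)
  qed (use 3 n in \<open>auto simp: frc_pair_in intro!: fm_eq_pair_in feq_refl\<close>)
  ultimately show ?thesis unfolding function_fm_def ex1_fm_def by simp
qed

lemma frc_bijectionI:
  assumes p: "p \<in> C" and n: "name f" "name a" "name b"
    and f: "p \<tturnstile> function_fm f a b"
    and 2: "\<And>y s q. vpair y s \<in> elts b \<Longrightarrow> q \<in> C \<Longrightarrow> le q p \<Longrightarrow> le q s \<Longrightarrow>
              \<exists>r\<in>C. le r q \<and> (\<exists>x. name x \<and> fmem r x a \<and> fmem r (pairn x y) f)"
    and 3: "\<And>x y x' q. name x \<Longrightarrow> name y \<Longrightarrow> name x' \<Longrightarrow> q \<in> C \<Longrightarrow> le q p \<Longrightarrow>
              fmem q (pairn x y) f \<Longrightarrow> fmem q (pairn x' y) f \<Longrightarrow> feq q x x'"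
  shows "p \<tturnstile> bijection_fm f a b"
proof -
  have "p \<tturnstile> ex1_fm b a (\<lambda>y x. pair_in_fm x y f)"
  proof (rule frc_ex1I[OF p n(3,2)])
    fix y s q assume y: "vpair y s \<in> elts b" "q \<in> C" "le q p" "le q s"
    then have "name y" using n name_elt by blast
    then show "\<exists>r\<in>C. le r q \<and> (\<exists>x. name x \<and> fmem r x a \<and> r \<tturnstile> pair_in_fm x y f)"
      using 2[OF y] n by (metis frc_pair_in)
  qed (use 3 n in \<open>auto simp: frc_pair_in intro!: fm_eq_pair_in feq_refl\<close>)
  then show ?thesis unfolding bijection_fm_def ex1_fm_def using f by simp
qed

lemma frc_function_chk:
  assumes p: "p \<in> C" and g: "\<forall>x\<in>elts a. g x \<in> elts b" "elts f = graph_on (elts a) g"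
  shows "p \<tturnstile> function_fm (chk f) (chk a) (chk b)"
proof -
  have c: "congruent_fm (\<lambda>z. Ex_in (chk a) (\<lambda>x. Ex_in (chk b) (\<lambda>y. pair_fm z x y)))"
    "congruent_fm (\<lambda>x. Ex_in (chk b) (\<lambda>y. Conj (pair_in_fm x y (chk f))
      (All_in (chk b) (\<lambda>y'. Imp (pair_in_fm x y' (chk f)) (Eql y' y)))))"
    "\<And>x y. congruent_fm (\<lambda>y'. Imp (pair_in_fm (chk x) y' (chk f)) (Eql y' (chk y)))"
    by (intro congruent_fmI fm_eq_all; simp add: feq_refl)+
  have "p \<tturnstile> Ex_in (chk a) (\<lambda>x. Ex_in (chk b) (\<lambda>y. pair_fm (chk z) x y))" if "z \<in> elts f" for z
  proof -
    obtain x where x: "x \<in> elts a" "z = vpair x (g x)" using \<open>z \<in> elts f\<close> unfolding g(2) graph_on_def by blast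
    show ?thesis
      by (rule frc_Ex_in_chkI[OF p x(1)], rule frc_Ex_in_chkI[OF p, of "g x"]) (use x g p in auto)
  qed
  moreover have "p \<tturnstile> Ex_in (chk b) (\<lambda>y. Conj (pair_in_fm (chk x) y (chk f))
      (All_in (chk b) (\<lambda>y'. Imp (pair_in_fm (chk x) y' (chk f)) (Eql y' y))))" if "x \<in> elts a" for x
  proof (rule frc_Ex_in_chkI[OF p, of "g x"])
    have "p \<tturnstile> Imp (pair_in_fm (chk x) (chk y') (chk f)) (Eql (chk y') (chk (g x)))" for y'
      using p that g by (simp add: frc_Imp feq_chk)
    then show "p \<tturnstile> Conj (pair_in_fm (chk x) (chk (g x)) (chk f))
      (All_in (chk b) (\<lambda>y'. Imp (pair_in_fm (chk x) y' (chk f)) (Eql y' (chk (g x)))))"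
      using p that g c(3) by (simp add: frc_All_in_chk)
  qed (use that g in auto)
  ultimately show ?thesis unfolding function_fm_def using p c(1,2) by (simp add: frc_All_in_chk)
qed

lemma frc_bijection_chk:
  assumes p: "p \<in> C" and g: "bij_betw g (elts a) (elts b)" "elts f = graph_on (elts a) g"
  shows "p \<tturnstile> bijection_fm (chk f) (chk a) (chk b)"
proof -
  have g': "\<forall>x\<in>elts a. g x \<in> elts b" using g by (auto simp: bij_betw_def)
  have c: "congruent_fm (\<lambda>y. Ex_in (chk a) (\<lambda>x. Conj (pair_in_fm x y (chk f))
      (All_in (chk a) (\<lambda>x'. Imp (pair_in_fm x' y (chk f)) (Eql x' x)))))"
    "\<And>x y. congruent_fm (\<lambda>x'. Imp (pair_in_fm x' (chk y) (chk f)) (Eql x' (chk x)))"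
    by (intro congruent_fmI fm_eq_all; simp add: feq_refl)+
  have "p \<tturnstile> Ex_in (chk a) (\<lambda>x. Conj (pair_in_fm x (chk y) (chk f))
      (All_in (chk a) (\<lambda>x'. Imp (pair_in_fm x' (chk y) (chk f)) (Eql x' x))))" if y: "y \<in> elts b" for y
  proof -
    obtain x where x: "x \<in> elts a" "y = g x" using y g by (auto simp: bij_betw_def)
    show ?thesis
    proof (rule frc_Ex_in_chkI[OF p x(1)])
      have "p \<tturnstile> Imp (pair_in_fm (chk x') (chk y) (chk f)) (Eql (chk x') (chk x))" for x'
        using p x g by (auto simp: frc_Imp feq_chk bij_betw_def inj_on_def)
      then show "p \<tturnstile> Conj (pair_in_fm (chk x) (chk y) (chk f))
        (All_in (chk a) (\<lambda>x'. Imp (pair_in_fm x' (chk y) (chk f)) (Eql x' (chk x))))"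
        using p x g c(2) by (simp add: frc_All_in_chk)
    qed
  qed
  then show ?thesis unfolding bijection_fm_def
    using p c(1) frc_function_chk[OF p g' g(2)] by (simp add: frc_All_in_chk)
qed

lemma frc_equinumerous_chk:
  assumes p: "p \<in> C" and "|elts a| =o |elts b|"
  shows "p \<tturnstile> equinumerous_fm (chk a) (chk b)"
proof -
  obtain g where g: "bij_betw g (elts a) (elts b)" using assms card_of_ordIso by blast
  have e: "elts (set_of (graph_on (elts a) g)) = graph_on (elts a) g"
    by (intro elts_set_of_small small_graph_on small_elts)
  show ?thesis unfolding equinumerous_fm_def
    by (rule frc_ExistsI[of "chk (set_of (graph_on (elts a) g))"]) (simp_all add: frc_bijection_chk[OF p g e])
qed

lemma frc_subsetI:
  assumes p: "p \<in> C" and n: "name a" "name b"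
    and "\<And>x s q. vpair x s \<in> elts a \<Longrightarrow> q \<in> C \<Longrightarrow> le q p \<Longrightarrow> le q s \<Longrightarrow> fmem q x b"
  shows "p \<tturnstile> subset_fm a b"
proof -
  have c: "congruent_fm (\<lambda>z. Mem z b)" by (intro congruent_fmI fm_eq_all) (simp_all add: feq_refl n)
  show ?thesis unfolding subset_fm_def frc_All_in_name[OF p c n(1)] using assms(4) by simp
qed

lemma frc_prodD:
  assumes p: "p \<in> C" and n: "name d" and d: "p \<tturnstile> prod_fm d (chk a) (chk b)" and "x \<in> elts a" "y \<in> elts b"
  shows "fmem p (pairn (chk x) (chk y)) d"
proof -
  have "p \<tturnstile> Ex_in (chk a) (\<lambda>x'. Ex_in (chk b) (\<lambda>y'. pair_fm (pairn (chk x) (chk y)) x' y'))"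
    by (rule frc_Ex_in_chkI[OF p, of x], fact, rule frc_Ex_in_chkI[OF p, of y]) (use assms in \<open>simp_all add: frc_pair feq_refl\<close>)
  moreover have "p \<tturnstile> Iff (Mem z d) (Ex_in (chk a) (\<lambda>x. Ex_in (chk b) (\<lambda>y. pair_fm z x y)))" if "name z" for z
    using d that by (simp add: prod_fm_def)
  ultimately show ?thesis using p le_refl[OF p] frc_Iff[OF p] by (metis forces.simps(1) name_chk name_pairn)
qed

text \<open>No new pairs of ground model elements appear: a pair with components forced into the
  canonical names of a and b is densely equal to the canonical name of a ground model pair.\<close>

lemma frc_prod_chk:
  assumes p: "p \<in> C" and d: "elts d = {vpair x y | x y. x \<in> elts a \<and> y \<in> elts b}"
  shows "p \<tturnstile> prod_fm (chk d) (chk a) (chk b)"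
  unfolding prod_fm_def
proof (simp add: frc_Iff[OF p] del: forces.simps(1), intro allI impI ballI)
  fix z q assume z: "name z" and q: "q \<in> C" "le q p"
  have c: "congruent_fm (\<lambda>x. Ex_in (chk b) (\<lambda>y. pair_fm z x y))" "\<And>x. congruent_fm (\<lambda>y. pair_fm z (chk x) y)"
    by (intro congruent_fmI fm_eq_all; simp add: feq_refl z)+
  have "q \<tturnstile> Ex_in (chk a) (\<lambda>x. Ex_in (chk b) (\<lambda>y. pair_fm z x y)) \<longleftrightarrow>
     dense_below q (\<lambda>r. \<exists>x\<in>elts a. dense_below r (\<lambda>r. \<exists>y\<in>elts b. feq r z (chk (vpair x y))))"
    unfolding frc_Ex_in_chk[OF q(1) c(1)]
    by (intro dense_below_cong bex_cong refl)
       (simp only: frc_Ex_in_chk[OF _ c(2)], intro dense_below_cong bex_cong refl, simp add: frc_pair z chk_vpair)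
  also have "\<dots> \<longleftrightarrow> dense_below q (\<lambda>r. \<exists>w\<in>elts d. feq r z (chk w))" (is "?l \<longleftrightarrow> ?r")
  proof
    assume ?l
    then show ?r
    proof (rule_tac dense_below_dense, elim dense_below_weaken)
      fix r assume "\<exists>x\<in>elts a. dense_below r (\<lambda>r. \<exists>y\<in>elts b. feq r z (chk (vpair x y)))"
      then obtain x where x: "x \<in> elts a" "dense_below r (\<lambda>r. \<exists>y\<in>elts b. feq r z (chk (vpair x y)))" by blast
      show "dense_below r (\<lambda>r. \<exists>w\<in>elts d. feq r z (chk w))"
        by (rule dense_below_weaken[OF x(2)]) (use x(1) d in blast)
    qed
  next
    assume ?r
    then show ?l
    proof (rule dense_below_weaken)
      fix r assume "\<exists>w\<in>elts d. feq r z (chk w)"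
      then obtain x y where xy: "x \<in> elts a" "y \<in> elts b" "feq r z (chk (vpair x y))" by (auto simp: d)
      have "dense_below r (\<lambda>r. \<exists>y\<in>elts b. feq r z (chk (vpair x y)))"
        by (rule dense_below_all) (use xy feq_mono in blast)
      then show "\<exists>x\<in>elts a. dense_below r (\<lambda>r. \<exists>y\<in>elts b. feq r z (chk (vpair x y)))"
        using xy(1) by blast
    qed
  qed
  finally show "q \<tturnstile> Mem z (chk d) \<longleftrightarrow> q \<tturnstile> Ex_in (chk a) (\<lambda>x. Ex_in (chk b) (\<lambda>y. pair_fm z x y))"
    by (simp add: fmem_chk[OF q(1)])
qed

subsection \<open>Names of functions\<close>

lemma frc_function_pair:
  assumes p: "p \<in> C" and n: "name f" "name a" "name b" "name x" "name y"
    and f: "p \<tturnstile> function_fm f a b" and q: "q \<in> C" "le q p" "fmem q (pairn x y) f"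
  shows "fmem q x a" "fmem q y b"
proof -
  have "q \<tturnstile> Ex_in a (\<lambda>x'. Ex_in b (\<lambda>y'. pair_fm (pairn x y) x' y'))"
    by (rule frc_All_inD[OF _ p q(1,2) _ q(3)]) (use f n in \<open>simp_all add: function_fm_def\<close>)
  then have "dense_below q (\<lambda>r. \<exists>x'. name x' \<and> fmem r x' a \<and>
      dense_below r (\<lambda>r. \<exists>y'. name y' \<and> fmem r y' b \<and> r \<tturnstile> pair_fm (pairn x y) x' y'))"
    unfolding frc_Ex_in .
  then have "dense_below q (\<lambda>r. fmem r x a \<and> fmem r y b)"
  proof (rule_tac dense_below_dense, elim dense_below_weaken)
    fix r assume "\<exists>x'. name x' \<and> fmem r x' a \<and>
      dense_below r (\<lambda>r. \<exists>y'. name y' \<and> fmem r y' b \<and> r \<tturnstile> pair_fm (pairn x y) x' y')"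
    then obtain x' where x': "name x'" "fmem r x' a"
      "dense_below r (\<lambda>r. \<exists>y'. name y' \<and> fmem r y' b \<and> r \<tturnstile> pair_fm (pairn x y) x' y')" by blast
    show "dense_below r (\<lambda>r. fmem r x a \<and> fmem r y b)"
    proof (rule dense_below_weaken[OF x'(3)])
      fix s assume s: "s \<in> C" "le s r" "\<exists>y'. name y' \<and> fmem s y' b \<and> s \<tturnstile> pair_fm (pairn x y) x' y'"
      then obtain y' where y': "name y'" "fmem s y' b" "s \<tturnstile> pair_fm (pairn x y) x' y'" by blast
      have e: "feq s (pairn x y) (pairn x' y')" using y' s x' n by (simp add: frc_pair)
      note e = pairn_inject[OF n(4,5) x'(1) y'(1) s(1) e]
      show "fmem s x a \<and> fmem s y b"
        using fmem_cong_left[OF x'(1) n(4) n(2) feq_sym[OF e(1)] fmem_mono[OF x'(2) s(2)]]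
          fmem_cong_left[OF y'(1) n(5) n(3) feq_sym[OF e(2)] y'(2)] by blast
    qed
  qed
  then have "dense_below q (\<lambda>r. fmem r x a)" "dense_below q (\<lambda>r. fmem r y b)"
    by (simp_all add: dense_below_def) blast+
  then show "fmem q x a" "fmem q y b" by (auto intro: fmem_dense)
qed

text \<open>The uniqueness clause of \<open>function_fm\<close> speaks of members of b only.
  Membership of y' in b follows from the pair being in f, so uniqueness is available here for every
  name y'.\<close>

lemma frc_function_value:
  assumes p: "p \<in> C" and n: "name f" "name a" "name b" "name x"
    and f: "p \<tturnstile> function_fm f a b" and q: "q \<in> C" "le q p" "fmem q x a"
  shows "dense_below q (\<lambda>r. \<exists>y. name y \<and> fmem r y b \<and> fmem r (pairn x y) f \<and>
    (\<forall>s\<in>C. \<forall>y'. name y' \<longrightarrow> le s r \<longrightarrow> fmem s (pairn x y') f \<longrightarrow> feq s y' y))"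
proof -
  have "p \<tturnstile> ex1_fm a b (\<lambda>x y. pair_in_fm x y f)" using f by (simp add: function_fm_def ex1_fm_def)
  from frc_ex1D[OF p this q(1,2) n(4) q(3)] show ?thesis
  proof (rule dense_below_weaken)
    fix r assume r: "r \<in> C" "le r q"
    assume "\<exists>y. name y \<and> fmem r y b \<and> r \<tturnstile> pair_in_fm x y f \<and>
      (\<forall>s\<in>C. \<forall>y'. name y' \<longrightarrow> le s r \<longrightarrow> fmem s y' b \<longrightarrow> s \<tturnstile> pair_in_fm x y' f \<longrightarrow> feq s y' y)"
    then obtain y where y: "name y" "fmem r y b" "r \<tturnstile> pair_in_fm x y f"
      and u: "\<forall>s\<in>C. \<forall>y'. name y' \<longrightarrow> le s r \<longrightarrow> fmem s y' b \<longrightarrow> s \<tturnstile> pair_in_fm x y' f \<longrightarrow> feq s y' y"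
      by blast
    then have yf: "fmem r (pairn x y) f" using r n by (simp add: frc_pair_in)
    have "feq s y' y" if s: "s \<in> C" "name y'" "le s r" "fmem s (pairn x y') f" for s y'
    proof -
      have "le s p" using s r q le_trans by blast
      then have "fmem s y' b" using frc_function_pair(2)[OF p n s(2) f s(1)] s by blast
      then show ?thesis using u s n by (simp add: frc_pair_in)
    qed
    then show "\<exists>y. name y \<and> fmem r y b \<and> fmem r (pairn x y) f \<and>
      (\<forall>s\<in>C. \<forall>y'. name y' \<longrightarrow> le s r \<longrightarrow> fmem s (pairn x y') f \<longrightarrow> feq s y' y)"
      using y yf by (intro exI[of _ y] conjI ballI allI impI)
  qed
qed

lemma frc_function_unique:
  assumes p: "p \<in> C" and n: "name f" "name a" "name b" "name x" "name y" "name y'"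
    and f: "p \<tturnstile> function_fm f a b" and q: "q \<in> C" "le q p" "fmem q (pairn x y) f" "fmem q (pairn x y') f"
  shows "feq q y y'"
proof (rule feq_dense)
  have "fmem q x a" by (rule frc_function_pair(1)[OF p n(1-5) f q(1-3)])
  from frc_function_value[OF p n(1-4) f q(1,2) this]
  show "dense_below q (\<lambda>r. feq r y y')"
  proof (rule dense_below_weaken)
    fix r assume r: "r \<in> C" "le r q"
    assume "\<exists>z. name z \<and> fmem r z b \<and> fmem r (pairn x z) f \<and>
      (\<forall>s\<in>C. \<forall>y'. name y' \<longrightarrow> le s r \<longrightarrow> fmem s (pairn x y') f \<longrightarrow> feq s y' z)"
    then obtain z where z: "name z" "\<forall>s\<in>C. \<forall>y'. name y' \<longrightarrow> le s r \<longrightarrow> fmem s (pairn x y') f \<longrightarrow> feq s y' z" by blast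
    have "feq r y z" "feq r y' z"
      using z(2) r(1) n(5,6) le_refl[OF r(1)] fmem_mono[OF q(3) r(2)] fmem_mono[OF q(4) r(2)] by simp_all
    then show "feq r y y'" using feq_trans[OF n(5) z(1) n(6) _ feq_sym] by blast
  qed
qed

lemma frc_bijection_value:
  assumes p: "p \<in> C" and n: "name f" "name a" "name b" "name y"
    and f: "p \<tturnstile> bijection_fm f a b" and q: "q \<in> C" "le q p" "fmem q y b"
  shows "dense_below q (\<lambda>r. \<exists>x. name x \<and> fmem r x a \<and> fmem r (pairn x y) f)"
proof -
  have "p \<tturnstile> ex1_fm b a (\<lambda>y x. pair_in_fm x y f)" using f by (simp add: bijection_fm_def ex1_fm_def)
  from frc_ex1D[OF p this q(1,2) n(4) q(3)] show ?thesis
  proof (rule dense_below_weaken)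
    fix r assume r: "r \<in> C" and "\<exists>x. name x \<and> fmem r x a \<and> r \<tturnstile> pair_in_fm x y f \<and>
      (\<forall>s\<in>C. \<forall>x'. name x' \<longrightarrow> le s r \<longrightarrow> fmem s x' a \<longrightarrow> s \<tturnstile> pair_in_fm x' y f \<longrightarrow> feq s x' x)"
    then obtain x where x: "name x" "fmem r x a" "r \<tturnstile> pair_in_fm x y f" by (elim exE conjE)
    then have "fmem r (pairn x y) f" using r n by (simp add: frc_pair_in)
    then show "\<exists>x. name x \<and> fmem r x a \<and> fmem r (pairn x y) f" using x by blast
  qed
qed

lemma frc_image_at_most_one:
  assumes p: "p \<in> C" and n: "name f" "name h" "name k"
  shows "p \<tturnstile> image_at_most_one_fm f h k \<longleftrightarrow>
    (\<forall>q x y x' y' c c'. q \<in> C \<longrightarrow> le q p \<longrightarrow> name x \<longrightarrow> name y \<longrightarrow> name x' \<longrightarrow> name y' \<longrightarrow> name c \<longrightarrow> name c' \<longrightarrow>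
       fmem q x h \<longrightarrow> fmem q y k \<longrightarrow> fmem q x' h \<longrightarrow> fmem q y' k \<longrightarrow>
       fmem q (pairn (pairn x y) c) f \<longrightarrow> fmem q (pairn (pairn x' y') c') f \<longrightarrow> feq q c c')" (is "?l \<longleftrightarrow> ?r")
proof
  assume l: ?l
  show ?r
  proof (intro allI impI)
    fix q x y x' y' c c'
    assume q: "q \<in> C" "le q p" and nn: "name x" "name y" "name x'" "name y'" "name c" "name c'"
      and m: "fmem q x h" "fmem q y k" "fmem q x' h" "fmem q y' k"
      and e: "fmem q (pairn (pairn x y) c) f" "fmem q (pairn (pairn x' y') c') f"
    note l1 = frc_All_inD[OF l[unfolded image_at_most_one_fm_def] p q nn(1) m(1)]
    note l2 = frc_All_inD[OF l1 q(1) q(1) le_refl[OF q(1)] nn(2) m(2)]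
    note l3 = frc_All_inD[OF l2 q(1) q(1) le_refl[OF q(1)] nn(3) m(3)]
    note l4 = frc_All_inD[OF l3 q(1) q(1) le_refl[OF q(1)] nn(4) m(4)]
    have "q \<tturnstile> Imp (Conj (Conj (pair_fm (pairn x y) x y) (pair_in_fm (pairn x y) c f))
                   (Conj (pair_fm (pairn x' y') x' y') (pair_in_fm (pairn x' y') c' f)))
             (Eql c c')" using l4 nn by simp
    then show "feq q c c'"
      using q le_refl nn n e by (simp add: frc_Imp frc_pair frc_pair_in feq_refl)
  qed
next
  assume r: ?r
  show ?l unfolding image_at_most_one_fm_def
  proof (rule frc_All_inI[OF p], rule frc_All_inI, assumption, rule frc_All_inI, assumption,
      rule frc_All_inI, assumption, simp only: forces.simps(5), intro allI impI)
    fix x q0 y q1 x' q2 y' q3 P P' c c'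
    assume x: "name x" "q0 \<in> C" "le q0 p" "fmem q0 x h" and y: "name y" "q1 \<in> C" "le q1 q0" "fmem q1 y k"
      and x': "name x'" "q2 \<in> C" "le q2 q1" "fmem q2 x' h" and y': "name y'" "q3 \<in> C" "le q3 q2" "fmem q3 y' k"
      and nn: "name P" "name P'" "name c" "name c'"
    show "q3 \<tturnstile> Imp (Conj (Conj (pair_fm P x y) (pair_in_fm P c f))
               (Conj (pair_fm P' x' y') (pair_in_fm P' c' f))) (Eql c c')"
    proof (simp only: frc_Imp[OF y'(2)], intro ballI impI)
      fix q assume q: "q \<in> C" "le q q3"
        and a: "q \<tturnstile> Conj (Conj (pair_fm P x y) (pair_in_fm P c f))
               (Conj (pair_fm P' x' y') (pair_in_fm P' c' f))"
      have les: "le q q2" "le q q1" "le q q0" "le q p" using q y' x' y x le_trans by blast+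
      have eqs: "feq q P (pairn x y)" "fmem q (pairn P c) f" "feq q P' (pairn x' y')" "fmem q (pairn P' c') f"
        using a q x y x' y' nn n by (simp_all add: frc_pair frc_pair_in)
      have "fmem q (pairn (pairn x y) c) f"
        by (rule fmem_cong_left[OF _ _ n(1) feq_pairn[OF _ _ _ _ eqs(1)] eqs(2)]) (use nn x y in \<open>auto intro: feq_refl\<close>)
      moreover have "fmem q (pairn (pairn x' y') c') f"
        by (rule fmem_cong_left[OF _ _ n(1) feq_pairn[OF _ _ _ _ eqs(3)] eqs(4)]) (use nn x' y' in \<open>auto intro: feq_refl\<close>)
      moreover have "fmem q x h" "fmem q y k" "fmem q x' h" "fmem q y' k"
        using fmem_mono x y x' y' les q(2) by blast+
      ultimately have "feq q c c'"
        using r[rule_format, OF q(1) les(4) x(1) y(1) x'(1) y'(1) nn(3,4)] by blast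
      then show "q \<tturnstile> Eql c c'" by simp
    qed
  qed
qed

text \<open>Valid for every forcing notion: the ground model bijection showing that d is not a
  cardinal survives in the extension.\<close>

lemma frc_not_intermediate_cardinal:
  assumes p: "p \<in> C" and s: "holds (succ_cardinal_fm l k)"
  shows "p \<tturnstile> All_in (chk l) (\<lambda>d. Neg (Conj (cardinal_fm d) (Mem (chk k) d)))"
proof (rule frc_All_in_chkI[OF p])
  show "congruent_fm (\<lambda>d. Neg (Conj (cardinal_fm d) (Mem (chk k) d)))"
    by (intro congruent_fmI fm_eq_all) (simp_all add: feq_refl)
  fix d assume d: "d \<in> elts l"
  show "p \<tturnstile> Neg (Conj (cardinal_fm (chk d)) (Mem (chk k) (chk d)))"
  proof (simp only: frc_Neg, intro ballI impI notI)
    fix q assume q: "q \<in> C" "le q p" "q \<tturnstile> Conj (cardinal_fm (chk d)) (Mem (chk k) (chk d))"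
    then have kd: "k \<in> elts d" and c: "q \<tturnstile> cardinal_fm (chk d)" by (simp_all add: fmem_chk_chk)
    have "ordinal d" using s d ordinal_elt unfolding holds_succ_cardinal holds_cardinal by blast
    then obtain a where a: "a \<in> elts d" "|elts a| =o |elts d|"
      using s d kd unfolding holds_succ_cardinal holds_cardinal by blast
    have "q \<tturnstile> Neg (equinumerous_fm (chk a) (chk d))"
      by (rule frc_All_inD[OF _ q(1) q(1) le_refl[OF q(1)] name_chk fmem_chkI[OF a(1) q(1)]])
        (use c in \<open>simp add: cardinal_fm_def\<close>)
    moreover have "q \<tturnstile> equinumerous_fm (chk a) (chk d)" by (rule frc_equinumerous_chk[OF q(1) a(2)])
    ultimately show False using q(1) le_refl by auto
  qed
qed

end

section \<open>Centered forcing\<close>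

text \<open>Prikry forcing seen through its stems alone. Stems are coded by elements of \<mu>, so
  that there being at most \<mu> of them is the plain statement \<open>stem_in\<close>, and
  pigeonhole arguments on stems can count in \<mu>.\<close>

locale centered_forcing = forcing_poset C le one
  for C :: "'v::zfc set" and le :: "'v \<Rightarrow> 'v \<Rightarrow> bool" and one :: 'v +
  fixes \<mu> :: 'v and stem :: "'v \<Rightarrow> 'v"
  assumes ordinal_mu: "ordinal \<mu>" and infinite_mu: "infinite (elts \<mu>)"
    and stem_in: "p \<in> C \<Longrightarrow> stem p \<in> elts \<mu>"
    and centered: "\<lbrakk>A \<subseteq> C; A \<noteq> {}; |A| <o |elts \<mu>|; \<forall>p\<in>A. stem p = s\<rbrakk>
      \<Longrightarrow> \<exists>r\<in>C. stem r = s \<and> (\<forall>p\<in>A. le r p)"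
begin

abbreviation big :: "'v set \<Rightarrow> bool" where
  "big J \<equiv> \<not> |J| \<le>o |elts \<mu>|"

lemma big_mono: "big J \<Longrightarrow> J \<subseteq> J' \<Longrightarrow> big J'"
  using card_of_mono1 ordLeq_transitive by blast

lemma big_nonempty: "big J \<Longrightarrow> J \<noteq> {}"
  using card_of_empty by blast

lemma pigeonhole_mu:
  assumes "big J" "\<And>j. j \<in> J \<Longrightarrow> t j \<in> elts \<mu>"
  shows "\<exists>s\<in>elts \<mu>. big {j \<in> J. t j = s}"
  by (rule pigeonhole_big[OF infinite_mu assms(1)]) (use assms(2) in \<open>auto simp: card_of_mono1\<close>)

lemma centered_finite:
  assumes "A \<subseteq> C" "A \<noteq> {}" "finite A" "\<forall>p\<in>A. stem p = s"
  shows "\<exists>r\<in>C. stem r = s \<and> (\<forall>p\<in>A. le r p)"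
proof (rule centered[OF assms(1,2) _ assms(4)])
  have "\<not> |elts \<mu>| \<le>o |A|" using assms(3) infinite_mu card_of_ordLeq_finite by blast
  then show "|A| <o |elts \<mu>|" using not_ordLeq_iff_ordLess card_of_Well_order by blast
qed

lemma mu_times_mu: "|elts \<mu> \<times> elts \<mu>| \<le>o |elts \<mu>|"
  using card_of_Times_same_infinite[OF infinite_mu] ordIso_iff_ordLeq by blast

lemma succ_times:
  assumes "|elts \<mu>| \<le>o |elts l|"
  shows "|elts l \<times> elts \<mu>| \<le>o |elts l|"
proof -
  have i: "infinite (elts l)" using assms infinite_mu card_of_ordLeq_infinite by blast
  show ?thesis
    by (rule card_of_Times_ordLeq_infinite_Field) (use i assms in \<open>auto simp: Field_card_of card_of_card_order_on card_of_mono1\<close>)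
qed

section \<open>Preservation of the successors of \<mu>\<close>

lemma frc_cardinal_chk:
  assumes p: "p \<in> C" and s: "holds (succ_cardinal_fm k l)" and l: "|elts \<mu>| \<le>o |elts l|"
  shows "p \<tturnstile> cardinal_fm (chk k)"
proof -
  have ok: "ordinal k" using s by (simp add: holds_succ_cardinal holds_cardinal)
  have "p \<tturnstile> All_in (chk k) (\<lambda>a. Neg (equinumerous_fm a (chk k)))"
  proof (rule frc_All_in_chkI[OF p])
    show "congruent_fm (\<lambda>a. Neg (equinumerous_fm a (chk k)))"
      by (intro congruent_fmI fm_eq_all) (simp_all add: feq_refl)
    fix a assume a: "a \<in> elts k"
    show "p \<tturnstile> Neg (equinumerous_fm (chk a) (chk k))"
    proof (simp only: frc_Neg, intro ballI impI notI)
      fix q assume q: "q \<in> C" "le q p" "q \<tturnstile> equinumerous_fm (chk a) (chk k)"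
      obtain r F where r: "r \<in> C" "name F" "r \<tturnstile> bijection_fm F (chk a) (chk k)"
        using dense_belowE[OF q(3)[unfolded equinumerous_fm_def frc_Exists] q(1) le_refl[OF q(1)]] by metis
      have ff: "r \<tturnstile> function_fm F (chk a) (chk k)" using r by (simp add: bijection_fm_def)
      have "\<exists>t x. t \<in> C \<and> le t r \<and> x \<in> elts a \<and> fmem t (pairn (chk x) (chk y)) F" if y: "y \<in> elts k" for y
      proof -
        obtain t x where t: "t \<in> C" "le t r" "name x" "fmem t x (chk a)" "fmem t (pairn x (chk y)) F"
          using dense_belowE[OF frc_bijection_value[OF r(1,2) name_chk name_chk name_chk r(3) r(1) le_refl[OF r(1)]
              fmem_chkI[OF y r(1)]] r(1) le_refl[OF r(1)]] by metis
        obtain u x' where u: "u \<in> C" "le u t" "x' \<in> elts a" "feq u x (chk x')"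
          using dense_belowE[OF t(4)[unfolded fmem_chk[OF t(1)]] t(1) le_refl[OF t(1)]] by metis
        have "fmem u (pairn (chk x') (chk y)) F"
          by (rule fmem_cong_left[OF _ _ r(2) feq_pairn[OF _ _ _ _ u(4)] fmem_mono[OF t(5) u(2)]])
            (use t in \<open>auto intro: feq_refl\<close>)
        then show ?thesis using u t le_trans by blast
      qed
      then obtain T X where TX: "\<And>y. y \<in> elts k \<Longrightarrow> T y \<in> C \<and> le (T y) r \<and> X y \<in> elts a \<and>
          fmem (T y) (pairn (chk (X y)) (chk y)) F" by metis
      \<comment> \<open>The decided preimage and the stem together determine y: conditions with
        equal stems have a common extension, and there F would send one argument to both y and y'.
        Thus k injects into the product of a with \<mu>, which has size at most l.\<close>
      have "inj_on (\<lambda>y. (X y, stem (T y))) (elts k)"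
      proof (rule inj_onI)
        fix y y' assume y: "y \<in> elts k" "y' \<in> elts k" "(X y, stem (T y)) = (X y', stem (T y'))"
        then obtain t where t: "t \<in> C" "le t (T y)" "le t (T y')"
          using centered_finite[of "{T y, T y'}" "stem (T y)"] TX by auto
        have "feq t (chk y) (chk y')"
        proof (rule frc_function_unique[OF r(1,2) name_chk name_chk name_chk name_chk name_chk ff t(1)])
          show "le t r" using t y TX le_trans by blast
          show "fmem t (pairn (chk (X y)) (chk y)) F" using TX[OF y(1)] t fmem_mono by blast
          show "fmem t (pairn (chk (X y)) (chk y')) F" using TX[OF y(2)] y t fmem_mono by auto
        qed
        then show "y = y'" using feq_chk[OF t(1)] by blast
      qed
      moreover have "(\<lambda>y. (X y, stem (T y))) ` elts k \<subseteq> elts a \<times> elts \<mu>" using TX stem_in by auto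
      ultimately have "|elts k| \<le>o |elts a \<times> elts \<mu>|" using card_of_ordLeq by blast
      moreover have "|elts a \<times> elts \<mu>| \<le>o |elts l \<times> elts \<mu>|"
        using succ_cardinal_elt[OF s a] by (rule card_of_Times_mono1)
      ultimately have "|elts k| \<le>o |elts l|" using succ_times[OF l] by (meson ordLeq_transitive)
      then show False using succ_cardinal_less[OF s] not_ordLess_ordLeq by blast
    qed
  qed
  then show ?thesis unfolding cardinal_fm_def using frc_ordinal_chk[OF p ok] by simp
qed

lemma frc_succ_cardinal_chk:
  assumes p: "p \<in> C" and s: "holds (succ_cardinal_fm k l)" and l: "|elts \<mu>| \<le>o |elts l|"
  shows "p \<tturnstile> succ_cardinal_fm (chk k) (chk l)"
  unfolding succ_cardinal_fm_def
  using frc_cardinal_chk[OF assms] frc_not_intermediate_cardinal[OF p s] s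
  by (simp add: fmem_chk_chk p holds_succ_cardinal)

lemma frc_with_successors:
  assumes p: "p \<in> C" and s: "holds (succ_cardinal_fm m1 \<mu>)" "holds (succ_cardinal_fm m2 m1)"
    and "p \<tturnstile> \<Phi> (chk m1) (chk m2)"
  shows "p \<tturnstile> with_successors (chk \<mu>) \<Phi>"
  unfolding with_successors_def
  by (rule frc_ExistsI[of "chk m1"], simp, rule frc_ExistsI[of "chk m2"], simp)
    (use assms succ_cardinal_less[OF s(1)] in
      \<open>simp add: frc_succ_cardinal_chk card_of_mono1 ordLess_imp_ordLeq\<close>)

text \<open>The chain condition, in the form that some condition of a long sequence forces that the generic
  filter contains many members of the sequence.\<close>

lemma big_compatible:
  assumes J: "big J" and P: "\<And>j. j \<in> J \<Longrightarrow> P j \<in> C"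
  shows "\<exists>j0\<in>J. \<forall>q\<in>C. le q (P j0) \<longrightarrow> big {j \<in> J. \<exists>r\<in>C. le r q \<and> le r (P j)}"
proof (rule ccontr)
  assume "\<not> ?thesis"
  then have "\<forall>j\<in>J. \<exists>q. q \<in> C \<and> le q (P j) \<and> \<not> big {i \<in> J. \<exists>r\<in>C. le r q \<and> le r (P i)}" by blast
  from bchoice[OF this] obtain Q where
    Q: "\<And>j. j \<in> J \<Longrightarrow> Q j \<in> C \<and> le (Q j) (P j) \<and> \<not> big {i \<in> J. \<exists>r\<in>C. le r (Q j) \<and> le r (P i)}" by blast
  \<comment> \<open>All \<open>Q i\<close> with this stem are compatible with one another and lie
    below \<open>P i\<close>. So any one of them meets more than \<mu> many of the conditions
    \<open>P i\<close>, against its choice.\<close>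
  obtain s where s: "big {j \<in> J. stem (Q j) = s}" using pigeonhole_mu[OF J, of "\<lambda>j. stem (Q j)"] Q stem_in by blast
  then obtain j where j: "j \<in> J" "stem (Q j) = s" using big_nonempty by blast
  have "{i \<in> J. stem (Q i) = s} \<subseteq> {i \<in> J. \<exists>r\<in>C. le r (Q j) \<and> le r (P i)}"
  proof clarify
    fix i assume i: "i \<in> J" "s = stem (Q i)"
    then obtain r where "r \<in> C" "le r (Q i)" "le r (Q j)"
      using centered_finite[of "{Q i, Q j}" s] Q j by auto
    then show "\<exists>r\<in>C. le r (Q j) \<and> le r (P i)" using Q i le_trans by blast
  qed
  then show False using Q[OF j(1)] big_mono[OF s] by blast
qed

text \<open>The large side of the rectangle cannot simply consist of all \<open>\<beta>\<close> whose condition is generic,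
  since one then needs a name for an enumeration of it. Instead \<open>\<phi>\<close> assigns to every \<open>k < \<mu>\<^sup>+\<close> its own
  predense block of conditions, indexed by stems, and \<open>sel\<close> picks the first generic member of the block.\<close>

lemma frc_generic_large_set:
  assumes s: "holds (succ_cardinal_fm m1 \<mu>)" and H: "H \<subseteq> elts m1" "|H| =o |elts m1|"
    and R: "\<And>y. y \<in> H \<Longrightarrow> R y \<in> C"
  shows "\<exists>y0\<in>H. \<exists>h. name h \<and> R y0 \<tturnstile> subset_of_size_fm h (chk m1) (chk m1) \<and>
    (\<forall>u y. fmem u y h \<longrightarrow> dense_below u (\<lambda>r. \<exists>\<beta>\<in>H. le r (R \<beta>) \<and> feq r y (chk \<beta>)))"
proof -
  have mu1: "|elts \<mu>| \<le>o |elts m1|" using succ_cardinal_less[OF s] ordLess_imp_ordLeq by blast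
  have inf1: "infinite (elts m1)" using mu1 infinite_mu card_of_ordLeq_infinite by blast
  have bigH: "big H"
    using H(2) succ_cardinal_less[OF s] by (meson not_ordLess_ordLeq ordIso_iff_ordLeq ordLeq_transitive)
  obtain y0 where y0: "y0 \<in> H" "\<And>q. q \<in> C \<Longrightarrow> le q (R y0) \<Longrightarrow> big {y \<in> H. \<exists>r\<in>C. le r q \<and> le r (R y)}"
    using big_compatible[OF bigH, of R] R by blast
  define q where "q = R y0"
  have q: "q \<in> C" using R y0 unfolding q_def by blast
  define J where "J t = {y \<in> H. \<exists>r\<in>C. stem r = t \<and> le r (R y)}" for t
  \<comment> \<open>Only these stems can index a block: \<phi> has to choose injectively from
    \<open>J t\<close> for every index k below the successor of \<mu>, so \<open>J t\<close> must be
    of full size.\<close>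
  define T where "T = {t \<in> elts \<mu>. big (J t)}"
  have "|elts m1 \<times> T| \<le>o |elts m1|"
  proof -
    have "elts m1 \<times> T \<subseteq> elts m1 \<times> elts \<mu>" unfolding T_def by auto
    then show ?thesis using card_of_mono1 succ_times[OF mu1] ordLeq_transitive by blast
  qed
  moreover have "|elts m1| \<le>o |J t|" if "t \<in> T" for t
  proof -
    have "J t \<subseteq> elts m1" "big (J t)" using that H(1) unfolding T_def J_def by auto
    from succ_cardinal_big_subset[OF s infinite_mu this] show ?thesis using ordIso_iff_ordLeq by blast
  qed
  ultimately obtain \<phi> where \<phi>: "inj_on \<phi> (elts m1 \<times> T)" "\<And>k t. k \<in> elts m1 \<Longrightarrow> t \<in> T \<Longrightarrow> \<phi> (k, t) \<in> J t"
    using injective_choice[of "elts m1 \<times> T" "elts m1" "\<lambda>(k, t). J t"] inf1 by auto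
  have \<phi>H: "\<phi> (k, t) \<in> H" if "k \<in> elts m1" "t \<in> T" for k t using \<phi>(2)[OF that] by (simp add: J_def)

  \<comment> \<open>Selecting t requires r to be incompatible with the earlier members of the block,
    not merely to lie outside them. Therefore the selection persists to stronger conditions and is
    unique for each k.\<close>
  define sel where "sel k t r \<longleftrightarrow> r \<in> C \<and> k \<in> elts m1 \<and> t \<in> T \<and> le r (R (\<phi> (k, t))) \<and>
    (\<forall>t'\<in>T. t' \<in> elts t \<longrightarrow> \<not> (\<exists>u\<in>C. le u r \<and> le u (R (\<phi> (k, t')))))" for k t r
  have sel_mono: "sel k t r'" if "sel k t r" "r' \<in> C" "le r' r" for k t r r'
    using that le_trans unfolding sel_def by meson
  have sel_unique: "t = t'" if "sel k t r" "sel k t' r" for k t t' r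
  proof -
    have "t \<in> elts \<mu>" "t' \<in> elts \<mu>" using that unfolding sel_def T_def by auto
    then have "t \<in> elts t' \<or> t = t' \<or> t' \<in> elts t" using ordinal_elts_linear[OF ordinal_mu] by blast
    moreover have "r \<in> C" "le r r" using that(1) le_refl unfolding sel_def by auto
    ultimately show ?thesis using that unfolding sel_def by blast
  qed
  have sel_dense: "\<exists>r'\<in>C. le r' r \<and> (\<exists>t. sel k t r')" if k: "k \<in> elts m1" and r: "r \<in> C" "le r q" for k r
  proof -
    have bigK: "big {y \<in> H. \<exists>u\<in>C. le u r \<and> le u (R y)}" (is "big ?K") using y0(2) r unfolding q_def by blast
    have "\<forall>y\<in>?K. \<exists>u. u \<in> C \<and> le u r \<and> le u (R y)" by blast
    from bchoice[OF this] obtain u where u: "\<And>y. y \<in> ?K \<Longrightarrow> u y \<in> C \<and> le (u y) r \<and> le (u y) (R y)" by blast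
    have "stem (u y) \<in> elts \<mu>" if "y \<in> ?K" for y using u[OF that] stem_in by blast
    \<comment> \<open>A stem t shared by more than \<mu> of the conditions \<open>u y\<close>
      belongs to T. It also makes r compatible with the member of block k at t: some v below that
      member and some \<open>u y\<close> below r both have stem t.\<close>
    from pigeonhole_mu[OF bigK, of "\<lambda>y. stem (u y)", OF this] obtain t where t: "t \<in> elts \<mu>" "big {y \<in> ?K. stem (u y) = t}" by blast
    have "{y \<in> ?K. stem (u y) = t} \<subseteq> J t" unfolding J_def using u by blast
    then have tT: "t \<in> T" unfolding T_def using t big_mono by blast
    then obtain v where v: "v \<in> C" "stem v = t" "le v (R (\<phi> (k, t)))" using \<phi>(2)[OF k] unfolding J_def by blast
    obtain y where y: "y \<in> ?K" "stem (u y) = t" using big_nonempty[OF t(2)] by blast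
    obtain w where "w \<in> C" "le w v" "le w (u y)"
      using centered_finite[of "{v, u y}" t] v y u by auto
    then have "\<exists>w\<in>C. le w r \<and> le w (R (\<phi> (k, t)))" using v u[OF y(1)] le_trans by blast
    then have "t \<in> {t \<in> T. \<exists>w\<in>C. le w r \<and> le w (R (\<phi> (k, t)))}" using tT by blast
    from elts_minimal[OF this] obtain t0 where "t0 \<in> {t \<in> T. \<exists>w\<in>C. le w r \<and> le w (R (\<phi> (k, t)))}"
      "\<forall>t'\<in>elts t0. t' \<notin> {t \<in> T. \<exists>w\<in>C. le w r \<and> le w (R (\<phi> (k, t)))}" by blast
    then have t0: "t0 \<in> T" "\<exists>w\<in>C. le w r \<and> le w (R (\<phi> (k, t0)))"
      and min: "\<And>t'. t' \<in> elts t0 \<Longrightarrow> t' \<in> T \<Longrightarrow> \<not> (\<exists>w\<in>C. le w r \<and> le w (R (\<phi> (k, t'))))" by simp_all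
    then obtain w where w: "w \<in> C" "le w r" "le w (R (\<phi> (k, t0)))" by blast
    have "sel k t0 w" unfolding sel_def using w k t0(1) min le_trans[OF _ w(2)] by blast
    then show ?thesis using w by blast
  qed

  \<comment> \<open>This name receives the entry computed by N from the index k and the chosen
    element, at every condition that selects it. One construction thus serves both the large side
    \<open>h1\<close> and its enumeration F.\<close>
  define B where "B N = set_of {vpair (N (\<phi> (k, t)) k) r | k t r. sel k t r}" for N :: "'v \<Rightarrow> 'v \<Rightarrow> 'v"
  have elts_B: "elts (B (\<lambda>y k. chk (n y k))) = {vpair (chk (n (\<phi> (k, t)) k)) r | k t r. sel k t r}" for n
  proof -
    have "{vpair (chk (n (\<phi> (k, t)) k)) r | k t r. sel k t r} \<subseteq>
      {vpair x r | x r. x \<in> (\<Union>y\<in>elts m1. (\<lambda>k. chk (n y k)) ` elts m1) \<and> r \<in> C}"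
    proof clarify
      fix k t r assume sel: "sel k t r"
      then have "k \<in> elts m1" "\<phi> (k, t) \<in> elts m1" "r \<in> C" using \<phi>H H(1) unfolding sel_def by blast+
      then show "\<exists>x r'. vpair (chk (n (\<phi> (k, t)) k)) r = vpair x r' \<and> x \<in> (\<Union>y\<in>elts m1. (\<lambda>k. chk (n y k)) ` elts m1) \<and> r' \<in> C"
        by (intro exI conjI refl) auto
    qed
    moreover have "small {vpair x r | x r. x \<in> (\<Union>y\<in>elts m1. (\<lambda>k. chk (n y k)) ` elts m1) \<and> r \<in> C}"
      by (intro small_vpairs small_UN small_image small_elts small_C)
    ultimately show ?thesis unfolding B_def using elts_set_of_small small_subset by meson
  qed
  have name_B: "name (B (\<lambda>y k. chk (n y k)))" for n
    by (subst name_iff) (auto simp: elts_B sel_def)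
  have B_mem: "dense_below u (\<lambda>r. \<exists>k t. sel k t r \<and> feq r x (chk (n (\<phi> (k, t)) k)))"
    if "fmem u x (B (\<lambda>y k. chk (n y k)))" for u x n
    using that unfolding fmem_iff
  proof (rule dense_below_weaken)
    fix r assume r: "r \<in> C" and "\<exists>\<pi> s. vpair \<pi> s \<in> elts (B (\<lambda>y k. chk (n y k))) \<and> le r s \<and> feq r x \<pi>"
    then obtain k t s where "sel k t s" "le r s" "feq r x (chk (n (\<phi> (k, t)) k))" unfolding elts_B by auto
    then show "\<exists>k t. sel k t r \<and> feq r x (chk (n (\<phi> (k, t)) k))" using sel_mono r by blast
  qed
  have B_elt: "fmem r (chk (n (\<phi> (k, t)) k)) (B (\<lambda>y k. chk (n y k)))" if "sel k t s" "le r s" for n k t s r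
    by (rule fmem_elt[OF name_B, of _ s]) (use that in \<open>auto simp: elts_B\<close>)

  define h1 where "h1 = B (\<lambda>y k. chk y)"
  define F where "F = B (\<lambda>y k. chk (vpair y k))"
  have nh: "name h1" "name F" unfolding h1_def F_def by (simp_all add: name_B)
  have F_mem: "\<exists>w\<in>C. le w u \<and> (\<exists>k t. sel k t w \<and> feq w x (chk (\<phi> (k, t))) \<and> feq w y (chk k))"
    if m: "fmem u (pairn x y) F" and n: "name x" "name y" and u: "u \<in> C" for u x y
  proof -
    obtain w k t where w: "w \<in> C" "le w u" "sel k t w" "feq w (pairn x y) (chk (vpair (\<phi> (k, t)) k))"
      using dense_belowE[OF B_mem[of u "pairn x y" vpair, OF m[unfolded F_def]] u le_refl[OF u]] by metis
    then show ?thesis using pairn_inject[OF n name_chk name_chk w(1)] unfolding chk_vpair by blast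
  qed
  have func: "q \<tturnstile> function_fm F h1 (chk m1)"
  proof (rule frc_functionI[OF q nh(2,1) name_chk])
    fix z s u assume z: "vpair z s \<in> elts F" "u \<in> C" "le u q" "le u s"
    then obtain k t where k: "sel k t s" "z = chk (vpair (\<phi> (k, t)) k)" unfolding F_def elts_B by auto
    have "fmem u (chk (\<phi> (k, t))) h1" unfolding h1_def using B_elt[OF k(1) z(4), of "\<lambda>y k. y"] by simp
    moreover have "fmem u (chk k) (chk m1)" using k(1) z(2) by (simp add: fmem_chk_chk sel_def)
    ultimately show "\<exists>x y. name x \<and> name y \<and> fmem u x h1 \<and> fmem u y (chk m1) \<and> z = pairn x y"
      unfolding k chk_vpair using name_chk by blast
  next
    fix x s u assume x: "vpair x s \<in> elts h1" "u \<in> C" "le u q" "le u s"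
    then obtain k t where k: "sel k t s" "x = chk (\<phi> (k, t))" unfolding h1_def elts_B by auto
    have "fmem u (pairn x (chk k)) F"
      unfolding k F_def using B_elt[OF k(1) x(4), of vpair] by (simp add: chk_vpair)
    moreover have "fmem u (chk k) (chk m1)" using k(1) x(2) by (simp add: fmem_chk_chk sel_def)
    ultimately show "\<exists>r\<in>C. le r u \<and> (\<exists>y. name y \<and> fmem r y (chk m1) \<and> fmem r (pairn x y) F)"
      using x(2) le_refl name_chk by blast
  next
    fix x y y' u assume n: "name x" "name y" "name y'" and u: "u \<in> C" "le u q"
      and m: "fmem u (pairn x y) F" "fmem u (pairn x y') F"
    show "feq u y y'"
    proof (rule feq_dense, rule dense_belowI)
      fix v assume v: "v \<in> C" "le v u"
      obtain w k t where w: "w \<in> C" "le w v" "sel k t w" "feq w x (chk (\<phi> (k, t)))" "feq w y (chk k)"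
        using F_mem[OF fmem_mono[OF m(1) v(2)] n(1,2) v(1)] by blast
      have wu: "le w u" using w v le_trans by blast
      obtain w' k' t' where w': "w' \<in> C" "le w' w" "sel k' t' w'" "feq w' x (chk (\<phi> (k', t')))" "feq w' y' (chk k')"
        using F_mem[OF fmem_mono[OF m(2) wu] n(1,3) w(1)] by blast
      have "feq w' (chk (\<phi> (k, t))) (chk (\<phi> (k', t')))"
        by (rule feq_trans[OF name_chk n(1) name_chk feq_sym[OF feq_mono[OF w(4) w'(2)]] w'(4)])
      \<comment> \<open>As \<phi> is injective across all blocks, the index can be read off from the
        element; this is what makes F single-valued.\<close>
      then have "(k, t) = (k', t')" using feq_chk[OF w'(1)] \<phi>(1) w(3) w'(3) unfolding sel_def inj_on_def by auto
      then have "feq w' y' (chk k)" using w'(5) by simp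
      then have "feq w' y y'"
        by (rule feq_trans[OF n(2) name_chk n(3) feq_mono[OF w(5) w'(2)] feq_sym])
      then show "\<exists>r\<in>C. le r v \<and> feq r y y'" using w w' le_trans by blast
    qed
  qed
  have "q \<tturnstile> bijection_fm F h1 (chk m1)"
  proof (rule frc_bijectionI[OF q nh(2,1) name_chk func])
    fix y s u assume y: "vpair y s \<in> elts (chk m1)" "u \<in> C" "le u q" "le u s"
    then obtain k where k: "k \<in> elts m1" "y = chk k" by auto
    obtain r t where r: "r \<in> C" "le r u" "sel k t r" using sel_dense[OF k(1) y(2,3)] by blast
    have "fmem r (chk (\<phi> (k, t))) h1" "fmem r (pairn (chk (\<phi> (k, t))) y) F" unfolding h1_def F_def k
      using B_elt[OF r(3) le_refl[OF r(1)], of "\<lambda>y k. y"] B_elt[OF r(3) le_refl[OF r(1)], of vpair]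
      by (simp_all add: chk_vpair)
    then show "\<exists>r\<in>C. le r u \<and> (\<exists>x. name x \<and> fmem r x h1 \<and> fmem r (pairn x y) F)" using r name_chk by blast
  next
    fix x y x' u assume n: "name x" "name y" "name x'" and u: "u \<in> C" "le u q"
      and m: "fmem u (pairn x y) F" "fmem u (pairn x' y) F"
    show "feq u x x'"
    proof (rule feq_dense, rule dense_belowI)
      fix v assume v: "v \<in> C" "le v u"
      obtain w k t where w: "w \<in> C" "le w v" "sel k t w" "feq w x (chk (\<phi> (k, t)))" "feq w y (chk k)"
        using F_mem[OF fmem_mono[OF m(1) v(2)] n(1,2) v(1)] by blast
      have wu: "le w u" using w v le_trans by blast
      obtain w' k' t' where w': "w' \<in> C" "le w' w" "sel k' t' w'" "feq w' x' (chk (\<phi> (k', t')))" "feq w' y (chk k')"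
        using F_mem[OF fmem_mono[OF m(2) wu] n(3,2) w(1)] by blast
      have "feq w' (chk k) (chk k')"
        by (rule feq_trans[OF name_chk n(2) name_chk feq_sym[OF feq_mono[OF w(5) w'(2)]] w'(5)])
      then have "k = k'" using feq_chk[OF w'(1)] by blast
      \<comment> \<open>Conversely an index determines its element, because a condition selects only
        one stem in block k.\<close>
      then have "t = t'" using sel_unique sel_mono[OF w(3) w'(1,2)] w'(3) by blast
      then have "feq w' x' (chk (\<phi> (k, t)))" using w'(4) \<open>k = k'\<close> by simp
      then have "feq w' x x'"
        by (rule feq_trans[OF n(1) name_chk n(3) feq_mono[OF w(4) w'(2)] feq_sym])
      then show "\<exists>r\<in>C. le r v \<and> feq r x x'" using w w' le_trans by blast
    qed
  qed
  then have "q \<tturnstile> equinumerous_fm h1 (chk m1)"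
    unfolding equinumerous_fm_def by (rule frc_ExistsI[OF nh(2)])
  moreover have "q \<tturnstile> subset_fm h1 (chk m1)"
  proof (rule frc_subsetI[OF q nh(1) name_chk])
    fix x s u assume "vpair x s \<in> elts h1" and u: "u \<in> C"
    then obtain k t where k: "sel k t s" "x = chk (\<phi> (k, t))" unfolding h1_def elts_B by auto
    then have "\<phi> (k, t) \<in> elts m1" using \<phi>H H(1) unfolding sel_def by blast
    then show "fmem u x (chk m1)" using u k(2) fmem_chkI by blast
  qed
  ultimately have s1: "q \<tturnstile> subset_of_size_fm h1 (chk m1) (chk m1)" by (simp add: subset_of_size_fm_def)
  show ?thesis
  proof (rule bexI[OF _ y0(1)], intro exI[of _ h1] conjI allI impI)
    show "name h1" "R y0 \<tturnstile> subset_of_size_fm h1 (chk m1) (chk m1)" using nh(1) s1 q_def by simp_all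
    fix u y assume "fmem u y h1"
    from B_mem[of u y "\<lambda>y k. y", OF this[unfolded h1_def]]
    show "dense_below u (\<lambda>r. \<exists>\<beta>\<in>H. le r (R \<beta>) \<and> feq r y (chk \<beta>))"
      by (rule dense_below_weaken) (use \<phi>H in \<open>auto simp: sel_def\<close>)
  qed
qed

section \<open>Positive relations in the extension\<close>

lemma frc_polarized:
  assumes s: "holds (succ_cardinal_fm m1 \<mu>)" "holds (succ_cardinal_fm m2 m1)"
    and \<nu>: "|elts \<nu>| <o |elts \<mu>|"
    and pol: "holds (polarized_fm m2 m1 \<nu> m1 \<mu>)" and p: "p \<in> C"
  shows "p \<tturnstile> polarized_fm (chk m2) (chk m1) (chk \<nu>) (chk m1) (chk \<mu>)"
  unfolding polarized_fm_def
proof (simp only: forces.simps frc_Imp[OF p], intro allI impI ballI, elim conjE, rule frc_dense, assumption,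
    rule dense_belowI)
  fix d f q0 p'
  assume nm: "name d" "name f" and q0': "q0 \<in> C" "le q0 p"
    and d: "q0 \<tturnstile> prod_fm d (chk m2) (chk m1)" and f: "q0 \<tturnstile> function_fm f d (chk \<mu>)"
    and p': "p' \<in> C" "le p' q0"
  have "\<exists>r \<gamma>. r \<in> C \<and> le r p' \<and> \<gamma> \<in> elts \<mu> \<and> fmem r (pairn (chk (vpair \<alpha> \<beta>)) (chk \<gamma>)) f"
    if "\<alpha> \<in> elts m2" "\<beta> \<in> elts m1" for \<alpha> \<beta>
  proof -
    have m: "fmem p' (chk (vpair \<alpha> \<beta>)) d"
      using frc_prodD[OF q0'(1) nm(1) d that] fmem_mono p'(2) by (simp add: chk_vpair)
    obtain r y where r: "r \<in> C" "le r p'" "name y" "fmem r y (chk \<mu>)" "fmem r (pairn (chk (vpair \<alpha> \<beta>)) y) f"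
      using dense_belowE[OF frc_function_value[OF q0'(1) nm(2,1) name_chk name_chk f p' m] p'(1) le_refl[OF p'(1)]]
      by metis
    obtain u \<gamma> where u: "u \<in> C" "le u r" "\<gamma> \<in> elts \<mu>" "feq u y (chk \<gamma>)"
      using dense_belowE[OF r(4)[unfolded fmem_chk[OF r(1)]] r(1) le_refl[OF r(1)]] by metis
    have "fmem u (pairn (chk (vpair \<alpha> \<beta>)) (chk \<gamma>)) f"
      by (rule fmem_cong_left[OF _ _ nm(2) feq_pairn[OF _ _ _ _ _ u(4)] fmem_mono[OF r(5) u(2)]])
        (use r in \<open>auto intro: feq_refl\<close>)
    then show ?thesis using u r le_trans by blast
  qed
  then obtain P G where PG: "\<And>\<alpha> \<beta>. \<alpha> \<in> elts m2 \<Longrightarrow> \<beta> \<in> elts m1 \<Longrightarrow> P \<alpha> \<beta> \<in> C \<and> le (P \<alpha> \<beta>) p' \<and>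
      G \<alpha> \<beta> \<in> elts \<mu> \<and> fmem (P \<alpha> \<beta>) (pairn (chk (vpair \<alpha> \<beta>)) (chk (G \<alpha> \<beta>))) f" by metis
  \<comment> \<open>The ground model relation admits only \<mu> colours, given as elements of \<mu>,
    so the pair of a stem and a value is coded by a single such element.\<close>
  obtain e where e: "inj_on e (elts \<mu> \<times> elts \<mu>)" "e ` (elts \<mu> \<times> elts \<mu>) \<subseteq> elts \<mu>"
    using mu_times_mu card_of_ordLeq by metis
  define f' where "f' \<alpha> \<beta> = e (stem (P \<alpha> \<beta>), G \<alpha> \<beta>)" for \<alpha> \<beta>
  have "\<forall>\<alpha>\<in>elts m2. \<forall>\<beta>\<in>elts m1. f' \<alpha> \<beta> \<in> elts \<mu>" unfolding f'_def using e(2) PG stem_in by blast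
  then obtain H0 H1 where H: "H0 \<subseteq> elts m2" "|H0| =o |elts \<nu>|" "H1 \<subseteq> elts m1" "|H1| =o |elts m1|"
    "\<forall>x\<in>H0. \<forall>y\<in>H1. \<forall>x'\<in>H0. \<forall>y'\<in>H1. f' x y = f' x' y'"
    using pol[unfolded holds_polarized, rule_format, of f'] by blast
  have hom: "stem (P x y) = stem (P x' y') \<and> G x y = G x' y'" if "x \<in> H0" "y \<in> H1" "x' \<in> H0" "y' \<in> H1" for x y x' y'
  proof -
    have "f' x y = f' x' y'" using H(5) that by blast
    moreover have "(stem (P x y), G x y) \<in> elts \<mu> \<times> elts \<mu>" "(stem (P x' y'), G x' y') \<in> elts \<mu> \<times> elts \<mu>"
      using that H(1,3) PG stem_in by blast+
    ultimately show ?thesis unfolding f'_def using e(1) unfolding inj_on_def by blast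
  qed
  have "\<exists>\<gamma>0. \<forall>x\<in>H0. \<forall>y\<in>H1. G x y = \<gamma>0" using hom by metis
  then obtain \<gamma>0 where \<gamma>0: "\<And>x y. x \<in> H0 \<Longrightarrow> y \<in> H1 \<Longrightarrow> G x y = \<gamma>0" by blast
  have "\<exists>r\<in>C. le r p' \<and> (\<forall>x\<in>H0. le r (P x y))" if y: "y \<in> H1" for y
  proof (cases "H0 = {}")
    \<comment> \<open>This happens for \<nu> = 0, where there are no conditions to extend.\<close>
    case True then show ?thesis using p' le_refl by blast
  next
    case False
    then obtain x0 where x0: "x0 \<in> H0" by blast
    have "|(\<lambda>x. P x y) ` H0| <o |elts \<mu>|"
      using card_of_image[of "\<lambda>x. P x y" H0] H(2) \<nu> ordLeq_ordIso_trans ordLeq_ordLess_trans by blast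
    then obtain r where r: "r \<in> C" "\<forall>p\<in>(\<lambda>x. P x y) ` H0. le r p"
      using centered[of "(\<lambda>x. P x y) ` H0" "stem (P x0 y)"] x0 y H(1,3) PG hom by blast
    moreover have "le r p'" using r x0 y H(1,3) PG le_trans by blast
    ultimately show ?thesis by blast
  qed
  then obtain R where R: "\<And>y. y \<in> H1 \<Longrightarrow> R y \<in> C \<and> le (R y) p' \<and> (\<forall>x\<in>H0. le (R y) (P x y))" by metis
  have RC: "R y \<in> C" if "y \<in> H1" for y using R[OF that] by blast
  obtain y0 h1 where y0: "y0 \<in> H1" and h1: "name h1" and s1: "R y0 \<tturnstile> subset_of_size_fm h1 (chk m1) (chk m1)"
    and h1_mem: "\<And>u y. fmem u y h1 \<Longrightarrow> dense_below u (\<lambda>r. \<exists>\<beta>\<in>H1. le r (R \<beta>) \<and> feq r y (chk \<beta>))"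
    using frc_generic_large_set[of m1 H1 R, OF s(1) H(3,4) RC] by blast
  define q where "q = R y0"
  have q: "q \<in> C" "le q p'" using R y0 unfolding q_def by blast+
  have qq: "le q q0" using q p' le_trans by blast
  define h0 where "h0 = chk (set_of H0)"
  have eH0: "elts (set_of H0) = H0" using H(1) small_subset small_elts elts_set_of_small by metis
  have nh: "name h0" "name h1" unfolding h0_def using h1 by simp_all
  have s0: "q \<tturnstile> subset_of_size_fm h0 (chk m2) (chk \<nu>)"
  proof -
    have "q \<tturnstile> subset_fm h0 (chk m2)"
      by (rule frc_subsetI[OF q(1) nh(1) name_chk]) (use H(1) in \<open>auto simp: h0_def eH0 fmem_chk_chk\<close>)
    moreover have "q \<tturnstile> equinumerous_fm h0 (chk \<nu>)"
      unfolding h0_def by (rule frc_equinumerous_chk[OF q(1)]) (use H(2) in \<open>simp add: eH0\<close>)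
    ultimately show ?thesis by (simp add: subset_of_size_fm_def)
  qed
  \<comment> \<open>Members of \<open>h0\<close> and \<open>h1\<close> are only densely equal to
    ground model elements \<alpha> and \<beta>. But \<beta> enters \<open>h1\<close> only below
    \<open>R \<beta>\<close>, hence below \<open>P \<alpha> \<beta>\<close>, and that condition has
    already fixed the colour.\<close>
  have val: "\<exists>w\<in>C. le w v \<and> feq w c (chk \<gamma>0)"
    if v: "v \<in> C" "le v q" and n: "name x" "name y" "name c" and m: "fmem v x h0" "fmem v y h1" "fmem v (pairn (pairn x y) c) f"
    for v x y c
  proof -
    obtain w \<alpha> where w: "w \<in> C" "le w v" "\<alpha> \<in> H0" "feq w x (chk \<alpha>)"
      using dense_belowE[OF m(1)[unfolded h0_def fmem_chk[OF v(1)] eH0] v(1) le_refl[OF v(1)]] by metis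
    obtain u \<beta> where u: "u \<in> C" "le u w" and \<beta>: "\<beta> \<in> H1" "le u (R \<beta>)" "feq u y (chk \<beta>)"
      using dense_belowE[OF h1_mem[OF m(2)] w(1,2)] by metis
    have up: "le u (P \<alpha> \<beta>)" using \<beta> R w(3) le_trans by blast
    have uv: "le u v" "le u q0" using u w v qq le_trans by blast+
    have PG': "fmem (P \<alpha> \<beta>) (pairn (chk (vpair \<alpha> \<beta>)) (chk \<gamma>0)) f"
      using PG[of \<alpha> \<beta>] \<gamma>0[OF w(3) \<beta>(1)] w(3) \<beta>(1) H(1,3) by auto
    have "fmem u (pairn (chk (vpair \<alpha> \<beta>)) c) f"
    proof (rule fmem_cong_left[OF _ _ nm(2) _ fmem_mono[OF m(3) uv(1)]])
      show "feq u (pairn (pairn x y) c) (pairn (chk (vpair \<alpha> \<beta>)) c)" unfolding chk_vpair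
        using feq_mono[OF w(4) u(2)] \<beta>(3) n by (intro feq_pairn feq_refl) auto
    qed (use n in auto)
    from frc_function_unique[OF q0'(1) nm(2,1) name_chk name_chk n(3) name_chk f u(1) uv(2) this fmem_mono[OF PG' up]]
    show ?thesis using u uv by blast
  qed
  have "q \<tturnstile> image_at_most_one_fm f h0 h1"
    unfolding frc_image_at_most_one[OF q(1) nm(2) nh(1,2)]
  proof (intro allI impI)
    fix u x y x' y' c c' assume u: "u \<in> C" "le u q" and n: "name x" "name y" "name x'" "name y'" "name c" "name c'"
      and m: "fmem u x h0" "fmem u y h1" "fmem u x' h0" "fmem u y' h1"
        "fmem u (pairn (pairn x y) c) f" "fmem u (pairn (pairn x' y') c') f"
    show "feq u c c'"
    proof (rule feq_dense, rule dense_belowI)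
      fix v assume v: "v \<in> C" "le v u"
      then have "le v q" using u le_trans by blast
      from val[OF v(1) this n(1,2,5) fmem_mono[OF m(1) v(2)] fmem_mono[OF m(2) v(2)] fmem_mono[OF m(5) v(2)]]
      obtain w where w: "w \<in> C" "le w v" "feq w c (chk \<gamma>0)" by blast
      then have wu: "le w u" "le w q" using v u le_trans by blast+
      from val[OF w(1) wu(2) n(3,4,6) fmem_mono[OF m(3) wu(1)] fmem_mono[OF m(4) wu(1)] fmem_mono[OF m(6) wu(1)]]
      obtain w' where w': "w' \<in> C" "le w' w" "feq w' c' (chk \<gamma>0)" by blast
      have "feq w' c c'" by (rule feq_trans[OF n(5) name_chk n(6) feq_mono[OF w(3) w'(2)] feq_sym[OF w'(3)]])
      then show "\<exists>r\<in>C. le r v \<and> feq r c c'" using w w' le_trans by blast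
    qed
  qed
  then have "q \<tturnstile> Exists (\<lambda>h0. Exists (\<lambda>h1.
      Conj (Conj (subset_of_size_fm h0 (chk m2) (chk \<nu>)) (subset_of_size_fm h1 (chk m1) (chk m1)))
           (image_at_most_one_fm f h0 h1)))"
    using s0 s1[folded q_def] by (intro frc_ExistsI[OF nh(1)] frc_ExistsI[OF nh(2)]) simp
  then show "\<exists>r\<in>C. le r p' \<and> r \<tturnstile> Exists (\<lambda>h0. Exists (\<lambda>h1.
      Conj (Conj (subset_of_size_fm h0 (chk m2) (chk \<nu>)) (subset_of_size_fm h1 (chk m1) (chk m1)))
           (image_at_most_one_fm f h0 h1)))" using q by blast
qed

section \<open>Negative relations in the extension\<close>

text \<open>\<open>E s i \<alpha>\<close> is to be read as: s forces \<alpha> to be the element with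
  index i of a subset of k enumerated by l. Persistence, density of decisions and distinctness of
  elements with distinct indices are all that is retained, so the combinatorics that follows deals
  with no names.\<close>

definition forced_enum :: "'v \<Rightarrow> 'v \<Rightarrow> 'v \<Rightarrow> ('v \<Rightarrow> 'v \<Rightarrow> 'v \<Rightarrow> bool) \<Rightarrow> bool" where
  "forced_enum k l r E \<longleftrightarrow>
     (\<forall>s t i \<alpha>. E s i \<alpha> \<longrightarrow> le t s \<longrightarrow> E t i \<alpha>) \<and>
     (\<forall>i\<in>elts l. dense_below r (\<lambda>s. \<exists>\<alpha>\<in>elts k. E s i \<alpha>)) \<and>
     (\<forall>s\<in>C. \<forall>i i' \<alpha>. le s r \<longrightarrow> E s i \<alpha> \<longrightarrow> E s i' \<alpha> \<longrightarrow> i = i')"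

lemma forced_enumD:
  assumes "forced_enum k l r E"
  shows "E s i \<alpha> \<Longrightarrow> le t s \<Longrightarrow> E t i \<alpha>"
    and "i \<in> elts l \<Longrightarrow> dense_below r (\<lambda>s. \<exists>\<alpha>\<in>elts k. E s i \<alpha>)"
    and "s \<in> C \<Longrightarrow> le s r \<Longrightarrow> E s i \<alpha> \<Longrightarrow> E s i' \<alpha> \<Longrightarrow> i = i'"
  using assms unfolding forced_enum_def by (elim conjE; simp)+

lemma forced_enum_mono: "forced_enum k l r E \<Longrightarrow> le s r \<Longrightarrow> forced_enum k l s E"
  unfolding forced_enum_def using dense_below_mono le_trans by meson

lemma subset_of_size_enum:
  assumes p: "p \<in> C" and n: "name h" and h: "p \<tturnstile> subset_of_size_fm h (chk k) (chk l)"
  obtains r E where "r \<in> C" "le r p" "forced_enum k l r E"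
    "\<And>s i \<alpha>. E s i \<alpha> \<Longrightarrow> fmem s (chk \<alpha>) h"
proof -
  have sub: "p \<tturnstile> subset_fm h (chk k)" and eq: "p \<tturnstile> equinumerous_fm h (chk l)"
    using h by (simp_all add: subset_of_size_fm_def)
  obtain r F where r: "r \<in> C" "le r p" "name F" "r \<tturnstile> bijection_fm F h (chk l)"
    using dense_belowE[OF eq[unfolded equinumerous_fm_def frc_Exists] p le_refl[OF p]] by metis
  have fn: "r \<tturnstile> function_fm F h (chk l)" using r by (simp add: bijection_fm_def)
  \<comment> \<open>F maps the set h onto l, so \<open>E\<close> reads the enumeration backwards,
    and distinct indices get distinct elements because F is single-valued.\<close>
  define E where "E s i \<alpha> \<longleftrightarrow> fmem s (chk \<alpha>) h \<and> fmem s (pairn (chk \<alpha>) (chk i)) F" for s i \<alpha>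
  have "forced_enum k l r E"
    unfolding forced_enum_def
  proof (intro conjI allI ballI impI)
    fix s t i \<alpha> show "E s i \<alpha> \<Longrightarrow> le t s \<Longrightarrow> E t i \<alpha>" unfolding E_def using fmem_mono by blast
  next
    fix i assume i: "i \<in> elts l"
    show "dense_below r (\<lambda>s. \<exists>\<alpha>\<in>elts k. E s i \<alpha>)"
    proof (rule dense_belowI)
      fix q assume q: "q \<in> C" "le q r"
      obtain s x where s: "s \<in> C" "le s q" "name x" "fmem s x h" "fmem s (pairn x (chk i)) F"
        using dense_belowE[OF frc_bijection_value[OF r(1,3) n name_chk name_chk r(4) q fmem_chkI[OF i q(1)]] q(1) le_refl[OF q(1)]]
        by metis
      have "le s p" using s q r le_trans by blast
      then have "fmem s x (chk k)"
        using frc_All_inD[OF sub[unfolded subset_fm_def] p s(1) _ s(3,4)] by simp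
      from dense_belowE[OF this[unfolded fmem_chk[OF s(1)]] s(1) le_refl[OF s(1)]]
      obtain t \<alpha> where t: "t \<in> C" "le t s" "\<alpha> \<in> elts k" "feq t x (chk \<alpha>)" by metis
      have "fmem t (chk \<alpha>) h" by (rule fmem_cong_left[OF s(3) name_chk n t(4) fmem_mono[OF s(4) t(2)]])
      moreover have "fmem t (pairn (chk \<alpha>) (chk i)) F"
        by (rule fmem_cong_left[OF _ _ r(3) feq_pairn[OF _ _ _ _ t(4)] fmem_mono[OF s(5) t(2)]])
          (use s in \<open>auto intro: feq_refl\<close>)
      ultimately show "\<exists>t\<in>C. le t q \<and> (\<exists>\<alpha>\<in>elts k. E t i \<alpha>)" unfolding E_def using s t le_trans by blast
    qed
  next
    fix s i i' \<alpha> assume s: "s \<in> C" "le s r" "E s i \<alpha>" "E s i' \<alpha>"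
    then have "feq s (chk i) (chk i')"
      using frc_function_unique[OF r(1,3) n name_chk name_chk name_chk name_chk fn s(1,2)] unfolding E_def by blast
    then show "i = i'" using feq_chk[OF s(1)] by blast
  qed
  then show ?thesis using that r(1,2) E_def by blast
qed

text \<open>The forced relation is applied to the canonical name of a ground model colouring. A
  condition deciding elements on both sides then forces two ground model colours to be equal, and
  such an equation is simply true.\<close>

lemma frc_polarized_enums:
  assumes q: "q \<in> C" "q \<tturnstile> polarized_fm (chk k0) (chk k1) (chk l0) (chk l1) (chk t)"
    and f: "\<forall>x\<in>elts k0. \<forall>y\<in>elts k1. f x y \<in> elts t"
  obtains r E0 E1 where "r \<in> C"
    "forced_enum k0 l0 r E0" "forced_enum k1 l1 r E1"
    "\<And>s i i' j j' \<alpha> \<alpha>' \<beta> \<beta>'. s \<in> C \<Longrightarrow> le s r \<Longrightarrow>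
      \<alpha> \<in> elts k0 \<Longrightarrow> \<alpha>' \<in> elts k0 \<Longrightarrow> \<beta> \<in> elts k1 \<Longrightarrow> \<beta>' \<in> elts k1 \<Longrightarrow>
      E0 s i \<alpha> \<Longrightarrow> E0 s i' \<alpha>' \<Longrightarrow> E1 s j \<beta> \<Longrightarrow> E1 s j' \<beta>' \<Longrightarrow> f \<alpha> \<beta> = f \<alpha>' \<beta>'"
proof -
  let ?D = "{vpair x y | x y. x \<in> elts k0 \<and> y \<in> elts k1}"
  define d where "d = set_of ?D"
  have d: "elts d = ?D" unfolding d_def by (intro elts_set_of_small small_vpairs small_elts)
  define g where "g z = (THE c. \<exists>x y. z = vpair x y \<and> c = f x y)" for z
  have g: "g (vpair x y) = f x y" for x y unfolding g_def by auto
  define F where "F = set_of (graph_on (elts d) g)"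
  have F: "elts F = graph_on (elts d) g" unfolding F_def by (intro elts_set_of_small small_graph_on small_elts)
  have "q \<tturnstile> prod_fm (chk d) (chk k0) (chk k1)" by (rule frc_prod_chk[OF q(1) d])
  moreover have "q \<tturnstile> function_fm (chk F) (chk d) (chk t)"
    by (rule frc_function_chk[OF q(1) _ F]) (use d g f in auto)
  moreover have "q \<tturnstile> Imp (Conj (prod_fm (chk d) (chk k0) (chk k1)) (function_fm (chk F) (chk d) (chk t)))
           (Exists (\<lambda>h0. Exists (\<lambda>h1.
              Conj (Conj (subset_of_size_fm h0 (chk k0) (chk l0)) (subset_of_size_fm h1 (chk k1) (chk l1)))
                   (image_at_most_one_fm (chk F) h0 h1))))"
    using q(2) by (simp add: polarized_fm_def)
  ultimately have "q \<tturnstile> Exists (\<lambda>h0. Exists (\<lambda>h1.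
              Conj (Conj (subset_of_size_fm h0 (chk k0) (chk l0)) (subset_of_size_fm h1 (chk k1) (chk l1)))
                   (image_at_most_one_fm (chk F) h0 h1)))"
    using q(1) le_refl by (simp add: frc_Imp)
  then have dd: "dense_below q (\<lambda>r. \<exists>h0. name h0 \<and> r \<tturnstile> Exists (\<lambda>h1.
              Conj (Conj (subset_of_size_fm h0 (chk k0) (chk l0)) (subset_of_size_fm h1 (chk k1) (chk l1)))
                   (image_at_most_one_fm (chk F) h0 h1)))"
    by (simp only: frc_Exists[where p = q])
  obtain q1 where q1: "q1 \<in> C" "le q1 q" "le q1 q" and ex0: "\<exists>h0. name h0 \<and> q1 \<tturnstile> Exists (\<lambda>h1.
              Conj (Conj (subset_of_size_fm h0 (chk k0) (chk l0)) (subset_of_size_fm h1 (chk k1) (chk l1)))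
                   (image_at_most_one_fm (chk F) h0 h1))"
    by (rule dense_belowE[OF dd q(1) le_refl[OF q(1)]])
  from ex0 obtain h0 where h0: "name h0" and ex1: "q1 \<tturnstile> Exists (\<lambda>h1.
              Conj (Conj (subset_of_size_fm h0 (chk k0) (chk l0)) (subset_of_size_fm h1 (chk k1) (chk l1)))
                   (image_at_most_one_fm (chk F) h0 h1))" by blast
  obtain q2 where q2: "q2 \<in> C" "le q2 q1" "le q2 q1" and ex2: "\<exists>h1. name h1 \<and> q2 \<tturnstile>
              Conj (Conj (subset_of_size_fm h0 (chk k0) (chk l0)) (subset_of_size_fm h1 (chk k1) (chk l1)))
                   (image_at_most_one_fm (chk F) h0 h1)"
    by (rule dense_belowE[OF ex1[unfolded frc_Exists[where p = q1]] q1(1) le_refl[OF q1(1)]])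
  from ex2 obtain h1 where h1: "name h1" and "q2 \<tturnstile>
              Conj (Conj (subset_of_size_fm h0 (chk k0) (chk l0)) (subset_of_size_fm h1 (chk k1) (chk l1)))
                   (image_at_most_one_fm (chk F) h0 h1)" by blast
  then have s0: "q2 \<tturnstile> subset_of_size_fm h0 (chk k0) (chk l0)" and s1: "q2 \<tturnstile> subset_of_size_fm h1 (chk k1) (chk l1)"
    and im: "q2 \<tturnstile> image_at_most_one_fm (chk F) h0 h1" by simp_all
  obtain r0 E0 where r0: "r0 \<in> C" "le r0 q2" and E0: "forced_enum k0 l0 r0 E0"
    "\<And>s i \<alpha>. E0 s i \<alpha> \<Longrightarrow> fmem s (chk \<alpha>) h0"
    by (rule subset_of_size_enum[OF q2(1) h0 s0]) blast
  obtain r1 E1 where r1: "r1 \<in> C" "le r1 r0" and E1: "forced_enum k1 l1 r1 E1"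
    "\<And>s i \<alpha>. E1 s i \<alpha> \<Longrightarrow> fmem s (chk \<alpha>) h1"
    by (rule subset_of_size_enum[OF r0(1) h1 frc_mono[OF s1 r0]]) blast
  have c2: "f \<alpha> \<beta> = f \<alpha>' \<beta>'" if s: "s \<in> C" "le s r1"
      and k: "\<alpha> \<in> elts k0" "\<alpha>' \<in> elts k0" "\<beta> \<in> elts k1" "\<beta>' \<in> elts k1"
      and E: "E0 s i \<alpha>" "E0 s i' \<alpha>'" "E1 s j \<beta>" "E1 s j' \<beta>'" for s i i' j j' \<alpha> \<alpha>' \<beta> \<beta>'
    proof -
      have sq: "le s q2" using s r1 r0 le_trans by blast
      have "fmem s (pairn (pairn (chk \<alpha>) (chk \<beta>)) (chk (f \<alpha> \<beta>))) (chk F)"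
        "fmem s (pairn (pairn (chk \<alpha>') (chk \<beta>')) (chk (f \<alpha>' \<beta>'))) (chk F)"
        using s(1) k by (auto simp: fmem_chk_chk F d g simp flip: chk_vpair)
      then have "feq s (chk (f \<alpha> \<beta>)) (chk (f \<alpha>' \<beta>'))"
        using im[unfolded frc_image_at_most_one[OF q2(1) name_chk h0 h1], rule_format, OF s(1) sq
            name_chk name_chk name_chk name_chk name_chk name_chk E0(2)[OF E(1)] E1(2)[OF E(3)] E0(2)[OF E(2)] E1(2)[OF E(4)]]
        by blast
      then show ?thesis using feq_chk[OF s(1)] by blast
    qed
  show ?thesis
    by (rule that[of r1 E0 E1]) (fact r1(1) forced_enum_mono[OF E0(1) r1(2)] E1(1) c2)+
qed

text \<open>Injectivity of A and B and equality of two colours each involve at most two indices on a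
  side. Hence \<open>common\<close> asks for compatibility of finitely many decisions only, even
  though no condition may realise the rectangle as a whole.\<close>

lemma homogeneous_rectangle:
  assumes E0: "forced_enum k0 l0 r E0" and E1: "forced_enum k1 l1 r E1"
    and hom: "\<And>s i i' j j' \<alpha> \<alpha>' \<beta> \<beta>'. s \<in> C \<Longrightarrow> le s r \<Longrightarrow>
      \<alpha> \<in> elts k0 \<Longrightarrow> \<alpha>' \<in> elts k0 \<Longrightarrow> \<beta> \<in> elts k1 \<Longrightarrow> \<beta>' \<in> elts k1 \<Longrightarrow>
      E0 s i \<alpha> \<Longrightarrow> E0 s i' \<alpha>' \<Longrightarrow> E1 s j \<beta> \<Longrightarrow> E1 s j' \<beta>' \<Longrightarrow> f \<alpha> \<beta> = f \<alpha>' \<beta>'"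
    and A: "A ` I \<subseteq> elts k0" and B: "B ` J \<subseteq> elts k1"
    and common: "\<And>I' J'. I' \<subseteq> I \<Longrightarrow> finite I' \<Longrightarrow> J' \<subseteq> J \<Longrightarrow> finite J' \<Longrightarrow>
      \<exists>t\<in>C. le t r \<and> (\<forall>i\<in>I'. E0 t i (A i)) \<and> (\<forall>j\<in>J'. E1 t j (B j))"
  shows "|A ` I| =o |I|" "|B ` J| =o |J|"
    "\<forall>x\<in>A ` I. \<forall>y\<in>B ` J. \<forall>x'\<in>A ` I. \<forall>y'\<in>B ` J. f x y = f x' y'"
proof -
  have "inj_on A I"
  proof (rule inj_onI)
    fix i j assume ij: "i \<in> I" "j \<in> I" "A i = A j"
    then obtain t where t: "t \<in> C" "le t r" "E0 t i (A i)" "E0 t j (A j)" using common[of "{i, j}" "{}"] by auto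
    then show "i = j" using forced_enumD(3)[OF E0 t(1,2)] ij by metis
  qed
  then show "|A ` I| =o |I|" by (rule ordIso_symmetric[OF card_of_ordIsoI[OF inj_on_imp_bij_betw]])
  have "inj_on B J"
  proof (rule inj_onI)
    fix i j assume ij: "i \<in> J" "j \<in> J" "B i = B j"
    then obtain t where t: "t \<in> C" "le t r" "E1 t i (B i)" "E1 t j (B j)" using common[of "{}" "{i, j}"] by auto
    then show "i = j" using forced_enumD(3)[OF E1 t(1,2)] ij by metis
  qed
  then show "|B ` J| =o |J|" by (rule ordIso_symmetric[OF card_of_ordIsoI[OF inj_on_imp_bij_betw]])
  have "f (A i) (B j) = f (A i') (B j')" if m: "i \<in> I" "j \<in> J" "i' \<in> I" "j' \<in> J" for i j i' j'
  proof -
    obtain t where t: "t \<in> C" "le t r" "E0 t i (A i)" "E0 t i' (A i')" "E1 t j (B j)" "E1 t j' (B j')"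
      using common[of "{i, i'}" "{j, j'}"] m by auto
    show ?thesis by (rule hom[OF t(1,2) _ _ _ _ t(3-6)]) (use m A B in auto)
  qed
  then show "\<forall>x\<in>A ` I. \<forall>y\<in>B ` J. \<forall>x'\<in>A ` I. \<forall>y'\<in>B ` J. f x y = f x' y'"
    by (intro ballI, elim imageE, hypsubst)
qed

text \<open>Both sides have the same size here, so one condition \<open>P i\<close> can decide the
  element with index i on each of them. A stem occurring for more than \<mu> many i then yields both
  sides from a single index set.\<close>

lemma frc_not_polarized_succ:
  assumes s: "holds (succ_cardinal_fm m1 \<mu>)"
    and np: "\<not> holds (polarized_fm m2 m1 m1 m1 \<mu>)" and p: "p \<in> C"
  shows "p \<tturnstile> Neg (polarized_fm (chk m2) (chk m1) (chk m1) (chk m1) (chk \<mu>))"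
proof (simp only: frc_Neg, intro ballI impI notI)
  fix q assume q: "q \<in> C" "le q p" "q \<tturnstile> polarized_fm (chk m2) (chk m1) (chk m1) (chk m1) (chk \<mu>)"
  from np obtain f where f: "\<forall>x\<in>elts m2. \<forall>y\<in>elts m1. f x y \<in> elts \<mu>" and
    no: "\<not> (\<exists>H0 H1. H0 \<subseteq> elts m2 \<and> |H0| =o |elts m1| \<and> H1 \<subseteq> elts m1 \<and> |H1| =o |elts m1| \<and>
          (\<forall>x\<in>H0. \<forall>y\<in>H1. \<forall>x'\<in>H0. \<forall>y'\<in>H1. f x y = f x' y'))"
    unfolding holds_polarized by blast
  have nh: False if "H0 \<subseteq> elts m2" "|H0| =o |elts m1|" "H1 \<subseteq> elts m1" "|H1| =o |elts m1|"
    "\<forall>x\<in>H0. \<forall>y\<in>H1. \<forall>x'\<in>H0. \<forall>y'\<in>H1. f x y = f x' y'" for H0 H1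
    by (rule notE[OF no], rule exI[of _ H0], rule exI[of _ H1]) (intro conjI; fact that)
  obtain r E0 E1 where r: "r \<in> C" and E0: "forced_enum m2 m1 r E0" and E1: "forced_enum m1 m1 r E1"
    and hm0: "\<And>s i i' j j' \<alpha> \<alpha>' \<beta> \<beta>'. s \<in> C \<Longrightarrow> le s r \<Longrightarrow>
      \<alpha> \<in> elts m2 \<Longrightarrow> \<alpha>' \<in> elts m2 \<Longrightarrow> \<beta> \<in> elts m1 \<Longrightarrow> \<beta>' \<in> elts m1 \<Longrightarrow>
      E0 s i \<alpha> \<Longrightarrow> E0 s i' \<alpha>' \<Longrightarrow> E1 s j \<beta> \<Longrightarrow> E1 s j' \<beta>' \<Longrightarrow> f \<alpha> \<beta> = f \<alpha>' \<beta>'"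
    by (rule frc_polarized_enums[OF q(1,3) f]) blast
  note D0 = forced_enumD[OF E0] and D1 = forced_enumD[OF E1]
  have "\<exists>s \<alpha> \<beta>. s \<in> C \<and> le s r \<and> \<alpha> \<in> elts m2 \<and> \<beta> \<in> elts m1 \<and> E0 s i \<alpha> \<and> E1 s i \<beta>" if i: "i \<in> elts m1" for i
  proof -
    obtain s \<alpha> where s: "s \<in> C" "le s r" "\<alpha> \<in> elts m2" "E0 s i \<alpha>"
      using dense_belowE[OF D0(2)[OF i] r le_refl[OF r]] by metis
    obtain t \<beta> where "t \<in> C" "le t s" "\<beta> \<in> elts m1" "E1 t i \<beta>"
      using dense_belowE[OF D1(2)[OF i] s(1,2)] by metis
    then show ?thesis using s D0(1) le_trans by blast
  qed
  then obtain P A B where P: "\<And>i. i \<in> elts m1 \<Longrightarrow> P i \<in> C \<and> le (P i) r \<and> A i \<in> elts m2 \<and> B i \<in> elts m1 \<and>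
      E0 (P i) i (A i) \<and> E1 (P i) i (B i)" by metis
  have "big (elts m1)" using succ_cardinal_less[OF s] not_ordLess_ordLeq by blast
  from pigeonhole_mu[OF this, of "\<lambda>i. stem (P i)"] obtain c where
    J: "big {i \<in> elts m1. stem (P i) = c}" using P stem_in by blast
  define J where "J = {i \<in> elts m1. stem (P i) = c}"
  have J1: "J \<subseteq> elts m1" unfolding J_def by blast
  have cJ: "|J| =o |elts m1|" using succ_cardinal_big_subset[OF s infinite_mu J1] J unfolding J_def by blast
  have common: "\<exists>t\<in>C. le t r \<and> (\<forall>i\<in>I. E0 t i (A i)) \<and> (\<forall>j\<in>I'. E1 t j (B j))"
    if I: "I \<subseteq> J" "finite I" "I' \<subseteq> J" "finite I'" for I I'
  proof (cases "I \<union> I' = {}")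
    case True
    then show ?thesis using r le_refl by blast
  next
    case False
    then obtain i where i: "i \<in> I \<union> I'" by blast
    have "P ` (I \<union> I') \<subseteq> C" "P ` (I \<union> I') \<noteq> {}" "finite (P ` (I \<union> I'))" "\<forall>p\<in>P ` (I \<union> I'). stem p = c"
      using I P False unfolding J_def by auto
    from centered_finite[OF this] obtain t where t: "t \<in> C" "\<forall>i\<in>I \<union> I'. le t (P i)" by blast
    have "le t (P i)" "le (P i) r" using t i I J1 P by blast+
    then have "le t r" by (rule le_trans)
    moreover have "E0 t i (A i)" if "i \<in> I" for i using that t I J1 P D0(1) by blast
    moreover have "E1 t i (B i)" if "i \<in> I'" for i using that t I J1 P D1(1) by blast
    ultimately show ?thesis using t(1) by blast
  qed
  have sub: "A ` J \<subseteq> elts m2" "B ` J \<subseteq> elts m1" using P J1 by blast+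
  note rect = homogeneous_rectangle[OF E0 E1 hm0 sub common]
  show False
    by (rule nh[OF sub(1) ordIso_transitive[OF rect(1) cJ] sub(2) ordIso_transitive[OF rect(2) cJ] rect(3)])
qed

text \<open>The decisions made along one descending sequence of conditions suffice for the small side of the
  rectangle, and whether two such sequences are compatible depends only on their stems.\<close>

lemma frc_not_polarized:
  assumes s: "holds (succ_cardinal_fm m1 \<mu>)"
    and np: "\<not> holds (polarized_fm m2 m1 \<nu> m1 \<mu>)" and p: "p \<in> C"
    and seq: "\<And>J (t :: 'v \<Rightarrow> nat \<Rightarrow> 'v). big J \<Longrightarrow> (\<And>j n. j \<in> J \<Longrightarrow> t j n \<in> elts \<mu>) \<Longrightarrow>
      \<exists>J'\<subseteq>J. big J' \<and> (\<forall>i\<in>J'. \<forall>j\<in>J'. t i = t j)"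
    and decide: "\<And>p E. p \<in> C \<Longrightarrow> (\<And>s t i. E s i \<Longrightarrow> le t s \<Longrightarrow> E t i) \<Longrightarrow> (\<And>i. i \<in> elts \<nu> \<Longrightarrow> dense_below p (\<lambda>s. E s i)) \<Longrightarrow>
      \<exists>q. (\<forall>n::nat. q n \<in> C \<and> le (q (Suc n)) (q n)) \<and> le (q 0) p \<and> |{i \<in> elts \<nu>. \<exists>n. E (q n) i}| =o |elts \<nu>|"
  shows "p \<tturnstile> Neg (polarized_fm (chk m2) (chk m1) (chk \<nu>) (chk m1) (chk \<mu>))"
proof (simp only: frc_Neg, intro ballI impI notI)
  fix q assume q: "q \<in> C" "le q p" "q \<tturnstile> polarized_fm (chk m2) (chk m1) (chk \<nu>) (chk m1) (chk \<mu>)"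
  from np obtain f where f: "\<forall>x\<in>elts m2. \<forall>y\<in>elts m1. f x y \<in> elts \<mu>" and
    no: "\<not> (\<exists>H0 H1. H0 \<subseteq> elts m2 \<and> |H0| =o |elts \<nu>| \<and> H1 \<subseteq> elts m1 \<and> |H1| =o |elts m1| \<and>
          (\<forall>x\<in>H0. \<forall>y\<in>H1. \<forall>x'\<in>H0. \<forall>y'\<in>H1. f x y = f x' y'))"
    unfolding holds_polarized by blast
  have nh: False if "H0 \<subseteq> elts m2" "|H0| =o |elts \<nu>|" "H1 \<subseteq> elts m1" "|H1| =o |elts m1|"
    "\<forall>x\<in>H0. \<forall>y\<in>H1. \<forall>x'\<in>H0. \<forall>y'\<in>H1. f x y = f x' y'" for H0 H1
    by (rule notE[OF no], rule exI[of _ H0], rule exI[of _ H1]) (intro conjI; fact that)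
  obtain r E0 E1 where r: "r \<in> C" and E0: "forced_enum m2 \<nu> r E0" and E1: "forced_enum m1 m1 r E1"
    and hm0: "\<And>s i i' j j' \<alpha> \<alpha>' \<beta> \<beta>'. s \<in> C \<Longrightarrow> le s r \<Longrightarrow>
      \<alpha> \<in> elts m2 \<Longrightarrow> \<alpha>' \<in> elts m2 \<Longrightarrow> \<beta> \<in> elts m1 \<Longrightarrow> \<beta>' \<in> elts m1 \<Longrightarrow>
      E0 s i \<alpha> \<Longrightarrow> E0 s i' \<alpha>' \<Longrightarrow> E1 s j \<beta> \<Longrightarrow> E1 s j' \<beta>' \<Longrightarrow> f \<alpha> \<beta> = f \<alpha>' \<beta>'"
    by (rule frc_polarized_enums[OF q(1,3) f]) blast
  note D0 = forced_enumD[OF E0] and D1 = forced_enumD[OF E1]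
  let ?E = "\<lambda>s i. \<exists>\<alpha>\<in>elts m2. E0 s i \<alpha>"
  have "\<exists>Q \<beta>. (\<forall>n::nat. Q n \<in> C \<and> le (Q (Suc n)) (Q n)) \<and> le (Q 0) r \<and> |{i \<in> elts \<nu>. \<exists>n. ?E (Q n) i}| =o |elts \<nu>|
     \<and> \<beta> \<in> elts m1 \<and> E1 (Q 0) j \<beta>" if j: "j \<in> elts m1" for j
  proof -
    obtain s \<beta> where s: "s \<in> C" "le s r" "\<beta> \<in> elts m1" "E1 s j \<beta>"
      using dense_belowE[OF D1(2)[OF j] r le_refl[OF r]] by metis
    have "\<exists>Q. (\<forall>n::nat. Q n \<in> C \<and> le (Q (Suc n)) (Q n)) \<and> le (Q 0) s \<and> |{i \<in> elts \<nu>. \<exists>n. ?E (Q n) i}| =o |elts \<nu>|"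
      by (rule decide[OF s(1)]) (use D0(1) dense_below_mono[OF D0(2) s(2)] in blast)+
    then obtain Q where Q: "\<forall>n::nat. Q n \<in> C \<and> le (Q (Suc n)) (Q n)" "le (Q 0) s"
      "|{i \<in> elts \<nu>. \<exists>n. ?E (Q n) i}| =o |elts \<nu>|" by blast
    have "le (Q 0) r" "E1 (Q 0) j \<beta>" using le_trans[OF Q(2) s(2)] D1(1)[OF s(4) Q(2)] by blast+
    then show ?thesis using Q s(3) by blast
  qed
  then have "\<forall>j. \<exists>Q \<beta>. j \<in> elts m1 \<longrightarrow> (\<forall>n::nat. Q n \<in> C \<and> le (Q (Suc n)) (Q n)) \<and> le (Q 0) r \<and> |{i \<in> elts \<nu>. \<exists>n. ?E (Q n) i}| =o |elts \<nu>|
     \<and> \<beta> \<in> elts m1 \<and> E1 (Q 0) j \<beta>" by blast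
  from choice[OF this] obtain Q where "\<forall>j. \<exists>\<beta>. j \<in> elts m1 \<longrightarrow> (\<forall>n::nat. Q j n \<in> C \<and> le (Q j (Suc n)) (Q j n)) \<and> le (Q j 0) r \<and> |{i \<in> elts \<nu>. \<exists>n. ?E (Q j n) i}| =o |elts \<nu>|
     \<and> \<beta> \<in> elts m1 \<and> E1 (Q j 0) j \<beta>" by blast
  from choice[OF this] obtain B where
    Q: "\<And>j n. j \<in> elts m1 \<Longrightarrow> Q j n \<in> C" "\<And>j n. j \<in> elts m1 \<Longrightarrow> le (Q j (Suc n)) (Q j n)" "\<And>j. j \<in> elts m1 \<Longrightarrow> le (Q j 0) r"
    and Qc: "\<And>j. j \<in> elts m1 \<Longrightarrow> |{i \<in> elts \<nu>. \<exists>n. ?E (Q j n) i}| =o |elts \<nu>|"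
    and B: "\<And>j. j \<in> elts m1 \<Longrightarrow> B j \<in> elts m1" "\<And>j. j \<in> elts m1 \<Longrightarrow> E1 (Q j 0) j (B j)" by blast
  have Qle: "le (Q j n) (Q j m)" if "j \<in> elts m1" "m \<le> n" for j m n
    using that(2) by (induction n rule: dec_induct) (use that(1) Q le_refl le_trans in blast)+
  have "big (elts m1)" using succ_cardinal_less[OF s] not_ordLess_ordLeq by blast
  from seq[OF this, of "\<lambda>j n. stem (Q j n)"] obtain J where J: "J \<subseteq> elts m1" "big J"
    "\<forall>i\<in>J. \<forall>j\<in>J. (\<lambda>n. stem (Q i n)) = (\<lambda>n. stem (Q j n))" using Q(1) stem_in by blast
  then have stm: "stem (Q i n) = stem (Q j n)" if "i \<in> J" "j \<in> J" for i j n using that by meson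
  have cJ: "|J| =o |elts m1|" using succ_cardinal_big_subset[OF s infinite_mu J(1,2)] .
  obtain j0 where j0: "j0 \<in> J" using big_nonempty[OF J(2)] by blast
  \<comment> \<open>The small side is read off from the one sequence \<open>Q j0\<close>; the other
    sequences only have to be compatible with it level by level.\<close>
  define I where "I = {i \<in> elts \<nu>. \<exists>n. ?E (Q j0 n) i}"
  have I: "I \<subseteq> elts \<nu>" "|I| =o |elts \<nu>|" using Qc j0 J(1) unfolding I_def by blast+
  have "\<forall>i\<in>I. \<exists>n \<alpha>. \<alpha> \<in> elts m2 \<and> E0 (Q j0 n) i \<alpha>" unfolding I_def by blast
  then obtain N A where A: "\<And>i. i \<in> I \<Longrightarrow> A i \<in> elts m2 \<and> E0 (Q j0 (N i)) i (A i)" by metis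
  have common: "\<exists>t\<in>C. le t r \<and> (\<forall>i\<in>I'. E0 t i (A i)) \<and> (\<forall>j\<in>J'. E1 t j (B j))"
    if "I' \<subseteq> I" "finite I'" "J' \<subseteq> J" "finite J'" for I' J'
  proof -
    \<comment> \<open>A level beyond all decisions that are used, the 0 covering an empty
      \<open>I'\<close>. At this level the conditions of the finitely many sequences share a stem,
      and a common extension lies below all their earlier entries.\<close>
    define n where "n = Max (insert 0 (N ` I'))"
    have n: "N i \<le> n" if "i \<in> I'" for i unfolding n_def using that \<open>finite I'\<close> by auto
    let ?K = "insert j0 J'"
    have K: "?K \<subseteq> J" using that j0 by blast
    have "\<forall>p\<in>(\<lambda>j. Q j n) ` ?K. stem p = stem (Q j0 n)" using stm K j0 by blast
    moreover have "(\<lambda>j. Q j n) ` ?K \<subseteq> C" using Q(1) J(1) K by blast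
    ultimately have "\<exists>t\<in>C. stem t = stem (Q j0 n) \<and> (\<forall>p\<in>(\<lambda>j. Q j n) ` ?K. le t p)"
      by (intro centered_finite) (use \<open>finite J'\<close> in auto)
    then obtain t where t: "t \<in> C" "\<forall>j\<in>?K. le t (Q j n)" by blast
    have le0: "le t (Q j m)" if j: "j \<in> ?K" "m \<le> n" for j m
      using le_trans[OF bspec[OF t(2) j(1)] Qle[OF _ j(2)]] j(1) K J(1) by blast
    have "le t r" using le_trans[OF le0[of j0 0] Q(3)] j0 J(1) by blast
    moreover have "E0 t i (A i)" if "i \<in> I'" for i
      using D0(1)[OF _ le0[of j0 "N i"]] A n that \<open>I' \<subseteq> I\<close> by blast
    moreover have "E1 t j (B j)" if "j \<in> J'" for j
      using D1(1)[OF B(2) le0[of j 0]] that K J(1) by blast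
    ultimately show ?thesis using t(1) by blast
  qed
  have sub: "A ` I \<subseteq> elts m2" "B ` J \<subseteq> elts m1" using A B(1) J(1) by blast+
  note rect = homogeneous_rectangle[OF E0 E1 hm0 sub common]
  show False
    by (rule nh[OF sub(1) ordIso_transitive[OF rect(1) I(2)] sub(2) ordIso_transitive[OF rect(2) cJ] rect(3)])
qed

lemma decide_countable:
  assumes \<nu>: "countable (elts \<nu>)" and p: "p \<in> C" and mono: "\<And>s t i. E s i \<Longrightarrow> le t s \<Longrightarrow> E t i"
    and dense: "\<And>i. i \<in> elts \<nu> \<Longrightarrow> dense_below p (\<lambda>s. E s i)"
  shows "\<exists>q. (\<forall>n::nat. q n \<in> C \<and> le (q (Suc n)) (q n)) \<and> le (q 0) p \<and> |{i \<in> elts \<nu>. \<exists>n. E (q n) i}| =o |elts \<nu>|"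
proof (cases "elts \<nu> = {}")
  case True
  then show ?thesis using p le_refl by (intro exI[of _ "\<lambda>_. p"]) (auto simp: card_of_refl)
next
  case False
  \<comment> \<open>Lists the nonempty set, with repetitions if it is finite.\<close>
  define en where "en = from_nat_into (elts \<nu>)"
  have en: "range en = elts \<nu>" unfolding en_def using False \<nu> by (rule range_from_nat_into)
  have step: "\<And>s n. s \<in> C \<and> le s p \<Longrightarrow> \<exists>r. (r \<in> C \<and> le r p) \<and> le r s \<and> E r (en n)"
  proof -
    fix s n assume s: "s \<in> C \<and> le s p"
    have "en n \<in> elts \<nu>" using en by blast
    from dense_belowE[OF dense[OF this]] s obtain r where "r \<in> C" "le r s" "le r p" "E r (en n)" by metis
    then show "\<exists>r. (r \<in> C \<and> le r p) \<and> le r s \<and> E r (en n)" by blast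
  qed
  have r0: "\<exists>r. r \<in> C \<and> le r p" using p le_refl by blast
  have "\<exists>q. \<forall>n::nat. (q n \<in> C \<and> le (q n) p) \<and> le (q (Suc n)) (q n) \<and> E (q (Suc n)) (en n)"
    by (rule dependent_nat_choice[of "\<lambda>_ r. r \<in> C \<and> le r p" "\<lambda>n s r. le r s \<and> E r (en n)"]) (fact r0, fact step)
  then obtain q where q: "\<And>n::nat. q n \<in> C \<and> le (q n) p" "\<And>n. le (q (Suc n)) (q n) \<and> E (q (Suc n)) (en n)"
    by blast
  have "{i \<in> elts \<nu>. \<exists>n. E (q n) i} = elts \<nu>"
  proof -
    have "\<exists>n. E (q n) i" if i: "i \<in> elts \<nu>" for i
    proof -
      obtain n where "i = en n" using en i by blast
      then show ?thesis using q(2)[of n] by blast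
    qed
    then show ?thesis by blast
  qed
  then have "|{i \<in> elts \<nu>. \<exists>n. E (q n) i}| =o |elts \<nu>|" by (simp add: card_of_refl)
  moreover have "\<forall>n. q n \<in> C \<and> le (q (Suc n)) (q n)" "le (q 0) p" using q by simp_all
  ultimately show ?thesis by (intro exI[of _ q] conjI)
qed

end

section \<open>Prikry forcing\<close>

subsection \<open>Regular cardinals\<close>

lemma regular_cardinal_sup:
  "regular_cardinal k \<Longrightarrow> a \<in> elts k \<Longrightarrow> F ` elts a \<subseteq> elts k \<Longrightarrow> \<exists>b\<in>elts k. \<forall>x\<in>elts a. F x \<in> elts b"
  unfolding regular_cardinal_def by (elim conjE) simp

lemma regular_bounded:
  assumes "regular_cardinal k" "I \<subseteq> elts k" "|I| <o |elts k|"
  shows "\<exists>b\<in>elts k. \<forall>i\<in>I. i \<in> elts b"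
proof (cases "I = {}")
  case True
  have "elts k \<noteq> {}" using assms(1) unfolding regular_cardinal_def by auto
  then show ?thesis using True by auto
next
  case False
  have "ordinal k" using assms(1) unfolding regular_cardinal_def holds_cardinal by blast
  then obtain a where a: "a \<in> elts k" "|I| \<le>o |elts a|" using ordLess_ordinal_elt assms(3) by blast
  then obtain g where g: "g ` elts a = I" using card_of_ordLeq2[OF False] by metis
  then obtain b where "b \<in> elts k" "\<forall>x\<in>elts a. g x \<in> elts b"
    using regular_cardinal_sup[OF assms(1) a(1), of g] assms(2) by auto
  then show ?thesis using g by blast
qed

text \<open>Otherwise every fibre of N is bounded in k, by \<open>b n\<close> say. As k is
  uncountable, the natural numbers can be indexed by an element of k, and regularity gives a bound c
  for all \<open>b n\<close>. But c lies in a fibre itself, so c is an element of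
  \<open>b (N c)\<close>, which is an element of c.\<close>

lemma regular_pigeonhole_nat:
  fixes k :: "'v::zfc"
  assumes k: "regular_cardinal k" "uncountable (elts k)"
  shows "\<exists>n::nat. |{i \<in> elts k. N i = n}| =o |elts k|"
proof (rule ccontr)
  assume no: "\<not> ?thesis"
  have ok: "ordinal k" using k(1) unfolding regular_cardinal_def holds_cardinal by blast
  have ex: "\<exists>b\<in>elts k. \<forall>i\<in>{i \<in> elts k. N i = n}. i \<in> elts b" for n
  proof (rule regular_bounded[OF k(1)])
    have "|{i \<in> elts k. N i = n}| \<le>o |elts k|" by (rule card_of_mono1) auto
    then show "|{i \<in> elts k. N i = n}| <o |elts k|" using no ordLeq_iff_ordLess_or_ordIso by blast
  qed auto
  have "\<forall>n. \<exists>b. b \<in> elts k \<and> (\<forall>i\<in>elts k. N i = n \<longrightarrow> i \<in> elts b)"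
  proof
    fix n show "\<exists>b. b \<in> elts k \<and> (\<forall>i\<in>elts k. N i = n \<longrightarrow> i \<in> elts b)" using ex[of n] by auto
  qed
  from choice[OF this] obtain b where b: "\<And>n. b n \<in> elts k" "\<And>i. i \<in> elts k \<Longrightarrow> i \<in> elts (b (N i))" by auto
  have "\<not> |elts k| \<le>o |UNIV :: nat set|"
    using k(2) unfolding countable_def card_of_ordLeq[symmetric] by auto
  then have "|UNIV :: nat set| <o |elts k|" by (simp add: card_of_not_ordLeq)
  then obtain a where a: "a \<in> elts k" "|UNIV :: nat set| \<le>o |elts a|" using ordLess_ordinal_elt[OF ok] by blast
  then obtain g :: "'v \<Rightarrow> nat" where g: "g ` elts a = UNIV" using card_of_ordLeq2[of "UNIV :: nat set" "elts a"] by auto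
  have "(\<lambda>x. b (g x)) ` elts a \<subseteq> elts k" using b(1) by blast
  then obtain c where c: "c \<in> elts k" "\<forall>x\<in>elts a. b (g x) \<in> elts c"
    using regular_cardinal_sup[OF k(1) a(1)] by metis
  obtain x where x: "x \<in> elts a" "g x = N c" using g by (metis UNIV_I imageE)
  then have "b (N c) \<in> elts c" using c(2) by metis
  then have "c \<in> elts c" using ordinal_trans[OF ordinal_elt[OF ok c(1)]] b(2)[OF c(1)] by blast
  then show False by simp
qed

lemma card_of_lists_length:
  assumes "infinite A"
  shows "|{xs. set xs \<subseteq> A \<and> length xs = n}| \<le>o |A|"
proof (induction n)
  case 0
  have "{xs. set xs \<subseteq> A \<and> length xs = 0} = {[]}" by auto
  moreover have "finite {[]}" by simp
  ultimately show ?case using assms by (metis card_of_Well_order card_of_ordLeq_finite ordLeq_total)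
next
  case (Suc n)
  have "{xs. set xs \<subseteq> A \<and> length xs = Suc n} \<subseteq> (\<lambda>(x, xs). x # xs) ` (A \<times> {xs. set xs \<subseteq> A \<and> length xs = n})"
    by (auto simp: length_Suc_conv image_iff)
  then have "|{xs. set xs \<subseteq> A \<and> length xs = Suc n}| \<le>o |A \<times> {xs. set xs \<subseteq> A \<and> length xs = n}|"
    by (meson card_of_image card_of_mono1 ordLeq_transitive)
  moreover have "|A \<times> {xs. set xs \<subseteq> A \<and> length xs = n}| \<le>o |A|"
    by (rule card_of_Times_ordLeq_infinite_Field)
      (use assms Suc in \<open>auto simp: Field_card_of card_of_card_order_on card_of_mono1\<close>)
  ultimately show ?case using ordLeq_transitive by blast
qed

text \<open>Bounds the number of stems: finite subsets are ranges of lists, and there are countably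
  many lengths.\<close>

lemma card_of_finite_subsets:
  assumes "infinite A"
  shows "|{s. s \<subseteq> A \<and> finite s}| \<le>o |A|"
proof -
  have "{s. s \<subseteq> A \<and> finite s} \<subseteq> set ` (\<Union>n\<in>UNIV. {xs. set xs \<subseteq> A \<and> length xs = n})"
  proof
    fix s assume "s \<in> {s. s \<subseteq> A \<and> finite s}"
    then obtain xs where "set xs = s" "set xs \<subseteq> A" using finite_list by blast
    then show "s \<in> set ` (\<Union>n\<in>UNIV. {xs. set xs \<subseteq> A \<and> length xs = n})" by auto
  qed
  then have "|{s. s \<subseteq> A \<and> finite s}| \<le>o |\<Union>n\<in>(UNIV :: nat set). {xs. set xs \<subseteq> A \<and> length xs = n}|"
    by (meson card_of_image card_of_mono1 ordLeq_transitive)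
  moreover have "|\<Union>n\<in>(UNIV :: nat set). {xs. set xs \<subseteq> A \<and> length xs = n}| \<le>o |A|"
    by (rule card_of_UNION_ordLeq_infinite[OF assms])
      (use assms card_of_lists_length in \<open>auto simp flip: infinite_iff_card_of_nat\<close>)
  ultimately show ?thesis using ordLeq_transitive by blast
qed

lemma finite_max_elt:
  assumes "ordinal k" "finite s" "s \<noteq> {}" "s \<subseteq> elts k"
  shows "\<exists>m\<in>s. \<forall>y\<in>s. y = m \<or> y \<in> elts m"
  using assms(2-4)
proof (induction s rule: finite_ne_induct)
  case (insert x s)
  then obtain m where m: "m \<in> s" "\<forall>y\<in>s. y = m \<or> y \<in> elts m" by blast
  then have mk: "m \<in> elts k" "x \<in> elts k" using insert.prems by auto
  from ordinal_elts_linear[OF assms(1) mk] consider "m \<in> elts x" | "x = m \<or> x \<in> elts m" by blast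
  then show ?case
  proof cases
    case 1
    have "y \<in> elts x" if "y \<in> s" for y
    proof -
      have "y = m \<or> y \<in> elts m" using m(2) that by blast
      then show ?thesis using 1 ordinal_trans[OF ordinal_elt[OF assms(1) mk(2)] 1] by auto
    qed
    then show ?thesis by blast
  next
    case 2
    then show ?thesis using m by blast
  qed
qed auto

subsection \<open>Normal ultrafilters\<close>

locale prikry_forcing =
  fixes \<mu> U :: "'v::zfc"
  assumes cardinal_mu: "holds (cardinal_fm \<mu>)" and uncountable_mu: "uncountable (elts \<mu>)"
    and normal: "normal_ultrafilter \<mu> U"
begin

definition measure_one :: "'v set \<Rightarrow> bool" where
  "measure_one A \<longleftrightarrow> A \<subseteq> elts \<mu> \<and> set_of A \<in> elts U"

lemma ord_mu: "ordinal \<mu>" using cardinal_mu by (simp add: holds_cardinal)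

lemma inf_mu: "infinite (elts \<mu>)" using uncountable_mu countable_finite by blast

lemma small_sub: "A \<subseteq> elts \<mu> \<Longrightarrow> small A" using small_subset small_elts by blast

lemma uf: "ultrafilter_over \<mu> U" using normal by (simp add: normal_ultrafilter_def)

lemma measure_one_subset: "measure_one A \<Longrightarrow> A \<subseteq> elts \<mu>"
  by (simp add: measure_one_def)

lemma measure_one_mono: "measure_one A \<Longrightarrow> A \<subseteq> B \<Longrightarrow> B \<subseteq> elts \<mu> \<Longrightarrow> measure_one B"
  using uf unfolding measure_one_def ultrafilter_over_def by (metis elts_set_of_small small_sub)

lemma measure_one_all: "measure_one (elts \<mu>)"
  using uf unfolding measure_one_def ultrafilter_over_def by simp

lemma measure_one_Int: "measure_one A \<Longrightarrow> measure_one B \<Longrightarrow> measure_one (A \<inter> B)"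
  using uf unfolding measure_one_def ultrafilter_over_def
  by (metis elts_set_of_small small_sub le_infI1)

lemma measure_one_compl:
  assumes "A \<subseteq> elts \<mu>" shows "measure_one (elts \<mu> - A) \<longleftrightarrow> \<not> measure_one A"
proof -
  have "elts (set_of (elts \<mu> - A)) = elts \<mu> - A" "elts (set_of A) = A"
    using assms by (simp_all add: small_sub)
  then show ?thesis using uf assms unfolding measure_one_def ultrafilter_over_def by (metis Diff_subset)
qed

lemma measure_one_nonempty: "measure_one A \<Longrightarrow> A \<noteq> {}"
  using measure_one_compl[of "{}"] measure_one_all by auto

lemma not_measure_one_singleton: "\<not> measure_one {x}"
  using normal unfolding measure_one_def normal_ultrafilter_def nonprincipal_def by auto

lemma measure_one_elt_Inter:
  assumes "x \<in> elts \<mu>" "\<And>y. y \<in> elts x \<Longrightarrow> measure_one (A y)"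
  shows "measure_one {z \<in> elts \<mu>. \<forall>y\<in>elts x. z \<in> A y}"
proof -
  have e: "elts (set_of (A y)) = A y" if "y \<in> elts x" for y
    using assms(2)[OF that] by (simp add: measure_one_def small_sub)
  have cf: "complete_filter \<mu> U" using normal by (simp add: normal_ultrafilter_def)
  have "set_of {z \<in> elts \<mu>. \<forall>y\<in>elts x. z \<in> elts (set_of (A y))} \<in> elts U"
  proof (rule cf[unfolded complete_filter_def, rule_format, OF assms(1), of "\<lambda>y. set_of (A y)"])
    show "set_of (A y) \<in> elts U" if "y \<in> elts x" for y using assms(2)[OF that] by (simp add: measure_one_def)
  qed
  moreover have "{z \<in> elts \<mu>. \<forall>y\<in>elts x. z \<in> elts (set_of (A y))} = {z \<in> elts \<mu>. \<forall>y\<in>elts x. z \<in> A y}"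
    using e by auto
  ultimately show ?thesis unfolding measure_one_def by auto
qed

lemma measure_one_diagonal:
  assumes "\<And>x. x \<in> elts \<mu> \<Longrightarrow> measure_one (A x)"
  shows "measure_one {z \<in> elts \<mu>. \<forall>x\<in>elts z. z \<in> A x}"
proof -
  have e: "elts (set_of (A y)) = A y" if "y \<in> elts \<mu>" for y
    using assms[OF that] by (simp add: measure_one_def small_sub)
  have df: "diagonally_closed \<mu> U" using normal by (simp add: normal_ultrafilter_def)
  have "set_of {z \<in> elts \<mu>. \<forall>x\<in>elts z. z \<in> elts (set_of (A x))} \<in> elts U"
  proof (rule df[unfolded diagonally_closed_def, rule_format, of "\<lambda>y. set_of (A y)"])
    show "set_of (A y) \<in> elts U" if "y \<in> elts \<mu>" for y using assms[OF that] by (simp add: measure_one_def)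
  qed
  moreover have "{z \<in> elts \<mu>. \<forall>x\<in>elts z. z \<in> elts (set_of (A x))} = {z \<in> elts \<mu>. \<forall>x\<in>elts z. z \<in> A x}"
    using e ordinal_trans[OF ord_mu] by auto
  ultimately show ?thesis unfolding measure_one_def by auto
qed

lemma measure_one_Inter:
  assumes I: "|I| <o |elts \<mu>|" and A: "\<And>i. i \<in> I \<Longrightarrow> measure_one (A i)"
  shows "measure_one {z \<in> elts \<mu>. \<forall>i\<in>I. z \<in> A i}"
proof -
  obtain x where x: "x \<in> elts \<mu>" "|I| \<le>o |elts x|" using ordLess_ordinal_elt[OF ord_mu I] by blast
  then obtain g where g: "inj_on g I" "g ` I \<subseteq> elts x" using card_of_ordLeq[of I "elts x"] by blast
  \<comment> \<open>Indices outside the image of g carry the whole of \<mu>, which does not affect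
    the intersection.\<close>
  define A' where "A' y = (if y \<in> g ` I then A (inv_into I g y) else elts \<mu>)" for y
  have "measure_one {z \<in> elts \<mu>. \<forall>y\<in>elts x. z \<in> A' y}"
    by (rule measure_one_elt_Inter[OF x(1)]) (auto simp: A'_def measure_one_all g A inv_into_into)
  moreover have "A' (g i) = A i" if "i \<in> I" for i using that g by (simp add: A'_def)
  ultimately show ?thesis
    by (elim measure_one_mono) (use g(2) in blast)+
qed

lemma nat_less_mu: "|UNIV :: nat set| <o |elts \<mu>|"
proof -
  have "\<not> |elts \<mu>| \<le>o |UNIV :: nat set|"
    using uncountable_mu unfolding countable_def card_of_ordLeq[symmetric] by auto
  then show ?thesis by (simp add: card_of_not_ordLeq)
qed

lemma measure_one_Inter_nat:
  "(\<And>n::nat. measure_one (A n)) \<Longrightarrow> measure_one {z \<in> elts \<mu>. \<forall>n. z \<in> A n}"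
  using measure_one_Inter[OF nat_less_mu, of A] by simp

lemma finite_less_mu: "finite s \<Longrightarrow> |s| <o |elts \<mu>|"
  using inf_mu card_of_ordLeq_finite card_of_not_ordLeq by metis

text \<open>Nonprincipality removes single points, and completeness removes all elements of y
  together. What remains after removing y as well lies above y by linearity.\<close>

lemma measure_one_above:
  assumes "y \<in> elts \<mu>" shows "measure_one {z \<in> elts \<mu>. y \<in> elts z}"
proof -
  have c: "measure_one (elts \<mu> - {x})" if "x \<in> elts \<mu>" for x
    using measure_one_compl[of "{x}"] not_measure_one_singleton that by auto
  have "measure_one {z \<in> elts \<mu>. \<forall>x\<in>elts y. z \<in> elts \<mu> - {x}}"
    by (rule measure_one_elt_Inter[OF assms]) (use c ordinal_trans[OF ord_mu assms] in auto)
  from measure_one_Int[OF this c[OF assms]] show ?thesis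
  proof (rule measure_one_mono)
    show "{z \<in> elts \<mu>. \<forall>x\<in>elts y. z \<in> elts \<mu> - {x}} \<inter> (elts \<mu> - {y}) \<subseteq> {z \<in> elts \<mu>. y \<in> elts z}"
      using ordinal_elts_linear[OF ord_mu _ assms] by blast
  qed auto
qed

lemma measure_one_above_finite:
  assumes "finite s" "s \<subseteq> elts \<mu>" shows "measure_one {z \<in> elts \<mu>. s \<subseteq> elts z}"
proof -
  have "measure_one {z \<in> elts \<mu>. \<forall>y\<in>s. z \<in> {z \<in> elts \<mu>. y \<in> elts z}}"
    by (rule measure_one_Inter[OF finite_less_mu[OF assms(1)]]) (use assms measure_one_above in blast)
  then show ?thesis by (rule measure_one_mono) auto
qed

text \<open>Diagonal intersection over finite subsets instead of points, by induction on the length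
  of a list enumerating the subset. Fixing the first entry leaves a shorter list with a modified
  family, the ordinary diagonal intersection takes care of that entry, and countable completeness
  joins all lengths.\<close>

lemma measure_one_diagonal_finite:
  assumes X: "\<And>s. finite s \<Longrightarrow> s \<subseteq> elts \<mu> \<Longrightarrow> measure_one (X s)"
  shows "measure_one {z \<in> elts \<mu>. \<forall>s. finite s \<longrightarrow> s \<subseteq> elts z \<longrightarrow> z \<in> X s}"
proof -
  have *: "measure_one {z \<in> elts \<mu>. \<forall>l. length l = n \<longrightarrow> set l \<subseteq> elts z \<longrightarrow> z \<in> Y (set l)}"
    if "\<And>s. finite s \<Longrightarrow> s \<subseteq> elts \<mu> \<Longrightarrow> measure_one (Y s)" for n Y
    using that
  proof (induction n arbitrary: Y)
    case 0
    have "measure_one (Y {})" using 0 by simp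
    then show ?case by (rule measure_one_mono) (use measure_one_subset[OF \<open>measure_one (Y {})\<close>] in auto)
  next
    case (Suc n)
    define A where "A x = {z \<in> elts \<mu>. \<forall>l. length l = n \<longrightarrow> set l \<subseteq> elts z \<longrightarrow> z \<in> Y (insert x (set l))}" for x
    have "measure_one (A x)" if "x \<in> elts \<mu>" for x
      unfolding A_def by (rule Suc.IH[of "\<lambda>s. Y (insert x s)"]) (use Suc.prems that in simp)
    from measure_one_diagonal[of A, OF this] show ?case
    proof (rule measure_one_mono)
      show "{z \<in> elts \<mu>. \<forall>x\<in>elts z. z \<in> A x} \<subseteq>
        {z \<in> elts \<mu>. \<forall>l. length l = Suc n \<longrightarrow> set l \<subseteq> elts z \<longrightarrow> z \<in> Y (set l)}"
        by (auto simp: A_def length_Suc_conv)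
    qed auto
  qed
  have "measure_one {z \<in> elts \<mu>. \<forall>n. z \<in> {z \<in> elts \<mu>. \<forall>l. length l = n \<longrightarrow> set l \<subseteq> elts z \<longrightarrow> z \<in> X (set l)}}"
    by (rule measure_one_Inter_nat) (rule *[OF X])
  then show ?thesis
  proof (rule measure_one_mono)
    show "{z \<in> elts \<mu>. \<forall>n. z \<in> {z \<in> elts \<mu>. \<forall>l. length l = n \<longrightarrow> set l \<subseteq> elts z \<longrightarrow> z \<in> X (set l)}}
      \<subseteq> {z \<in> elts \<mu>. \<forall>s. finite s \<longrightarrow> s \<subseteq> elts z \<longrightarrow> z \<in> X s}"
    proof clarify
      fix z s assume z: "\<forall>n. z \<in> {z \<in> elts \<mu>. \<forall>l. length l = n \<longrightarrow> set l \<subseteq> elts z \<longrightarrow> z \<in> X (set l)}"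
        and s: "finite s" "s \<subseteq> elts z"
      obtain l where "set l = s" using finite_list[OF s(1)] by blast
      then show "z \<in> X s" using z s by auto
    qed
  qed auto
qed

text \<open>A set of bounded sequences of size greater than \<open>\<mu>\<close> would make the ultrafilter principal; this is
  how the inaccessibility of \<open>\<mu>\<close> enters.\<close>

lemma sequence_pigeonhole:
  fixes J :: "'v set" and t :: "'v \<Rightarrow> nat \<Rightarrow> 'v"
  assumes J: "\<not> |J| \<le>o |elts \<mu>|" and t: "\<And>j n. j \<in> J \<Longrightarrow> t j n \<in> elts \<mu>"
  shows "\<exists>J'\<subseteq>J. \<not> |J'| \<le>o |elts \<mu>| \<and> (\<forall>i\<in>J'. \<forall>j\<in>J'. t i = t j)"
proof -
  \<comment> \<open>A sequence is bounded because almost every point of \<mu> lies above any given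
    term, hence above all countably many of them.\<close>
  have "\<exists>x. x \<in> elts \<mu> \<and> (\<forall>n. t j n \<in> elts x)" if j: "j \<in> J" for j
  proof -
    have "measure_one {z \<in> elts \<mu>. \<forall>n. z \<in> {z \<in> elts \<mu>. t j n \<in> elts z}}"
      by (rule measure_one_Inter_nat) (use measure_one_above t j in blast)
    from measure_one_nonempty[OF this] show ?thesis by blast
  qed
  then obtain b where b: "\<And>j. j \<in> J \<Longrightarrow> b j \<in> elts \<mu> \<and> (\<forall>n. t j n \<in> elts (b j))" by metis
  obtain x where x: "x \<in> elts \<mu>" "\<not> |{j \<in> J. b j = x}| \<le>o |elts \<mu>|"
    using pigeonhole_big[OF inf_mu J, of b "elts \<mu>"] b by (auto simp: card_of_mono1)
  define J1 where "J1 = {j \<in> J. b j = x}"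
  have tx: "t j n \<in> elts x" if "j \<in> J1" for j n using that b unfolding J1_def by blast
  have "|t ` J1| \<le>o |elts \<mu>|"
  proof (rule ccontr)
    assume "\<not> ?thesis"
    then have "|elts \<mu>| \<le>o |t ` J1|" by (simp add: card_of_not_ordLeq ordLess_imp_ordLeq)
    then obtain g where g: "inj_on g (elts \<mu>)" "g ` elts \<mu> \<subseteq> t ` J1" using card_of_ordLeq[of "elts \<mu>" "t ` J1"] by blast
    \<comment> \<open>The coordinate n takes its values in x, an element of \<mu>; by completeness
      the fibres over these values cannot all be null.\<close>
    have "\<exists>y. measure_one {\<xi> \<in> elts \<mu>. g \<xi> n = y}" for n
    proof (rule ccontr)
      assume no: "\<not> ?thesis"
      have "measure_one {z \<in> elts \<mu>. \<forall>y\<in>elts x. z \<in> elts \<mu> - {\<xi> \<in> elts \<mu>. g \<xi> n = y}}"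
        by (rule measure_one_elt_Inter[OF x(1)]) (use no in \<open>simp add: measure_one_compl\<close>)
      from measure_one_nonempty[OF this] obtain z where z: "z \<in> elts \<mu>" "g z n \<notin> elts x" by blast
      then obtain j where "j \<in> J1" "g z = t j" using g(2) by blast
      then show False using z(2) tx by simp
    qed
    then obtain y where y: "\<And>n. measure_one {\<xi> \<in> elts \<mu>. g \<xi> n = y n}" by metis
    have m: "measure_one {z \<in> elts \<mu>. \<forall>n. z \<in> {\<xi> \<in> elts \<mu>. g \<xi> n = y n}}" by (rule measure_one_Inter_nat[OF y])
    then obtain z where z: "z \<in> elts \<mu>" "\<forall>n. g z n = y n" using measure_one_nonempty by blast
    \<comment> \<open>On this set all coordinates are constant at once, so injectivity of g leaves
      only one point.\<close>
    have "{z \<in> elts \<mu>. \<forall>n. z \<in> {\<xi> \<in> elts \<mu>. g \<xi> n = y n}} \<subseteq> {z}"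
    proof clarify
      fix w assume w: "w \<in> elts \<mu>" "\<forall>n. w \<in> {\<xi> \<in> elts \<mu>. g \<xi> n = y n}"
      then have "g w = g z" using z(2) by auto
      then show "w = z" using g(1) w(1) z(1) by (meson inj_onD)
    qed
    then have "measure_one {z}" using measure_one_mono[OF m] z(1) by blast
    then show False using not_measure_one_singleton by blast
  qed
  from pigeonhole_big[OF inf_mu x(2)[folded J1_def] subset_refl this] obtain s where
    "\<not> |{j \<in> J1. t j = s}| \<le>o |elts \<mu>|" by blast
  then show ?thesis by (intro exI[of _ "{j \<in> J1. t j = s}"]) (auto simp: J1_def)
qed

subsection \<open>Conditions\<close>

abbreviation C :: "'v set" where "C \<equiv> prikry_conditions \<mu> U"

abbreviation one :: 'v where "one \<equiv> vpair (set_of {}) \<mu>"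

definition cond :: "'v set \<Rightarrow> 'v set \<Rightarrow> 'v" where
  "cond s A = vpair (set_of s) (set_of A)"

definition below :: "'v set \<Rightarrow> 'v set" where
  "below s = {x. \<exists>y\<in>s. x = y \<or> x \<in> elts y}"

lemma C_iff: "p \<in> C \<longleftrightarrow> (\<exists>s A. p = cond s A \<and> finite s \<and> s \<subseteq> elts \<mu> \<and> measure_one A)"
proof
  assume "p \<in> C"
  then obtain a X where "p = vpair a X" "elts a \<subseteq> elts \<mu>" "finite (elts a)" "X \<in> elts U"
    unfolding prikry_conditions_def by blast
  moreover have "elts X \<subseteq> elts \<mu>" using uf \<open>X \<in> elts U\<close> unfolding ultrafilter_over_def by blast
  ultimately show "\<exists>s A. p = cond s A \<and> finite s \<and> s \<subseteq> elts \<mu> \<and> measure_one A"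
    by (intro exI[of _ "elts a"] exI[of _ "elts X"]) (simp add: cond_def measure_one_def)
next
  assume "\<exists>s A. p = cond s A \<and> finite s \<and> s \<subseteq> elts \<mu> \<and> measure_one A"
  then show "p \<in> C" unfolding prikry_conditions_def cond_def measure_one_def using small_sub by fastforce
qed

lemma condI: "finite s \<Longrightarrow> s \<subseteq> elts \<mu> \<Longrightarrow> measure_one A \<Longrightarrow> cond s A \<in> C"
  using C_iff by blast

lemma le_cond:
  assumes "s \<subseteq> elts \<mu>" "t \<subseteq> elts \<mu>" "A \<subseteq> elts \<mu>" "B \<subseteq> elts \<mu>"
  shows "prikry_le (cond s A) (cond t B) \<longleftrightarrow> s \<inter> below t = t \<and> (s - t) \<union> A \<subseteq> B"
  unfolding prikry_le_def cond_def below_def using assms by (auto simp: small_sub)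

lemma below_self: "s \<inter> below s = s" by (auto simp: below_def)

lemma prikry_trans: "prikry_le (p :: 'v) q \<Longrightarrow> prikry_le q r \<Longrightarrow> prikry_le p r"
proof -
  assume "prikry_le p q" "prikry_le q r"
  then obtain a X b Y c Z :: 'v where e: "p = vpair a X" "q = vpair b Y" "r = vpair c Z"
    and 1: "elts a \<inter> below (elts b) = elts b" "(elts a - elts b) \<union> elts X \<subseteq> elts Y"
    and 2: "elts b \<inter> below (elts c) = elts c" "(elts b - elts c) \<union> elts Y \<subseteq> elts Z"
    unfolding prikry_le_def below_def by auto
  have "elts a \<inter> below (elts c) = elts c"
  proof
    have "below (elts c) \<subseteq> below (elts b)" using 2(1) by (auto simp: below_def)
    then show "elts a \<inter> below (elts c) \<subseteq> elts c" using 1 2 by blast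
    show "elts c \<subseteq> elts a \<inter> below (elts c)" using 1 2 by blast
  qed
  moreover have "(elts a - elts c) \<union> elts X \<subseteq> elts Z" using 1 2 by blast
  ultimately show ?thesis unfolding prikry_le_def e below_def by blast
qed

lemma small_prikry: "small C"
proof -
  obtain z where z: "elts z = {y. elts y \<subseteq> elts \<mu>}" using small_Pow by blast
  have "C \<subseteq> {vpair a X | a X. a \<in> elts z \<and> X \<in> elts U}" unfolding prikry_conditions_def z by blast
  then show ?thesis using small_subset small_vpairs small_elts by blast
qed

lemma one_cond: "one = cond {} (elts \<mu>)" by (simp add: cond_def)

lemma prikry_poset: "forcing_poset C prikry_le one"
proof
  show "one \<in> C" unfolding one_cond by (rule condI) (simp_all add: measure_one_all)
  fix p q r :: 'v
  show "prikry_le p p" if "p \<in> C"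
    using that unfolding C_iff by (auto simp: le_cond below_self dest: measure_one_subset)
  show "prikry_le p one" if "p \<in> C"
    using that unfolding C_iff one_cond by (auto simp: le_cond below_def dest: measure_one_subset)
  show "prikry_le p q \<Longrightarrow> prikry_le q r \<Longrightarrow> prikry_le p r" by (rule prikry_trans)
qed (rule small_prikry)

definition code :: "'v set \<Rightarrow> 'v" where
  "code = (SOME f. inj_on f {s. s \<subseteq> elts \<mu> \<and> finite s} \<and> f ` {s. s \<subseteq> elts \<mu> \<and> finite s} \<subseteq> elts \<mu>)"

lemma code: "inj_on code {s. s \<subseteq> elts \<mu> \<and> finite s}" "code ` {s. s \<subseteq> elts \<mu> \<and> finite s} \<subseteq> elts \<mu>"
proof -
  have "\<exists>f. inj_on f {s. s \<subseteq> elts \<mu> \<and> finite s} \<and> f ` {s. s \<subseteq> elts \<mu> \<and> finite s} \<subseteq> elts \<mu>"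
    using card_of_finite_subsets[OF inf_mu] unfolding card_of_ordLeq .
  from someI_ex[OF this] show "inj_on code {s. s \<subseteq> elts \<mu> \<and> finite s}" "code ` {s. s \<subseteq> elts \<mu> \<and> finite s} \<subseteq> elts \<mu>"
    unfolding code_def by blast+
qed

definition stem :: "'v \<Rightarrow> 'v" where
  "stem p = code (elts (THE a. \<exists>X. p = vpair a X))"

lemma stem_cond: "s \<subseteq> elts \<mu> \<Longrightarrow> stem (cond s A) = code s"
  unfolding stem_def cond_def by (simp add: small_sub)

text \<open>Equal codes mean equal finite stems, as \<open>code\<close> is injective. Conditions
  with one stem differ only in their measure one sets, and fewer than \<mu> of these have an
  intersection of measure one.\<close>

lemma prikry_centered: "centered_forcing C prikry_le one \<mu> stem"
proof -
  interpret forcing_poset C prikry_le one by (rule prikry_poset)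
  show ?thesis
  proof
    show "ordinal \<mu>" "infinite (elts \<mu>)" by (fact ord_mu inf_mu)+
    show "stem p \<in> elts \<mu>" if "p \<in> C" for p
      using that code(2) unfolding C_iff by (auto simp: stem_cond)
    fix A s assume A: "A \<subseteq> C" "A \<noteq> {}" "|A| <o |elts \<mu>|" "\<forall>p\<in>A. stem p = s"
    obtain p0 where p0: "p0 \<in> A" using A by blast
    then obtain a X0 where a: "p0 = cond a X0" "finite a" "a \<subseteq> elts \<mu>" using A(1) C_iff by blast
    have "\<exists>X. measure_one X \<and> p = cond a X" if p: "p \<in> A" for p
    proof -
      obtain b X where b: "p = cond b X" "finite b" "b \<subseteq> elts \<mu>" "measure_one X" using A(1) p C_iff by blast
      have "code b = code a" using A(4) p p0 a b by (metis stem_cond)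
      then have "b = a" using code(1) a b unfolding inj_on_def by blast
      then show ?thesis using b by blast
    qed
    then obtain X where X: "\<And>p. p \<in> A \<Longrightarrow> measure_one (X p) \<and> p = cond a (X p)" by metis
    define Z where "Z = {z \<in> elts \<mu>. \<forall>p\<in>A. z \<in> X p}"
    have Z: "measure_one Z" unfolding Z_def by (rule measure_one_Inter[OF A(3)]) (use X in blast)
    have "prikry_le (cond a Z) p" if p: "p \<in> A" for p
    proof -
      have "prikry_le (cond a Z) (cond a (X p))"
        using a X[OF p] p by (subst le_cond) (auto simp: below_self Z_def dest: measure_one_subset)
      then show ?thesis using X[OF p] by simp
    qed
    moreover have "stem (cond a Z) = s" using stem_cond a p0 A(4) by metis
    ultimately show "\<exists>r\<in>C. stem r = s \<and> (\<forall>p\<in>A. prikry_le r p)" using condI[OF a(2,3) Z] by blast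
  qed
qed

sublocale centered_forcing C prikry_le one \<mu> stem by (rule prikry_centered)

subsection \<open>Deciding many statements at once\<close>

text \<open>An iterated measure quantifier: for almost all \<open>\<xi>1\<close>, for almost all
  \<open>\<xi>2\<close>, and so on for n points, the enlarged stem satisfies E together with some
  measure one set. Almost all points lie above a given finite stem, so the added points are
  increasing up to null sets.\<close>

primrec decided_in :: "('v \<Rightarrow> bool) \<Rightarrow> nat \<Rightarrow> 'v set \<Rightarrow> bool" where
  "decided_in E 0 s \<longleftrightarrow> (\<exists>Z. measure_one Z \<and> E (cond s Z))"
| "decided_in E (Suc n) s \<longleftrightarrow> measure_one {\<xi> \<in> elts \<mu>. decided_in E n (insert \<xi> s)}"

text \<open>If no n works, a is bad, and a bad stem stays bad for almost every added point, since
  only countably many n are involved. A diagonal intersection Y of these sets makes all extensions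
  of a with points from Y bad: remove the largest point and apply induction. But density provides an
  extension of the condition with stem a and set Y that satisfies E, and its stem is decided with n
  = 0.\<close>

lemma decided_in_some:
  assumes a: "finite a" "a \<subseteq> elts \<mu>" and Y0: "measure_one Y0"
    and dense: "dense_below (cond a Y0) E"
  shows "\<exists>n. decided_in E n a"
proof (rule ccontr)
  assume bad_a: "\<not> ?thesis"
  define bad where "bad s \<longleftrightarrow> (\<forall>n. \<not> decided_in E n s)" for s
  have bad_step: "measure_one {\<xi> \<in> elts \<mu>. bad (insert \<xi> s)}" if s: "bad s" for s
  proof -
    have "measure_one (elts \<mu> - {\<xi> \<in> elts \<mu>. decided_in E n (insert \<xi> s)})" for n
      using s unfolding bad_def by (subst measure_one_compl) (auto simp flip: decided_in.simps(2))
    from measure_one_Inter_nat[OF this] show ?thesis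
      by (rule measure_one_mono) (auto simp: bad_def)
  qed
  define X where "X s = (if bad s then {\<xi> \<in> elts \<mu>. bad (insert \<xi> s)} else elts \<mu>)" for s
  have mX: "measure_one (X s)" if "finite s" "s \<subseteq> elts \<mu>" for s using bad_step measure_one_all by (simp add: X_def)
  define Y where "Y = {z \<in> elts \<mu>. \<forall>s. finite s \<longrightarrow> s \<subseteq> elts z \<longrightarrow> z \<in> X s} \<inter> Y0"
  have Y: "measure_one Y" unfolding Y_def
    by (rule measure_one_Int[OF measure_one_diagonal_finite[OF mX] Y0])
  have all_bad: "bad s" if "finite s" "s \<subseteq> elts \<mu>" "s \<inter> below a = a" "s - a \<subseteq> Y" for s
    using that
  proof (induction "card s" arbitrary: s rule: less_induct)
    case less
    show ?case
    proof (cases "s = a")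
      case True then show ?thesis using bad_a unfolding bad_def by blast
    next
      case False
      have as: "a \<subseteq> s" using less.prems by blast
      then have "s \<noteq> {}" using False by blast
      then obtain m where m: "m \<in> s" "\<forall>y\<in>s. y = m \<or> y \<in> elts m"
        using finite_max_elt[OF ord_mu less.prems(1) _ less.prems(2)] by blast
      \<comment> \<open>If the largest point of s were in a, all of s would lie below max a + 1, and
        s would be a.\<close>
      have "m \<notin> a"
      proof
        assume "m \<in> a"
        then have "s \<subseteq> below a" using m(2) unfolding below_def by blast
        then show False using less.prems(3) False by blast
      qed
      then have mY: "m \<in> Y" using m less.prems by blast
      have "bad (s - {m})"
      proof (rule less.hyps)
        show "card (s - {m}) < card s" by (rule card_Diff1_less[OF less.prems(1) m(1)])
        show "(s - {m}) \<inter> below a = a" using less.prems(3) \<open>m \<notin> a\<close> by blast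
      qed (use less.prems in auto)
      moreover have "m \<in> X (s - {m})" using mY m less.prems unfolding Y_def by auto
      ultimately have "bad (insert m (s - {m}))" by (simp add: X_def)
      then show ?thesis using m by (simp add: insert_absorb)
    qed
  qed
  have "cond a Y \<in> C" by (rule condI[OF a Y])
  moreover have "prikry_le (cond a Y) (cond a Y0)"
    using a measure_one_subset[OF Y] measure_one_subset[OF Y0] by (subst le_cond) (auto simp: below_self Y_def)
  ultimately obtain r where r: "r \<in> C" "prikry_le r (cond a Y)" "E r" using dense by (meson dense_belowE)
  obtain s Z where s: "r = cond s Z" "finite s" "s \<subseteq> elts \<mu>" "measure_one Z" using r(1) C_iff by blast
  have "s \<inter> below a = a" "s - a \<subseteq> Y"
    using r(2) s a measure_one_subset[OF Y] measure_one_subset[OF s(4)] by (simp_all add: le_cond)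
  then have "bad s" using all_bad s by blast
  then have "\<not> decided_in E 0 s" unfolding bad_def by blast
  then show False using s r(3) by auto
qed

text \<open>The same points serve all i in I: at each of the n steps fewer than \<mu> measure one
  sets are intersected, together with \<open>Y0\<close> and the set of points above the current
  stem.\<close>

lemma decided_in_extension:
  assumes "finite a" "a \<subseteq> elts \<mu>" and Y0: "measure_one Y0"
    and I: "|I| <o |elts \<mu>|" and "\<forall>i\<in>I. decided_in (E i) n a"
  shows "\<exists>s. finite s \<and> s \<subseteq> elts \<mu> \<and> s \<inter> below a = a \<and> s - a \<subseteq> Y0 \<and> (\<forall>i\<in>I. decided_in (E i) 0 s)"
  using assms(1,2,5)
proof (induction n arbitrary: a)
  case 0
  then show ?case by (intro exI[of _ a]) (auto simp: below_self)
next
  case (Suc n)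
  have "measure_one {z \<in> elts \<mu>. \<forall>i\<in>I. z \<in> {\<xi> \<in> elts \<mu>. decided_in (E i) n (insert \<xi> a)}}"
    by (rule measure_one_Inter[OF I]) (use Suc.prems(3) in simp)
  from measure_one_nonempty[OF measure_one_Int[OF measure_one_Int[OF this Y0] measure_one_above_finite[OF Suc.prems(1,2)]]]
  obtain \<xi> where \<xi>: "\<xi> \<in> elts \<mu>" "\<xi> \<in> Y0" "a \<subseteq> elts \<xi>" "\<forall>i\<in>I. decided_in (E i) n (insert \<xi> a)" by blast
  from Suc.IH[of "insert \<xi> a"] Suc.prems \<xi> obtain s where
    s: "finite s" "s \<subseteq> elts \<mu>" "s \<inter> below (insert \<xi> a) = insert \<xi> a" "s - insert \<xi> a \<subseteq> Y0" "\<forall>i\<in>I. decided_in (E i) 0 s"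
    by auto
  have o: "ordinal \<xi>" using ordinal_elt[OF ord_mu \<xi>(1)] .
  \<comment> \<open>The new point lies above all of a, so a remains an initial segment of the
    enlarged stem.\<close>
  have "\<xi> \<notin> below a"
    unfolding below_def using \<xi>(3) ordinal_trans[OF o] elts_irrefl by blast
  moreover have b: "below a \<subseteq> below (insert \<xi> a)" "a \<subseteq> below a" unfolding below_def by auto
  ultimately have "s \<inter> below a \<subseteq> a" using s(3) by auto
  moreover have "a \<subseteq> s" using s(3) by blast
  ultimately have "s \<inter> below a = a" using b(2) by blast
  then show ?case using s \<xi> by (intro exI[of _ s]) auto
qed

lemma decide_uncountable:
  assumes \<nu>: "\<nu> \<in> elts \<mu>" "regular_cardinal \<nu>" "uncountable (elts \<nu>)" and p: "p \<in> C"
    and mono: "\<And>s t i. E s i \<Longrightarrow> prikry_le t s \<Longrightarrow> E t i"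
    and dense: "\<And>i. i \<in> elts \<nu> \<Longrightarrow> dense_below p (\<lambda>s. E s i)"
  shows "\<exists>q\<in>C. prikry_le q p \<and> |{i \<in> elts \<nu>. E q i}| =o |elts \<nu>|"
proof -
  obtain a Y0 where a: "p = cond a Y0" "finite a" "a \<subseteq> elts \<mu>" "measure_one Y0" using p C_iff by blast
  have "\<exists>n. decided_in (\<lambda>s. E s i) n a" if "i \<in> elts \<nu>" for i
    by (rule decided_in_some[OF a(2-4)]) (use dense[OF that] a in simp)
  then obtain N where N: "\<And>i. i \<in> elts \<nu> \<Longrightarrow> decided_in (\<lambda>s. E s i) (N i) a" by metis
  obtain n where n: "|{i \<in> elts \<nu>. N i = n}| =o |elts \<nu>|" using regular_pigeonhole_nat[OF \<nu>(2,3)] by blast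
  define I where "I = {i \<in> elts \<nu>. N i = n}"
  have I: "|I| <o |elts \<mu>|"
    using n cardinal_elt_less[OF cardinal_mu \<nu>(1)] ordIso_ordLess_trans unfolding I_def by blast
  have "\<forall>i\<in>I. decided_in (\<lambda>s. E s i) n a" using N unfolding I_def by blast
  from decided_in_extension[OF a(2-4) I this] obtain s where
    s: "finite s" "s \<subseteq> elts \<mu>" "s \<inter> below a = a" "s - a \<subseteq> Y0" "\<forall>i\<in>I. decided_in (\<lambda>s. E s i) 0 s" by blast
  then have "\<forall>i\<in>I. \<exists>Z. measure_one Z \<and> E (cond s Z) i" by simp
  from bchoice[OF this] obtain Z where Z: "\<And>i. i \<in> I \<Longrightarrow> measure_one (Z i) \<and> E (cond s (Z i)) i" by blast
  \<comment> \<open>The deciding conditions share the stem s and differ only in their measure one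
    sets; as I is smaller than \<mu>, one set lies below all of these and below
    \<open>Y0\<close>.\<close>
  define Y where "Y = {z \<in> elts \<mu>. \<forall>i\<in>I. z \<in> Z i} \<inter> Y0"
  have Y: "measure_one Y" unfolding Y_def by (intro measure_one_Int measure_one_Inter[OF I] a(4)) (use Z in blast)
  have q: "cond s Y \<in> C" by (rule condI[OF s(1,2) Y])
  have "prikry_le (cond s Y) p" unfolding a(1)
    by (subst le_cond) (use s a measure_one_subset[OF Y] measure_one_subset[OF a(4)] in \<open>auto simp: Y_def\<close>)
  moreover have "E (cond s Y) i" if i: "i \<in> I" for i
  proof (rule mono)
    show "E (cond s (Z i)) i" using Z[OF i] by blast
    show "prikry_le (cond s Y) (cond s (Z i))"
      using s Z[OF i] i measure_one_subset[OF Y] by (subst le_cond) (auto simp: Y_def below_self dest: measure_one_subset)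
  qed
  then have "I \<subseteq> {i \<in> elts \<nu>. E (cond s Y) i}" unfolding I_def by blast
  then have "|elts \<nu>| \<le>o |{i \<in> elts \<nu>. E (cond s Y) i}|"
    using card_of_mono1[of I] n unfolding I_def[symmetric] by (meson ordIso_symmetric ordIso_ordLeq_trans)
  moreover have "|{i \<in> elts \<nu>. E (cond s Y) i}| \<le>o |elts \<nu>|" by (rule card_of_mono1) auto
  ultimately show ?thesis using q by (meson ordIso_iff_ordLeq)
qed

text \<open>Finite \<nu> and \<omega> belong to the countable case; the diagonal intersections enter
  through the uncountable regular one.\<close>

lemma frc_not_polarized_prikry:
  assumes s: "holds (succ_cardinal_fm m1 \<mu>)"
    and np: "\<not> holds (polarized_fm m2 m1 \<nu> m1 \<mu>)" and p: "p \<in> C"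
    and \<nu>: "countable (elts \<nu>) \<or> \<nu> \<in> elts \<mu> \<and> regular_cardinal \<nu>"
  shows "forces C prikry_le (Neg (polarized_fm (check one m2) (check one m1) (check one \<nu>) (check one m1) (check one \<mu>))) p"
proof (rule frc_not_polarized[OF s np p])
  fix J :: "'v set" and t :: "'v \<Rightarrow> nat \<Rightarrow> 'v"
  assume "\<not> |J| \<le>o |elts \<mu>|" "\<And>j n. j \<in> J \<Longrightarrow> t j n \<in> elts \<mu>"
  then show "\<exists>J'\<subseteq>J. \<not> |J'| \<le>o |elts \<mu>| \<and> (\<forall>i\<in>J'. \<forall>j\<in>J'. t i = t j)" by (rule sequence_pigeonhole)
next
  fix p E assume E: "p \<in> C" "\<And>s t i. E s i \<Longrightarrow> prikry_le t s \<Longrightarrow> E t i" "\<And>i. i \<in> elts \<nu> \<Longrightarrow> dense_below p (\<lambda>s. E s i)"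
  show "\<exists>q. (\<forall>n::nat. q n \<in> C \<and> prikry_le (q (Suc n)) (q n)) \<and> prikry_le (q 0) p \<and>
    |{i \<in> elts \<nu>. \<exists>n. E (q n) i}| =o |elts \<nu>|"
  proof (cases "countable (elts \<nu>)")
    case True
    then show ?thesis by (rule decide_countable[where E = E, OF _ E])
  next
    case False
    have "\<exists>q\<in>C. prikry_le q p \<and> |{i \<in> elts \<nu>. E q i}| =o |elts \<nu>|"
      by (rule decide_uncountable[where E = E, OF _ _ False E]) (use \<nu> False in auto)
    then obtain q where q: "q \<in> C" "prikry_le q p" "|{i \<in> elts \<nu>. E q i}| =o |elts \<nu>|" by blast
    \<comment> \<open>A single condition already decides enough, so the constant sequence
      serves.\<close>
    then show ?thesis using le_refl[OF q(1)] by (intro exI[of _ "\<lambda>_. q"]) simp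
  qed
qed

section \<open>The three kinds of relations for Prikry forcing\<close>

lemma prikry_forces_arrow:
  assumes "|elts \<nu>| <o |elts \<mu>|" "holds (arrow_fm \<mu> \<nu>)"
  shows "prikry_forces \<mu> U (arrow_fm (prikry_check \<mu> \<mu>) (prikry_check \<mu> \<nu>))"
proof -
  obtain m1 m2 where s: "holds (succ_cardinal_fm m1 \<mu>)" "holds (succ_cardinal_fm m2 m1)"
    and "holds (polarized_fm m2 m1 \<nu> m1 \<mu>)"
    using assms(2) by (auto simp: arrow_fm_def with_successors_def)
  then show ?thesis
    unfolding prikry_forces_def prikry_check_def arrow_fm_def
    by (intro ballI frc_with_successors[OF _ s] frc_polarized[OF s assms(1)])
qed

lemma prikry_forces_not_arrow:
  assumes "countable (elts \<nu>) \<or> \<nu> \<in> elts \<mu> \<and> regular_cardinal \<nu>" "holds (not_arrow_fm \<mu> \<nu>)"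
  shows "prikry_forces \<mu> U (not_arrow_fm (prikry_check \<mu> \<mu>) (prikry_check \<mu> \<nu>))"
proof -
  obtain m1 m2 where s: "holds (succ_cardinal_fm m1 \<mu>)" "holds (succ_cardinal_fm m2 m1)"
    and "\<not> holds (polarized_fm m2 m1 \<nu> m1 \<mu>)"
    using assms(2) by (auto simp: not_arrow_fm_def with_successors_def)
  then show ?thesis
    unfolding prikry_forces_def prikry_check_def not_arrow_fm_def
    by (intro ballI frc_with_successors[OF _ s] frc_not_polarized_prikry[OF s(1) _ _ assms(1)])
qed

lemma prikry_forces_not_arrow_succ:
  assumes "holds (not_arrow_succ_fm \<mu>)"
  shows "prikry_forces \<mu> U (not_arrow_succ_fm (prikry_check \<mu> \<mu>))"
proof -
  obtain m1 m2 where s: "holds (succ_cardinal_fm m1 \<mu>)" "holds (succ_cardinal_fm m2 m1)"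
    and "\<not> holds (polarized_fm m2 m1 m1 m1 \<mu>)"
    using assms by (auto simp: not_arrow_succ_fm_def with_successors_def)
  then show ?thesis
    unfolding prikry_forces_def prikry_check_def not_arrow_succ_fm_def
    by (intro ballI frc_with_successors[OF _ s] frc_not_polarized_succ[OF s(1)])
qed

end

theorem theorem1p3:
  fixes \<mu> U :: "'v::zfc"
  assumes "measurable_cardinal \<mu>"
    and "normal_ultrafilter \<mu> U"
  shows "(\<forall>n. holds (arrow_fm \<mu> (vnat n)) \<longrightarrow>
            prikry_forces \<mu> U (arrow_fm (prikry_check \<mu> \<mu>) (prikry_check \<mu> (vnat n)))) \<and>
         (\<forall>\<nu>\<in>elts \<mu>. regular_cardinal \<nu> \<and> holds (arrow_fm \<mu> \<nu>) \<longrightarrow>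
            prikry_forces \<mu> U (arrow_fm (prikry_check \<mu> \<mu>) (prikry_check \<mu> \<nu>))) \<and>
         (\<forall>n. holds (not_arrow_fm \<mu> (vnat n)) \<longrightarrow>
            prikry_forces \<mu> U (not_arrow_fm (prikry_check \<mu> \<mu>) (prikry_check \<mu> (vnat n)))) \<and>
         (\<forall>\<nu>\<in>elts \<mu>. regular_cardinal \<nu> \<and> holds (not_arrow_fm \<mu> \<nu>) \<longrightarrow>
            prikry_forces \<mu> U (not_arrow_fm (prikry_check \<mu> \<mu>) (prikry_check \<mu> \<nu>))) \<and>
         (holds (not_arrow_succ_fm \<mu>) \<longrightarrow>
            prikry_forces \<mu> U (not_arrow_succ_fm (prikry_check \<mu> \<mu>)))"
proof -
  interpret prikry_forcing \<mu> U
    using assms by unfold_locales (simp_all add: measurable_cardinal_def)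
  have fin: "finite (elts (vnat n :: 'v))" for n by (simp add: elts_vnat)
  show ?thesis
  proof (intro conjI allI ballI impI, goal_cases)
    case (1 n)
    then show ?case by (rule prikry_forces_arrow[OF finite_less_mu[OF fin]])
  next
    case (2 \<nu>)
    then show ?case using prikry_forces_arrow[OF cardinal_elt_less[OF cardinal_mu]] by simp
  next
    case (3 n)
    then show ?case using prikry_forces_not_arrow countable_finite[OF fin] by simp
  next
    case (4 \<nu>)
    then show ?case using prikry_forces_not_arrow by simp
  next
    case 5
    then show ?case by (rule prikry_forces_not_arrow_succ)
  qed
qed

end
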